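(* Let $\{X_i\}_{i=-\infty}^\infty$ be a $\beta$-mixing sequence with values in $\mathcal X$ and let $\Xi_{i,n}=\Xi_n(X_i)$ for each $i$, where $\Xi_n:\mathcal X\to\mathbb R^{d_1\times d_2}$ is a sequence of measurable $d_1\times d_2$ matrix-valued functions (the dimensions $d_1,d_2$ may depend on $n$). Assume $E[\Xi_{i,n}]=0$ and $\|\Xi_{i,n}\|\le R_n$ for each $i$, and define $s_n^2=\max_{1\le i,j\le n}\max\{\|E[\Xi_{i,n}\Xi_{j,n}']\|,\|E[\Xi_{i,n}'\Xi_{j,n}]\|\}$. If $q=q(n)$ is an integer between $1$ and $n/2$ chosen such that $\frac nq\beta(q)=o(1)$ and $R_n\sqrt{q\log(d_1+d_2)}=o(s_n\sqrt n)$, then $$\left\|\sum_{i=1}^n\Xi_{i,n}\right\|=O_p\big(s_n\sqrt{nq\log(d_1+d_2)}\big).$$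
   Context: Asymptotics are as $n\to\infty$. $\|\cdot\|$ is the spectral norm (largest singular value); $'$ is transpose. $\beta$-mixing coefficients: for $\sigma$-algebras $\mathcal A,\mathcal B$, $\beta(\mathcal A,\mathcal B)=\frac12\sup\sum_{(i,j)\in I\times J}|\mathbb P(A_i\cap B_j)-\mathbb P(A_i)\mathbb P(B_j)|$, the supremum being over all finite partitions $\{A_i\}_{i\in I}\subset\mathcal A$ and $\{B_j\}_{j\in J}\subset\mathcal B$ of the sample space; $\beta(q)=\sup_i\beta(\sigma(\ldots,X_{i-1},X_i),\sigma(X_{i+q},X_{i+q+1},\ldots))$. The sequence is $\beta$-mixing if $\beta(q)\to0$ as $q\to\infty$. The sequence is not required to be identically distributed. *)

theory Defs
  imports "HOL-Probability.Probability" "HOL-Library.Landau_Symbols"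
    "Jordan_Normal_Form.Char_Poly"
begin

definition singular_values :: "real mat \<Rightarrow> real set" where
  "singular_values A = {sqrt ev |ev. eigenvalue (transpose_mat A * A) ev}"

(* Meaningful when A has at least one row and one column: the spectrum is then
   finite, nonempty and contained in [0, \<infinity>). For wide matrices the set of singular
   values contains additional zeros, which do not affect the maximum. *)
definition spectral_norm :: "real mat \<Rightarrow> real" where
  "spectral_norm A = Max (singular_values A)"

(* HOL-Probability has no integral and no big sum for matrices whose dimensions are
   natural numbers rather than types; both are taken entrywise. *)
definition mat_expectation ::
  "'a measure \<Rightarrow> nat \<Rightarrow> nat \<Rightarrow> ('a \<Rightarrow> real mat) \<Rightarrow> real mat" where
  "mat_expectation M r c A = Matrix.mat r c (\<lambda>(k, l). \<integral>\<omega>. A \<omega> $$ (k, l) \<partial>M)"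

definition mat_sum :: "nat \<Rightarrow> nat \<Rightarrow> ('i \<Rightarrow> real mat) \<Rightarrow> 'i set \<Rightarrow> real mat" where
  "mat_sum r c A I = Matrix.mat r c (\<lambda>(k, l). \<Sum>i\<in>I. A i $$ (k, l))"

definition sigma_generated ::
  "'a measure \<Rightarrow> 'x measure \<Rightarrow> ('i \<Rightarrow> 'a \<Rightarrow> 'x) \<Rightarrow> 'i set \<Rightarrow> 'a set set" where
  "sigma_generated M S X J =
     sigma_sets (space M) (\<Union>j\<in>J. {X j -` B \<inter> space M |B. B \<in> sets S})"

(* The cells of partition_on are nonempty; empty cells would contribute nothing to
   the double sum. *)
definition finite_partitions :: "'a set \<Rightarrow> 'a set set \<Rightarrow> 'a set set set" where
  "finite_partitions \<Omega> \<A> = {P. partition_on \<Omega> P \<and> finite P \<and> P \<subseteq> \<A>}"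

definition beta_dep :: "'a measure \<Rightarrow> 'a set set \<Rightarrow> 'a set set \<Rightarrow> real" where
  "beta_dep M \<A> \<B> = 1 / 2 *
     (SUP (P, Q) \<in> finite_partitions (space M) \<A> \<times> finite_partitions (space M) \<B>.
        \<Sum>(A, B)\<in>P \<times> Q. \<bar>measure M (A \<inter> B) - measure M A * measure M B\<bar>)"

definition beta_coeff ::
  "'a measure \<Rightarrow> 'x measure \<Rightarrow> (int \<Rightarrow> 'a \<Rightarrow> 'x) \<Rightarrow> nat \<Rightarrow> real" where
  "beta_coeff M S X q =
     (SUP i. beta_dep M (sigma_generated M S X {..i}) (sigma_generated M S X {i + int q..}))"

definition beta_mixing :: "'a measure \<Rightarrow> 'x measure \<Rightarrow> (int \<Rightarrow> 'a \<Rightarrow> 'x) \<Rightarrow> bool" where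
  "beta_mixing M S X \<longleftrightarrow> beta_coeff M S X \<longlonglongrightarrow> 0"

(* The nonnegative s_n, for the array (i, \<omega>) \<mapsto> A i \<omega> of r \<times> c matrices. *)
definition s_coeff ::
  "'a measure \<Rightarrow> nat \<Rightarrow> nat \<Rightarrow> (int \<Rightarrow> 'a \<Rightarrow> real mat) \<Rightarrow> nat \<Rightarrow> real" where
  "s_coeff M r c A n = sqrt (Max ((\<lambda>(i, j).
     max (spectral_norm (mat_expectation M r r (\<lambda>\<omega>. A i \<omega> * transpose_mat (A j \<omega>))))
         (spectral_norm (mat_expectation M c c (\<lambda>\<omega>. transpose_mat (A i \<omega>) * A j \<omega>))))
     ` ({1..int n} \<times> {1..int n})))"

(* Y n = O_p(a n) as n tends to infinity. The strict inequality inside the probability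
   allows a n = 0, in which case Y n is 0 with probability close to 1. *)
definition big_o_p :: "'a measure \<Rightarrow> (nat \<Rightarrow> 'a \<Rightarrow> real) \<Rightarrow> (nat \<Rightarrow> real) \<Rightarrow> bool" where
  "big_o_p M Y a \<longleftrightarrow> (\<forall>\<epsilon>>0. \<exists>C>0. \<forall>\<^sub>F n in sequentially.
     Y n \<in> borel_measurable M \<and> measure M {\<omega> \<in> space M. \<bar>Y n \<omega>\<bar> > C * a n} < \<epsilon>)"

end

theory Submission
  imports Defs
begin

text \<open>
  The sum is cut into consecutive blocks of length \<open>q\<close>, and the blocks of even and of odd number are summed
  separately. Within one of these two sums neighbouring blocks are separated by \<open>q\<close> indices, so that
  replacing a block by an independent copy costs at most \<open>2 \<beta>(q)\<close> in the expectation of a \<open>[0, 1]\<close>-valued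
  function. There are at most \<open>n / q\<close> blocks in each sum, and \<open>(n / q) \<beta>(q) \<rightarrow> 0\<close>. For independent blocks a
  matrix Bernstein bound applies: a block has norm at most \<open>q R\<^sub>n\<close>, and its matrix variance has norm at most
  \<open>q\<^sup>2 s\<^sub>n\<^sup>2\<close>, since it is a sum of at most \<open>q\<^sup>2\<close> cross moments, each of norm at most \<open>s\<^sub>n\<^sup>2\<close>. The variances
  add up to at most \<open>n q s\<^sub>n\<^sup>2\<close>, and the assumption on \<open>R\<^sub>n\<close> allows the Laplace transform at
  \<open>\<theta> = sqrt (log (d\<^sub>1 + d\<^sub>2)) / (s\<^sub>n sqrt (n q))\<close>, which gives deviations of the stated order.

  The Bernstein bound rests on one estimate: adding an independent centred symmetric matrix \<open>Y\<close>
  of norm at most \<open>1\<close> to a symmetric matrix \<open>A\<close> multiplies \<open>E tr exp A\<close> by at most \<open>1 + 2 \<parallel>E Y\<^sup>2\<parallel>\<close>. The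
  role usually played here by the Golden-Thompson inequality falls to \<open>trace_exp_perturbation\<close>, the deterministic
  second order bound \<open>tr exp (A + Y) \<le> tr exp A + tr (Y exp A) + 2 tr (Y\<^sup>2 exp A)\<close>. Expanding in orthonormal
  eigenbases of both \<open>A\<close> and \<open>A + Y\<close> turns it into scalar inequalities for \<open>exp\<close>. Rectangular matrices enter
  through their self-adjoint dilation.

  The decoupling works with functions of the partial sums. The indicator of a large
  norm is dominated by a Lipschitz function \<open>F\<close> of the partial sum. Averaging \<open>F\<close> over the last block gives a
  Lipschitz function with the same constant on the previous partial sum, and this is repeated until no block is left
  (\<open>decoupled_iteration\<close>). A single step, \<open>beta_decouple_lipschitz\<close>, rounds both arguments to a finite grid, so
  that the finite partitions in the definition of \<open>\<beta>\<close> suffice. The bound \<open>F \<le> const * tr exp (\<theta> \<cdot>)\<close> is carried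
  along through the same averages.
\<close>

section \<open>Orthonormal eigensystems of symmetric matrices\<close>

text \<open>
  Vectors are functions and matrices are functions on pairs, read only on finite index sets. The dimension can then
  vary within one statement, and the dilation of a rectangular matrix is indexed by a disjoint union without renumbering.
\<close>
definition ip :: "'i set \<Rightarrow> ('i \<Rightarrow> real) \<Rightarrow> ('i \<Rightarrow> real) \<Rightarrow> real" where
  "ip I x y = (\<Sum>k\<in>I. x k * y k)"

definition mv :: "'j set \<Rightarrow> ('i \<times> 'j \<Rightarrow> real) \<Rightarrow> ('j \<Rightarrow> real) \<Rightarrow> 'i \<Rightarrow> real" where
  "mv J A x = (\<lambda>k. \<Sum>l\<in>J. A (k, l) * x l)"

definition symm_on :: "'i set \<Rightarrow> ('i \<times> 'i \<Rightarrow> real) \<Rightarrow> bool" where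
  "symm_on I H \<longleftrightarrow> (\<forall>k\<in>I. \<forall>l\<in>I. H (k, l) = H (l, k))"

text \<open>
  Rows and columns are both required to be orthonormal, so that completeness is part of the definition
  rather than the outcome of a dimension count.
\<close>
definition orthobasis :: "'i set \<Rightarrow> ('i \<Rightarrow> 'i \<Rightarrow> real) \<Rightarrow> bool" where
  "orthobasis I u \<longleftrightarrow>
     (\<forall>i\<in>I. \<forall>j\<in>I. ip I (u i) (u j) = of_bool (i = j)) \<and>
     (\<forall>k\<in>I. \<forall>l\<in>I. (\<Sum>i\<in>I. u i k * u i l) = of_bool (k = l))"

definition eigensystem ::
  "'i set \<Rightarrow> ('i \<times> 'i \<Rightarrow> real) \<Rightarrow> ('i \<Rightarrow> 'i \<Rightarrow> real) \<Rightarrow> ('i \<Rightarrow> real) \<Rightarrow> bool" where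
  "eigensystem I H u e \<longleftrightarrow>
     orthobasis I u \<and> (\<forall>i\<in>I. \<forall>k\<in>I. mv I H (u i) k = e i * u i k)"

lemma ip_commute: "ip I x y = ip I y x"
  by (simp add: ip_def mult.commute)

lemma ip_cong: "(\<And>k. k \<in> I \<Longrightarrow> x k = x' k) \<Longrightarrow> (\<And>k. k \<in> I \<Longrightarrow> y k = y' k) \<Longrightarrow> ip I x y = ip I x' y'"
  unfolding ip_def by (rule sum.cong) auto

lemma ip_add_left: "ip I (\<lambda>k. x k + y k) z = ip I x z + ip I y z"
  by (simp add: ip_def sum.distrib algebra_simps)

lemma ip_add_right: "ip I z (\<lambda>k. x k + y k) = ip I z x + ip I z y"
  by (simp add: ip_def sum.distrib algebra_simps)

lemma ip_diff_right: "ip I z (\<lambda>k. x k - y k) = ip I z x - ip I z y"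
  by (simp add: ip_def sum_subtractf algebra_simps)

lemma ip_diff_left: "ip I (\<lambda>k. x k - y k) z = ip I x z - ip I y z"
  by (simp add: ip_def sum_subtractf algebra_simps)

lemma ip_scale_left: "ip I (\<lambda>k. c * x k) z = c * ip I x z"
  by (simp add: ip_def sum_distrib_left mult_ac)

lemma ip_scale_right: "ip I z (\<lambda>k. c * x k) = c * ip I z x"
  by (simp add: ip_def sum_distrib_left mult_ac)

lemma ip_sum_right: "ip I z (\<lambda>k. \<Sum>j\<in>J. y j k) = (\<Sum>j\<in>J. ip I z (y j))"
  unfolding ip_def sum_distrib_left by (rule sum.swap)

lemma ip_self_nonneg: "0 \<le> ip I x x"
  unfolding ip_def by (intro sum_nonneg) simp

lemma mv_add: "mv J A (\<lambda>k. x k + y k) = (\<lambda>k. mv J A x k + mv J A y k)"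
  by (simp add: mv_def sum.distrib algebra_simps)

lemma mv_diff: "mv J A (\<lambda>k. x k - y k) = (\<lambda>k. mv J A x k - mv J A y k)"
  by (simp add: mv_def sum_subtractf algebra_simps)

lemma mv_scale: "mv J A (\<lambda>k. c * x k) = (\<lambda>k. c * mv J A x k)"
  by (simp add: mv_def sum_distrib_left mult_ac)

lemma ip_mv_transpose: "ip I x (mv J A y) = ip J (mv I (\<lambda>(l, k). A (k, l)) x) y"
proof -
  have "ip I x (mv J A y) = (\<Sum>k\<in>I. \<Sum>l\<in>J. x k * (A (k, l) * y l))"
    by (simp add: ip_def mv_def sum_distrib_left)
  also have "\<dots> = (\<Sum>l\<in>J. \<Sum>k\<in>I. x k * (A (k, l) * y l))"
    by (rule sum.swap)
  also have "\<dots> = ip J (mv I (\<lambda>(l, k). A (k, l)) x) y"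
    unfolding ip_def mv_def sum_distrib_right by (simp add: mult_ac)
  finally show ?thesis .
qed

lemma ip_mv_symm: "symm_on I H \<Longrightarrow> ip I x (mv I H y) = ip I (mv I H x) y"
proof -
  assume H: "symm_on I H"
  have "ip I (mv I (\<lambda>(l, k). H (k, l)) x) y = ip I (mv I H x) y"
    using H by (intro ip_cong) (auto simp: mv_def symm_on_def intro!: sum.cong)
  then show ?thesis
    by (simp add: ip_mv_transpose)
qed

lemma orthobasis_expand:
  assumes "finite I" "orthobasis I u" "k \<in> I"
  shows "(\<Sum>i\<in>I. ip I (u i) x * u i k) = x k"
proof -
  have "(\<Sum>i\<in>I. ip I (u i) x * u i k) = (\<Sum>i\<in>I. \<Sum>l\<in>I. x l * (u i k * u i l))"
    unfolding ip_def sum_distrib_right by (simp add: mult_ac)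
  also have "\<dots> = (\<Sum>l\<in>I. x l * (\<Sum>i\<in>I. u i k * u i l))"
    by (subst sum.swap) (simp add: sum_distrib_left)
  also have "\<dots> = (\<Sum>l\<in>I. x l * of_bool (k = l))"
    using assms by (intro sum.cong) (auto simp: orthobasis_def)
  also have "\<dots> = x k"
    using assms by (simp add: of_bool_def if_distrib cong: if_cong)
  finally show ?thesis .
qed

lemma parseval:
  assumes "finite I" "orthobasis I u"
  shows "(\<Sum>i\<in>I. ip I (u i) x * ip I (u i) y) = ip I x y"
proof -
  have "ip I x y = ip I y (\<lambda>k. \<Sum>i\<in>I. ip I (u i) x * u i k)"
    using orthobasis_expand[OF assms] by (subst ip_commute) (auto intro!: ip_cong)
  also have "\<dots> = (\<Sum>i\<in>I. ip I (u i) x * ip I (u i) y)"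
    by (simp add: ip_sum_right ip_scale_right ip_commute)
  finally show ?thesis by simp
qed

lemma parseval_self:
  assumes "finite I" "orthobasis I u"
  shows "(\<Sum>i\<in>I. (ip I (u i) x)\<^sup>2) = ip I x x"
  using parseval[OF assms, of x x] by (simp add: power2_eq_square)

text \<open>
  Tychonoff's theorem for the function type with its product topology.
\<close>
lemma compact_product_box:
  fixes A :: "'i \<Rightarrow> 'b::topological_space set"
  assumes "\<And>i. compact (A i)"
  shows "compact {f. \<forall>i. f i \<in> A i}"
proof -
  have "compactin (product_topology (\<lambda>i. euclidean) UNIV) (Pi\<^sub>E UNIV A)"
    using assms by (subst compactin_PiE) auto
  moreover have "Pi\<^sub>E UNIV A = {f. \<forall>i. f i \<in> A i}"
    by (auto simp: PiE_def Pi_def)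
  ultimately show ?thesis
    by (simp add: euclidean_product_topology)
qed

lemma continuous_on_entry:
  "continuous_on A (\<lambda>u :: 'a \<Rightarrow> 'b \<Rightarrow> real. u i k)"
proof -
  have "continuous_on A (\<lambda>u :: 'a \<Rightarrow> 'b \<Rightarrow> real. u i)"
    by (rule continuous_on_product_then_coordinatewise[OF continuous_on_id])
  then show ?thesis
    by (rule continuous_on_product_then_coordinatewise)
qed

text \<open>
  The vanishing of all entries outside \<open>I \<times> I\<close> makes this set compact in the full function space.
\<close>
definition basis_box :: "'i set \<Rightarrow> ('i \<Rightarrow> 'i \<Rightarrow> real) set" where
  "basis_box I = {u. \<forall>i k. u i k \<in> (if i \<in> I \<and> k \<in> I then {-1..1} else {0})}"

lemma compact_orthobases:
  assumes "finite I"
  shows "compact (basis_box I \<inter> {u. orthobasis I u})"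
proof -
  have "compact {u :: 'a \<Rightarrow> 'a \<Rightarrow> real. \<forall>i. u i \<in> {f. \<forall>k. f k \<in> (if i \<in> I \<and> k \<in> I then {-1..1} else {0})}}"
    by (intro compact_product_box) auto
  then have 1: "compact (basis_box I)"
    by (simp add: basis_box_def)
  have "{u. orthobasis I u} =
     (\<Inter>i\<in>I. \<Inter>j\<in>I. {u. (\<Sum>k\<in>I. u i k * u j k) = of_bool (i = j)}) \<inter>
     (\<Inter>k\<in>I. \<Inter>l\<in>I. {u. (\<Sum>i\<in>I. u i k * u i l) = of_bool (k = l)})"
    by (auto simp: orthobasis_def ip_def)
  moreover have "closed \<dots>"
    by (intro closed_Int closed_INT ballI closed_Collect_eq continuous_intros continuous_on_entry)
  ultimately have "closed {u. orthobasis I u}" by simp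
  with 1 show ?thesis by (rule compact_Int_closed)
qed

lemma orthobasis_entry_le_1:
  assumes "finite I" "orthobasis I u" "i \<in> I" "k \<in> I"
  shows "\<bar>u i k\<bar> \<le> 1"
proof -
  have "(u i k)\<^sup>2 \<le> (\<Sum>l\<in>I. (u i l)\<^sup>2)"
    using assms by (intro member_le_sum) auto
  also have "\<dots> = 1"
    using assms by (auto simp: orthobasis_def ip_def power2_eq_square)
  finally show ?thesis
    by (simp add: abs_square_le_1)
qed

text \<open>
  A Givens rotation in the plane of the \<open>p\<close>-th and \<open>q\<close>-th basis vectors.
\<close>
definition rotate_pair :: "'i \<Rightarrow> 'i \<Rightarrow> real \<Rightarrow> real \<Rightarrow> ('i \<Rightarrow> 'i \<Rightarrow> real) \<Rightarrow> 'i \<Rightarrow> 'i \<Rightarrow> real" where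
  "rotate_pair p q c s u = u(p := \<lambda>k. c * u p k + s * u q k, q := \<lambda>k. c * u q k - s * u p k)"

lemma rotate_pair_simps:
  "p \<noteq> q \<Longrightarrow> rotate_pair p q c s u p = (\<lambda>k. c * u p k + s * u q k)"
  "rotate_pair p q c s u q = (\<lambda>k. c * u q k - s * u p k)"
  "i \<noteq> p \<Longrightarrow> i \<noteq> q \<Longrightarrow> rotate_pair p q c s u i = u i"
  by (auto simp: rotate_pair_def)

lemma sum_split_pair:
  fixes f :: "'i \<Rightarrow> real"
  assumes "finite I" "p \<in> I" "q \<in> I" "p \<noteq> q"
  shows "sum f I = f p + f q + sum f (I - {p, q})"
proof -
  have "sum f I = sum f {p, q} + sum f (I - {p, q})"
    using assms by (subst sum.subset_diff[of "{p, q}" I]) auto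
  then show ?thesis using assms by simp
qed

lemma orthobasis_rotate_pair:
  assumes "finite I" "orthobasis I u" "p \<in> I" "q \<in> I" "p \<noteq> q" and cs: "c\<^sup>2 + s\<^sup>2 = 1"
  shows "orthobasis I (rotate_pair p q c s u)"
proof -
  have ip: "ip I (u i) (u j) = of_bool (i = j)" if "i \<in> I" "j \<in> I" for i j
    using assms that by (auto simp: orthobasis_def)
  have cs': "c * c + s * s = 1" "s * s + c * c = 1"
    using cs by (auto simp: power2_eq_square)
  have 1: "ip I (rotate_pair p q c s u i) (rotate_pair p q c s u j) = of_bool (i = j)"
    if ij: "i \<in> I" "j \<in> I" for i j
  proof -
    note s = rotate_pair_simps ip_add_left ip_add_right ip_scale_left ip_scale_right ip_diff_left ip_diff_right ip
    have "i = p \<or> i = q \<or> i \<noteq> p \<and> i \<noteq> q" and "j = p \<or> j = q \<or> j \<noteq> p \<and> j \<noteq> q" by auto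
    then show ?thesis
      using assms(3-5) ij cs'
      by (elim disjE conjE) (simp_all add: s algebra_simps)
  qed
  have 2: "(\<Sum>i\<in>I. rotate_pair p q c s u i k * rotate_pair p q c s u i l) = of_bool (k = l)"
    if kl: "k \<in> I" "l \<in> I" for k l
  proof -
    have "(\<Sum>i\<in>I. rotate_pair p q c s u i k * rotate_pair p q c s u i l)
       = (c * u p k + s * u q k) * (c * u p l + s * u q l) +
         (c * u q k - s * u p k) * (c * u q l - s * u p l)
         + (\<Sum>i\<in>I - {p, q}. u i k * u i l)"
      using assms by (subst sum_split_pair[of I p q]) (auto simp: rotate_pair_simps intro!: sum.cong)
    also have "(c * u p k + s * u q k) * (c * u p l + s * u q l) +
         (c * u q k - s * u p k) * (c * u q l - s * u p l)
       = (c\<^sup>2 + s\<^sup>2) * (u p k * u p l + u q k * u q l)"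
      by (simp add: algebra_simps power2_eq_square)
    also have "\<dots> + (\<Sum>i\<in>I - {p, q}. u i k * u i l) = (\<Sum>i\<in>I. u i k * u i l)"
      using assms by (subst sum_split_pair[of I p q]) auto
    also have "\<dots> = of_bool (k = l)"
      using assms kl by (auto simp: orthobasis_def)
    finally show ?thesis .
  qed
  show ?thesis using 1 2 by (auto simp: orthobasis_def)
qed

text \<open>
  The first order condition at the identity for a function on the circle, obtained from rotations of small angle.
\<close>
lemma rotation_first_order:
  fixes b D :: real
  assumes "\<And>c s. c\<^sup>2 + s\<^sup>2 = 1 \<Longrightarrow> 2 * c * s * b \<le> s\<^sup>2 * D"
  shows "b = 0"
proof (rule ccontr)
  assume b: "b \<noteq> 0"
  define t where "t = b / (\<bar>D\<bar> + 1)"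
  have bt: "b = t * (\<bar>D\<bar> + 1)"
    by (simp add: t_def add_nonneg_eq_0_iff)
  define r where "r = sqrt (1 + t\<^sup>2)"
  have r: "r\<^sup>2 = 1 + t\<^sup>2" "r > 0"
    by (auto simp: r_def add_pos_nonneg)
  have "(1 / r)\<^sup>2 + (t / r)\<^sup>2 = 1"
    using r by (simp add: power_divide flip: add_divide_distrib) (metis r less_irrefl power_zero_numeral zero_less_power)
  from assms[OF this] have "2 * t * b / r\<^sup>2 \<le> t\<^sup>2 * D / r\<^sup>2"
    by (simp add: power_divide power2_eq_square)
  then have "2 * t * b \<le> t\<^sup>2 * D"
    using r(2) by (simp only: divide_le_cancel) (metis r(2) not_less_iff_gr_or_eq zero_less_power)
  also have "\<dots> \<le> t\<^sup>2 * \<bar>D\<bar>"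
    by (intro mult_left_mono) auto
  finally have "t\<^sup>2 * (2 * (\<bar>D\<bar> + 1)) \<le> t\<^sup>2 * \<bar>D\<bar>"
    using bt by (simp add: power2_eq_square mult_ac)
  moreover have "t\<^sup>2 > 0" using b bt by auto
  ultimately show False by (subst (asm) mult_le_cancel_left_pos) auto
qed

text \<open>
  Maximise \<open>\<Sum>i. w\<^sub>i \<langle>u\<^sub>i, H u\<^sub>i\<rangle>\<close> with pairwise distinct weights over the compact set of orthonormal bases. At a
  maximiser, rotating \<open>u\<^sub>p\<close> and \<open>u\<^sub>q\<close> against each other gives the first order condition
  \<open>(w\<^sub>p - w\<^sub>q) \<langle>u\<^sub>p, H u\<^sub>q\<rangle> = 0\<close>. Hence \<open>H\<close> is diagonal in the basis \<open>u\<close>.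
\<close>
lemma spectral_theorem:
  assumes fin: "finite I" and symm: "symm_on I H"
  shows "\<exists>u e. eigensystem I H u e"
proof -
  \<comment> \<open>Any injective numbering of \<open>I\<close> supplies distinct weights.\<close>
  obtain w :: "'a \<Rightarrow> nat" where w: "inj_on w I"
    using finite_imp_inj_to_nat_seg[OF fin] by blast
  define f where "f = (\<lambda>u :: 'a \<Rightarrow> 'a \<Rightarrow> real. \<Sum>i\<in>I. real (w i) * ip I (u i) (mv I H (u i)))"
  define K where "K = basis_box I \<inter> {u. orthobasis I u}"
  have "compact K" using compact_orthobases[OF fin] by (simp add: K_def)
  moreover have "(\<lambda>i k. of_bool (i \<in> I \<and> i = k)) \<in> K"
  proof -
    have "(\<Sum>k\<in>I. of_bool (i \<in> I \<and> i = k) * of_bool (j \<in> I \<and> j = k)) = (of_bool (i = j) :: real)"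
      "(\<Sum>k\<in>I. of_bool (k \<in> I \<and> k = i) * of_bool (k \<in> I \<and> k = j)) = (of_bool (i = j) :: real)"
      if "i \<in> I" "j \<in> I" for i j
    proof -
      have "(\<Sum>k\<in>I. if k = i then of_bool (i = j) else 0) = (of_bool (i = j) :: real)"
        using that fin by simp
      moreover have "(\<Sum>k\<in>I. of_bool (i \<in> I \<and> i = k) * of_bool (j \<in> I \<and> j = k)) = (\<Sum>k\<in>I. if k = i then of_bool (i = j) else 0 :: real)"
        "(\<Sum>k\<in>I. of_bool (k \<in> I \<and> k = i) * of_bool (k \<in> I \<and> k = j)) = (\<Sum>k\<in>I. if k = i then of_bool (i = j) else 0 :: real)"
        by (intro sum.cong refl; use that in auto)+
      ultimately show "(\<Sum>k\<in>I. of_bool (i \<in> I \<and> i = k) * of_bool (j \<in> I \<and> j = k)) = (of_bool (i = j) :: real)"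
        "(\<Sum>k\<in>I. of_bool (k \<in> I \<and> k = i) * of_bool (k \<in> I \<and> k = j)) = (of_bool (i = j) :: real)"
        by simp_all
    qed
    then show ?thesis
      by (auto simp: K_def basis_box_def orthobasis_def ip_def)
  qed
  moreover have "continuous_on K f"
    unfolding f_def ip_def mv_def by (intro continuous_intros continuous_on_entry)
  ultimately obtain u where u: "u \<in> K" "\<And>v. v \<in> K \<Longrightarrow> f v \<le> f u"
    using continuous_attains_sup[of K f] by blast
  have ob: "orthobasis I u" using u by (simp add: K_def)
  have offdiag: "ip I (u p) (mv I H (u q)) = 0"
    if pq: "p \<in> I" "q \<in> I" and wpq: "w q < w p" for p q
  proof -
    have ne: "p \<noteq> q" using wpq by auto
    define a b d where "a = ip I (u p) (mv I H (u p))"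
      and "b = ip I (u p) (mv I H (u q))" and "d = ip I (u q) (mv I H (u q))"
    have b': "ip I (u q) (mv I H (u p)) = b"
      by (simp add: b_def ip_mv_symm[OF symm, of "u p"] ip_commute)
    have "2 * c * s * b \<le> s\<^sup>2 * (a - d)" if cs: "c\<^sup>2 + s\<^sup>2 = 1" for c s
    proof -
      define v where "v = rotate_pair p q c s u"
      have obv: "orthobasis I v"
        unfolding v_def using fin ob pq ne cs by (rule orthobasis_rotate_pair)
      have supp: "v i k = 0" if "i \<notin> I \<or> k \<notin> I" for i k
      proof -
        have "u i k = 0" if "i \<notin> I \<or> k \<notin> I" for i k
          using u(1) that by (auto simp: K_def basis_box_def split: if_splits)
        then show ?thesis using that pq by (auto simp: v_def rotate_pair_def)
      qed
      have "v \<in> K"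
        using obv supp orthobasis_entry_le_1[OF fin obv]
        by (auto simp: K_def basis_box_def abs_le_iff)
      then have "f v \<le> f u" by (rule u)
      moreover have "f v = real (w p) * (c\<^sup>2 * a + 2 * c * s * b + s\<^sup>2 * d)
          + real (w q) * (s\<^sup>2 * a - 2 * c * s * b + c\<^sup>2 * d)
          + (\<Sum>i\<in>I - {p, q}. real (w i) * ip I (u i) (mv I H (u i)))"
      proof -
        have vp: "ip I (v p) (mv I H (v p)) = c\<^sup>2 * a + 2 * c * s * b + s\<^sup>2 * d"
          using ne b' unfolding v_def a_def b_def d_def
          by (simp add: rotate_pair_simps mv_add mv_scale ip_add_left ip_add_right ip_scale_left ip_scale_right
              algebra_simps power2_eq_square)
        have vq: "ip I (v q) (mv I H (v q)) = s\<^sup>2 * a - 2 * c * s * b + c\<^sup>2 * d"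
          using ne b' unfolding v_def a_def b_def d_def
          by (simp add: rotate_pair_simps mv_diff mv_scale ip_diff_left ip_diff_right ip_scale_left ip_scale_right
              algebra_simps power2_eq_square)
        show ?thesis
          unfolding f_def sum_split_pair[OF fin pq ne] vp vq
          by (simp add: v_def rotate_pair_simps)
      qed
      moreover have "f u = real (w p) * a + real (w q) * d
          + (\<Sum>i\<in>I - {p, q}. real (w i) * ip I (u i) (mv I H (u i)))"
        unfolding f_def sum_split_pair[OF fin pq ne] by (simp add: a_def d_def)
      moreover have "c\<^sup>2 = 1 - s\<^sup>2" using cs by simp
      ultimately have "(real (w p) - real (w q)) * (2 * c * s * b) \<le> (real (w p) - real (w q)) * (s\<^sup>2 * (a - d))"
        by (simp add: algebra_simps)
      then show ?thesis using wpq by (simp add: mult_le_cancel_left_pos)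
    qed
    then have "b = 0" by (rule rotation_first_order)
    then show ?thesis by (simp add: b_def)
  qed
  have off: "ip I (u p) (mv I H (u q)) = 0" if "p \<in> I" "q \<in> I" "p \<noteq> q" for p q
  proof (cases "w q < w p")
    case False
    with that w have "w p < w q"
      by (metis inj_onD linorder_neqE_nat)
    from offdiag[OF that(2,1) this] show ?thesis
      by (simp add: ip_mv_symm[OF symm, of "u p"] ip_commute)
  qed (use offdiag that in auto)
  define e where "e = (\<lambda>i. ip I (u i) (mv I H (u i)))"
  have "mv I H (u i) k = e i * u i k" if "i \<in> I" "k \<in> I" for i k
  proof -
    have "mv I H (u i) k = (\<Sum>j\<in>I. ip I (u j) (mv I H (u i)) * u j k)"
      using orthobasis_expand[OF fin ob that(2)] by simp
    also have "\<dots> = (\<Sum>j\<in>I. if j = i then ip I (u i) (mv I H (u i)) * u i k else 0)"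
      using that off by (intro sum.cong) auto
    finally show ?thesis using that fin by (simp add: e_def)
  qed
  with ob have "eigensystem I H u e" by (simp add: eigensystem_def)
  then show ?thesis by blast
qed

section \<open>One step of the trace exponential\<close>

text \<open>
  The mean of a convex function over an interval is at most the mean of its end point values; here for \<open>exp\<close>.
\<close>
lemma exp_diff_le_trapezoid:
  fixes a b :: real
  shows "\<bar>exp b - exp a\<bar> \<le> \<bar>b - a\<bar> * (exp b + exp a) / 2"
proof -
  have f0: "exp x - 1 \<le> x * (exp x + 1) / 2" if "x \<ge> 0" for x :: real
  proof -
    have "(\<lambda>x. x * (exp x + 1) / 2 - (exp x - 1 :: real)) 0 \<le> x * (exp x + 1) / 2 - (exp x - 1)"
    proof (rule DERIV_nonneg_imp_nondecreasing[OF that])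
      fix y :: real
      have "1 - y \<le> exp (- y)" using exp_ge_add_one_self[of "- y"] by simp
      then have "exp y * (1 - y) \<le> exp y * exp (- y)" by (intro mult_left_mono) auto
      also have "\<dots> = 1" by (simp flip: exp_add)
      finally have "0 \<le> (y * exp y + (exp y + 1)) / 2 - exp y" by (simp add: algebra_simps)
      moreover have "((\<lambda>x. x * (exp x + 1) / 2 - (exp x - 1)) has_real_derivative
          (y * exp y + (exp y + 1)) / 2 - exp y) (at y)"
        by (auto intro!: derivative_eq_intros)
      ultimately show "\<exists>z. ((\<lambda>x. x * (exp x + 1) / 2 - (exp x - 1)) has_real_derivative z) (at y) \<and> 0 \<le> z"
        by blast
    qed
    then show ?thesis by simp
  qed
  have le: "exp b - exp a \<le> (b - a) * (exp b + exp a) / 2" if "a \<le> b" for a b :: real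
  proof -
    have "exp a * (exp (b - a) - 1) \<le> exp a * ((b - a) * (exp (b - a) + 1) / 2)"
      using f0[of "b - a"] that by (intro mult_left_mono) auto
    moreover have "exp a * exp (b - a) = exp b" by (simp flip: exp_add)
    ultimately show ?thesis by (simp add: algebra_simps)
  qed
  show ?thesis
    using le[of a b] le[of b a] by (cases "a \<le> b") (auto simp: abs_if algebra_simps)
qed

text \<open>
  A second order Taylor bound that treats \<open>a\<close> and \<open>b\<close> alike: in a double sum over two eigenbases the term
  with \<open>exp b\<close> and the term with \<open>exp a\<close> become traces against the two matrix exponentials.
\<close>
lemma exp_taylor2_symmetric:
  fixes a b :: real
  shows "exp b - exp a - exp a * (b - a) \<le> (b - a)\<^sup>2 * (exp b + exp a) / 2"
proof -
  define g where "g = (\<lambda>x :: real. x\<^sup>2 * (exp x + 1) / 2 - (exp x - 1 - x))"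
  define g' where "g' = (\<lambda>y :: real. y * (exp y + 1) + y\<^sup>2 * exp y / 2 - exp y + 1)"
  have der: "(g has_real_derivative g' y) (at y)" for y
    unfolding g_def g'_def
    by (auto intro!: derivative_eq_intros simp: field_simps power2_eq_square)
  have pos: "0 \<le> g' y" if "y \<ge> 0" for y
  proof -
    have "exp y - 1 \<le> y * (exp y + 1) / 2"
      using exp_diff_le_trapezoid[of y 0] that by simp
    moreover have "0 \<le> y * (exp y + 1)" "0 \<le> y\<^sup>2 * exp y" using that by (auto intro!: mult_nonneg_nonneg add_nonneg_nonneg)
    ultimately show ?thesis unfolding g'_def by linarith
  qed
  have neg: "g' y \<le> 0" if "y \<le> 0" for y
  proof -
    have "1 - exp y \<le> (- y) * (exp y + 1) / 2"
      using exp_diff_le_trapezoid[of y 0] that by simp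
    moreover have "0 \<le> 1 + exp y + y * exp y"
    proof -
      have "exp y * (- y) \<le> exp y * exp (- y)"
        using exp_ge_add_one_self[of "- y"] by (intro mult_left_mono) auto
      also have "\<dots> = 1" by (simp flip: exp_add)
      finally have "- (y * exp y) \<le> 1" by (simp add: mult.commute)
      then show ?thesis using exp_gt_zero[of y] by linarith
    qed
    then have "y * (1 + exp y + y * exp y) \<le> 0" using that by (simp add: mult_nonpos_nonneg)
    ultimately show ?thesis by (simp add: g'_def algebra_simps power2_eq_square)
  qed
  have "0 \<le> g x" for x
  proof -
    have "g 0 = 0" by (simp add: g_def)
    moreover have "g 0 \<le> g x" if "x \<ge> 0"
      by (rule DERIV_nonneg_imp_nondecreasing[OF that]) (use der pos in blast)
    moreover have "g 0 \<le> g x" if "x \<le> 0"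
      by (rule DERIV_nonpos_imp_nonincreasing[OF that]) (use der neg in blast)
    ultimately show ?thesis by (cases "x \<ge> 0") auto
  qed
  from this[of "b - a"] have "exp (b - a) - 1 - (b - a) \<le> (b - a)\<^sup>2 * (exp (b - a) + 1) / 2"
    by (simp add: g_def)
  then have "exp a * (exp (b - a) - 1 - (b - a)) \<le> exp a * ((b - a)\<^sup>2 * (exp (b - a) + 1) / 2)"
    by (intro mult_left_mono) auto
  moreover have "exp b = exp a * exp (b - a)" by (simp flip: exp_add)
  ultimately show ?thesis by (simp only:) (simp add: algebra_simps)
qed

text \<open>
  Let \<open>o\<^sub>i\<^sub>j = \<langle>u\<^sub>i, v\<^sub>j\<rangle>\<close> (\<open>ov\<close> below). Since \<open>Y = B - A\<close>, the numbers \<open>w\<^sub>i\<^sub>j = \<langle>u\<^sub>i, Y v\<^sub>j\<rangle>\<close> equal \<open>(b\<^sub>j - a\<^sub>i) o\<^sub>i\<^sub>j\<close>, and by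
  Parseval every trace in the claim is a double sum over \<open>i\<close> and \<open>j\<close>. The symmetric Taylor bound yields the
  remainder \<open>(P + Q) / 2\<close> with \<open>P = tr (Y\<^sup>2 exp B)\<close> and \<open>Q = tr (Y\<^sup>2 exp A)\<close>. To remove \<open>B\<close>, write \<open>P - Q\<close> as a
  double sum of \<open>\<langle>Y u\<^sub>i, Y v\<^sub>j\<rangle> o\<^sub>i\<^sub>j (exp b\<^sub>j - exp a\<^sub>i)\<close>. The trapezoid bound and the contraction property
  give \<open>P - Q \<le> (P + Q) / 2\<close>, that is \<open>P \<le> 3 Q\<close>.
\<close>
lemma trace_exp_perturbation:
  assumes fin: "finite I"
    and A: "eigensystem I A u a" and B: "eigensystem I B v b"
    and symA: "symm_on I A" and symY: "symm_on I Y"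
    and BY: "\<And>k l. k \<in> I \<Longrightarrow> l \<in> I \<Longrightarrow> B (k, l) = A (k, l) + Y (k, l)"
    and contr: "\<And>x. ip I (mv I Y x) (mv I Y x) \<le> ip I x x"
  shows "(\<Sum>j\<in>I. exp (b j)) \<le> (\<Sum>i\<in>I. exp (a i)) + (\<Sum>i\<in>I. exp (a i) * ip I (u i) (mv I Y (u i)))
     + 2 * (\<Sum>i\<in>I. exp (a i) * ip I (mv I Y (u i)) (mv I Y (u i)))"
proof -
  have ou: "orthobasis I u" and ov: "orthobasis I v"
    using A B by (auto simp: eigensystem_def)
  define ov where "ov i j = ip I (u i) (v j)" for i j
  define w where "w i j = ip I (u i) (mv I Y (v j))" for i j
  define z where "z i j = ip I (mv I Y (u i)) (mv I Y (v j))" for i j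
  have w': "w i j = ip I (v j) (mv I Y (u i))" for i j
    by (simp add: w_def ip_mv_symm[OF symY, of "u i"] ip_commute)
  have z': "z i j = ip I (u i) (mv I Y (mv I Y (v j)))" "z i j = ip I (v j) (mv I Y (mv I Y (u i)))" for i j
    unfolding z_def
    by (simp add: ip_mv_symm[OF symY, of "u i"] ip_commute)
       (subst ip_commute, simp add: ip_mv_symm[OF symY, of "v j"])
  have w_eq: "w i j = (b j - a i) * ov i j" if "i \<in> I" "j \<in> I" for i j
  proof -
    have "mv I Y x k = mv I B x k - mv I A x k" if "k \<in> I" for x k
      unfolding mv_def using that BY by (simp add: algebra_simps flip: sum_subtractf)
    then have "w i j = ip I (u i) (\<lambda>k. mv I B (v j) k - mv I A (v j) k)"
      unfolding w_def by (intro ip_cong) auto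
    also have "\<dots> = ip I (u i) (mv I B (v j)) - ip I (mv I A (u i)) (v j)"
      by (simp add: ip_diff_right ip_mv_symm[OF symA])
    also have "ip I (u i) (mv I B (v j)) = ip I (u i) (\<lambda>k. b j * v j k)"
      using B that by (intro ip_cong) (auto simp: eigensystem_def)
    also have "ip I (mv I A (u i)) (v j) = ip I (\<lambda>k. a i * u i k) (v j)"
      using A that by (intro ip_cong) (auto simp: eigensystem_def)
    finally show ?thesis
      by (simp add: ip_scale_left ip_scale_right ov_def algebra_simps)
  qed
  have ov_row: "(\<Sum>j\<in>I. (ov i j)\<^sup>2) = 1" if "i \<in> I" for i
    using parseval_self[OF fin ov, of "u i"] ou that
    by (simp add: ov_def ip_commute orthobasis_def)
  have ov_col: "(\<Sum>i\<in>I. (ov i j)\<^sup>2) = 1" if "j \<in> I" for j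
    using parseval_self[OF fin ou, of "v j"] ov that
    by (simp add: ov_def orthobasis_def)
  have w_row: "(\<Sum>j\<in>I. (w i j)\<^sup>2) = ip I (mv I Y (u i)) (mv I Y (u i))" for i
    using parseval_self[OF fin ov, of "mv I Y (u i)"] by (simp add: w')
  have w_col: "(\<Sum>i\<in>I. (w i j)\<^sup>2) = ip I (mv I Y (v j)) (mv I Y (v j))" for j
    using parseval_self[OF fin ou, of "mv I Y (v j)"] by (simp add: w_def)
  have z_row: "(\<Sum>j\<in>I. (z i j)\<^sup>2) \<le> ip I (mv I Y (u i)) (mv I Y (u i))" for i
    using parseval_self[OF fin ov, of "mv I Y (mv I Y (u i))"] contr[of "mv I Y (u i)"] by (simp add: z'(2))
  have z_col: "(\<Sum>i\<in>I. (z i j)\<^sup>2) \<le> ip I (mv I Y (v j)) (mv I Y (v j))" for j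
    using parseval_self[OF fin ou, of "mv I Y (mv I Y (v j))"] contr[of "mv I Y (v j)"] by (simp add: z'(1))
  have wov: "(\<Sum>j\<in>I. w i j * ov i j) = ip I (u i) (mv I Y (u i))" for i
    using parseval[OF fin ov, of "mv I Y (u i)" "u i"] by (simp add: w' ov_def ip_commute)
  have zov_row: "(\<Sum>j\<in>I. z i j * ov i j) = ip I (mv I Y (u i)) (mv I Y (u i))" for i
    using parseval[OF fin ov, of "mv I Y (mv I Y (u i))" "u i"]
    by (simp add: z'(2) ov_def ip_commute[of I _ "u i"] ip_mv_symm[OF symY, of "u i"])
  have zov_col: "(\<Sum>i\<in>I. z i j * ov i j) = ip I (mv I Y (v j)) (mv I Y (v j))" for j
    using parseval[OF fin ou, of "mv I Y (mv I Y (v j))" "v j"]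
    by (simp add: z'(1) ov_def ip_commute[of I _ "v j"] ip_mv_symm[OF symY, of "v j"])
  define P where "P = (\<Sum>j\<in>I. exp (b j) * ip I (mv I Y (v j)) (mv I Y (v j)))"
  define Q where "Q = (\<Sum>i\<in>I. exp (a i) * ip I (mv I Y (u i)) (mv I Y (u i)))"
  have by_rows: "(\<Sum>i\<in>I. \<Sum>j\<in>I. exp (a i) * f i j) = (\<Sum>i\<in>I. exp (a i) * (\<Sum>j\<in>I. f i j))" for f
    by (simp add: sum_distrib_left)
  have by_cols: "(\<Sum>i\<in>I. \<Sum>j\<in>I. exp (b j) * f i j) = (\<Sum>j\<in>I. exp (b j) * (\<Sum>i\<in>I. f i j))" for f
    by (subst sum.swap) (simp add: sum_distrib_left)
  have "(\<Sum>j\<in>I. exp (b j)) - (\<Sum>i\<in>I. exp (a i)) - (\<Sum>i\<in>I. exp (a i) * ip I (u i) (mv I Y (u i)))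
     = (\<Sum>i\<in>I. \<Sum>j\<in>I. (ov i j)\<^sup>2 * (exp (b j) - exp (a i) - exp (a i) * (b j - a i)))"
  proof -
    have "(\<Sum>j\<in>I. exp (b j)) = (\<Sum>i\<in>I. \<Sum>j\<in>I. exp (b j) * (ov i j)\<^sup>2)"
      by (simp add: by_cols ov_col)
    moreover have "(\<Sum>i\<in>I. exp (a i)) = (\<Sum>i\<in>I. \<Sum>j\<in>I. exp (a i) * (ov i j)\<^sup>2)"
      by (simp add: by_rows ov_row)
    moreover have "(\<Sum>i\<in>I. exp (a i) * ip I (u i) (mv I Y (u i))) = (\<Sum>i\<in>I. \<Sum>j\<in>I. exp (a i) * ((b j - a i) * (ov i j)\<^sup>2))"
      unfolding by_rows wov[symmetric]
      by (intro sum.cong refl) (simp add: w_eq power2_eq_square mult_ac)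
    ultimately show ?thesis
      by (simp add: algebra_simps flip: sum_subtractf)
  qed
  also have "\<dots> \<le> (\<Sum>i\<in>I. \<Sum>j\<in>I. (ov i j)\<^sup>2 * ((b j - a i)\<^sup>2 * (exp (b j) + exp (a i)) / 2))"
    by (intro sum_mono mult_left_mono exp_taylor2_symmetric) auto
  also have "\<dots> = (\<Sum>i\<in>I. \<Sum>j\<in>I. exp (b j) * ((w i j)\<^sup>2 / 2)) + (\<Sum>i\<in>I. \<Sum>j\<in>I. exp (a i) * ((w i j)\<^sup>2 / 2))"
    unfolding sum.distrib[symmetric]
    by (intro sum.cong refl) (simp add: w_eq power_mult_distrib, simp add: algebra_simps add_divide_distrib)
  also have "\<dots> = P / 2 + Q / 2"
    unfolding by_rows by_cols
    by (simp add: w_row w_col P_def Q_def flip: sum_divide_distrib)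
  finally have main: "(\<Sum>j\<in>I. exp (b j)) \<le> (\<Sum>i\<in>I. exp (a i)) + (\<Sum>i\<in>I. exp (a i) * ip I (u i) (mv I Y (u i)))
     + P / 2 + Q / 2" by simp
  have "P - Q = (\<Sum>i\<in>I. \<Sum>j\<in>I. z i j * (ov i j * (exp (b j) - exp (a i))))"
  proof -
    have "P = (\<Sum>i\<in>I. \<Sum>j\<in>I. exp (b j) * (z i j * ov i j))"
      by (simp add: by_cols zov_col P_def)
    moreover have "Q = (\<Sum>i\<in>I. \<Sum>j\<in>I. exp (a i) * (z i j * ov i j))"
      by (simp add: by_rows zov_row Q_def)
    ultimately show ?thesis
      by (simp add: algebra_simps flip: sum_subtractf)
  qed
  also have "\<dots> \<le> (\<Sum>i\<in>I. \<Sum>j\<in>I. ((z i j)\<^sup>2 + (w i j)\<^sup>2) * ((exp (b j) + exp (a i)) / 4))"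
  proof (intro sum_mono)
    fix i j assume ij: "i \<in> I" "j \<in> I"
    have "z i j * (ov i j * (exp (b j) - exp (a i))) \<le> \<bar>z i j\<bar> * (\<bar>ov i j\<bar> * \<bar>exp (b j) - exp (a i)\<bar>)"
      by (simp flip: abs_mult)
    also have "\<dots> \<le> \<bar>z i j\<bar> * (\<bar>ov i j\<bar> * (\<bar>b j - a i\<bar> * (exp (b j) + exp (a i)) / 2))"
      by (intro mult_left_mono exp_diff_le_trapezoid) auto
    also have "\<dots> = (\<bar>z i j\<bar> * \<bar>w i j\<bar>) * ((exp (b j) + exp (a i)) / 2)"
      using ij by (simp add: w_eq abs_mult)
    also have "\<dots> \<le> (((z i j)\<^sup>2 + (w i j)\<^sup>2) / 2) * ((exp (b j) + exp (a i)) / 2)"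
    proof (intro mult_right_mono)
      have "0 \<le> (\<bar>z i j\<bar> - \<bar>w i j\<bar>)\<^sup>2" by simp
      then show "\<bar>z i j\<bar> * \<bar>w i j\<bar> \<le> ((z i j)\<^sup>2 + (w i j)\<^sup>2) / 2"
        by (simp add: power2_diff)
    qed (simp add: add_nonneg_nonneg)
    finally show "z i j * (ov i j * (exp (b j) - exp (a i))) \<le> ((z i j)\<^sup>2 + (w i j)\<^sup>2) * ((exp (b j) + exp (a i)) / 4)"
      by simp
  qed
  also have "\<dots> = ((\<Sum>i\<in>I. \<Sum>j\<in>I. exp (b j) * ((z i j)\<^sup>2 + (w i j)\<^sup>2)) + (\<Sum>i\<in>I. \<Sum>j\<in>I. exp (a i) * ((z i j)\<^sup>2 + (w i j)\<^sup>2))) / 4"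
    unfolding sum.distrib[symmetric] sum_divide_distrib
    by (intro sum.cong refl) (simp add: field_simps)
  also have "\<dots> \<le> (2 * P + 2 * Q) / 4"
  proof -
    have "(\<Sum>i\<in>I. \<Sum>j\<in>I. exp (b j) * ((z i j)\<^sup>2 + (w i j)\<^sup>2)) \<le> (\<Sum>j\<in>I. exp (b j) * (2 * ip I (mv I Y (v j)) (mv I Y (v j))))"
      unfolding by_cols using z_col by (intro sum_mono mult_left_mono) (auto simp: sum.distrib w_col)
    moreover have "(\<Sum>i\<in>I. \<Sum>j\<in>I. exp (a i) * ((z i j)\<^sup>2 + (w i j)\<^sup>2)) \<le> (\<Sum>i\<in>I. exp (a i) * (2 * ip I (mv I Y (u i)) (mv I Y (u i))))"
      unfolding by_rows using z_row by (intro sum_mono mult_left_mono) (auto simp: sum.distrib w_row)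
    moreover have "(\<Sum>j\<in>I. exp (b j) * (2 * ip I (mv I Y (v j)) (mv I Y (v j)))) = 2 * P"
      "(\<Sum>i\<in>I. exp (a i) * (2 * ip I (mv I Y (u i)) (mv I Y (u i)))) = 2 * Q"
      by (simp_all add: P_def Q_def sum_distrib_left mult_ac)
    ultimately show ?thesis by simp
  qed
  finally have "P \<le> 3 * Q" by simp
  with main show ?thesis by (simp add: Q_def)
qed

section \<open>The spectral norm as an operator norm\<close>

lemma ip_self_L2: "ip I x x = (L2_set x I)\<^sup>2"
  by (simp add: ip_def L2_set_def power2_eq_square sum_nonneg)

lemma ip_le_L2: "\<bar>ip I x y\<bar> \<le> L2_set x I * L2_set y I"
proof -
  have "\<bar>ip I x y\<bar> \<le> (\<Sum>k\<in>I. \<bar>x k\<bar> * \<bar>y k\<bar>)"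
    unfolding ip_def by (rule order_trans[OF sum_abs]) (simp add: abs_mult)
  also have "\<dots> \<le> L2_set x I * L2_set y I" by (rule L2_set_mult_ineq)
  finally show ?thesis .
qed

text \<open>
  The partial sums of a random array are handled as functions of their entries; this is the spectral norm in that
  form.
\<close>
definition nrm :: "nat \<Rightarrow> nat \<Rightarrow> (nat \<times> nat \<Rightarrow> real) \<Rightarrow> real" where
  "nrm r c A = spectral_norm (Matrix.mat r c A)"

lemma nrm_cong: "(\<And>k l. k < r \<Longrightarrow> l < c \<Longrightarrow> A (k, l) = B (k, l)) \<Longrightarrow> nrm r c A = nrm r c B"
  unfolding nrm_def by (rule arg_cong[of _ _ spectral_norm]) (rule eq_matI; simp)

lemma spectral_norm_eq_nrm: "M \<in> carrier_mat r c \<Longrightarrow> spectral_norm M = nrm r c (\<lambda>p. M $$ p)"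
  unfolding nrm_def by (rule arg_cong[of _ _ spectral_norm]) (rule eq_matI; auto)

lemma eigensystem_ip:
  assumes "finite I" "eigensystem I H u e" "symm_on I H" "i \<in> I"
  shows "ip I (u i) (mv I H x) = e i * ip I (u i) x"
proof -
  have "ip I (u i) (mv I H x) = ip I (mv I H (u i)) x"
    by (rule ip_mv_symm[OF assms(3)])
  also have "\<dots> = ip I (\<lambda>k. e i * u i k) x"
    using assms by (intro ip_cong) (auto simp: eigensystem_def)
  finally show ?thesis by (simp add: ip_scale_left)
qed

lemma eigensystem_quadratic:
  assumes "finite I" "eigensystem I H u e" "symm_on I H"
  shows "ip I x (mv I H x) = (\<Sum>i\<in>I. e i * (ip I (u i) x)\<^sup>2)"
proof -
  have "ip I x (mv I H x) = (\<Sum>i\<in>I. ip I (u i) x * ip I (u i) (mv I H x))"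
    using assms by (intro parseval[symmetric]) (auto simp: eigensystem_def)
  also have "\<dots> = (\<Sum>i\<in>I. e i * (ip I (u i) x)\<^sup>2)"
    using assms by (intro sum.cong) (auto simp: eigensystem_ip power2_eq_square)
  finally show ?thesis .
qed

lemma eigenvalue_iff_eigensystem:
  assumes H: "eigensystem {..<c} H u e" and symm: "symm_on {..<c} H"
  shows "eigenvalue (Matrix.mat c c H) mu \<longleftrightarrow> (\<exists>i<c. e i = mu)"
proof
  assume "\<exists>i<c. e i = mu"
  then obtain i where i: "i < c" "e i = mu" by blast
  have "vec c (u i) \<noteq> 0\<^sub>v c"
  proof
    assume 0: "vec c (u i) = 0\<^sub>v c"
    have "u i k = 0" if "k < c" for k
      using arg_cong[OF 0, of "\<lambda>v. v $ k"] that by simp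
    then have "ip {..<c} (u i) (u i) = 0" by (simp add: ip_def)
    then show False using H i by (simp add: eigensystem_def orthobasis_def)
  qed
  moreover have "Matrix.mat c c H *\<^sub>v vec c (u i) = mu \<cdot>\<^sub>v vec c (u i)"
    using H i by (intro eq_vecI) (auto simp: eigensystem_def mv_def scalar_prod_def atLeast0LessThan)
  ultimately show "eigenvalue (Matrix.mat c c H) mu"
    by (auto simp: eigenvalue_def eigenvector_def intro!: exI[of _ "vec c (u i)"])
next
  assume "eigenvalue (Matrix.mat c c H) mu"
  then obtain v where v: "v \<in> carrier_vec c" "v \<noteq> 0\<^sub>v c" "Matrix.mat c c H *\<^sub>v v = mu \<cdot>\<^sub>v v"
    by (auto simp: eigenvalue_def eigenvector_def)
  show "\<exists>i<c. e i = mu"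
  proof (rule ccontr)
    assume no: "\<not> ?thesis"
    have "mv {..<c} H (\<lambda>k. v $ k) k = mu * v $ k" if "k < c" for k
      using arg_cong[OF v(3), of "\<lambda>w. w $ k"] that v(1)
      by (simp add: mv_def scalar_prod_def atLeast0LessThan)
    then have ip: "ip {..<c} (u i) (mv {..<c} H (\<lambda>k. v $ k)) = mu * ip {..<c} (u i) (\<lambda>k. v $ k)" for i
      unfolding ip_scale_right[symmetric] by (intro ip_cong) auto
    have "ip {..<c} (u i) (\<lambda>k. v $ k) = 0" if "i < c" for i
      using eigensystem_ip[OF _ H symm, of i "\<lambda>k. v $ k"] ip[of i] that no by auto
    then have "v $ k = 0" if "k < c" for k
      using orthobasis_expand[of "{..<c}" u k "\<lambda>k. v $ k"] H that by (simp add: eigensystem_def)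
    then have "v = 0\<^sub>v c" using v(1) by (intro eq_vecI) auto
    with v(2) show False by simp
  qed
qed

definition gram :: "nat \<Rightarrow> (nat \<times> nat \<Rightarrow> real) \<Rightarrow> nat \<times> nat \<Rightarrow> real" where
  "gram r A = (\<lambda>(l, l'). \<Sum>k<r. A (k, l) * A (k, l'))"

lemma symm_gram: "symm_on I (gram r A)"
  by (simp add: symm_on_def gram_def mult.commute)

lemma ip_gram: "ip {..<c} x (mv {..<c} (gram r A) x) = (L2_set (mv {..<c} A x) {..<r})\<^sup>2"
proof -
  have "mv {..<c} (gram r A) x = mv {..<r} (\<lambda>(l, k). A (k, l)) (mv {..<c} A x)"
  proof
    fix l
    have "mv {..<c} (gram r A) x l = (\<Sum>l'<c. \<Sum>k<r. A (k, l) * A (k, l') * x l')"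
      by (simp add: mv_def gram_def sum_distrib_right)
    also have "\<dots> = (\<Sum>k<r. \<Sum>l'<c. A (k, l) * A (k, l') * x l')"
      by (rule sum.swap)
    also have "\<dots> = mv {..<r} (\<lambda>(l, k). A (k, l)) (mv {..<c} A x) l"
      by (simp add: mv_def sum_distrib_left mult_ac)
    finally show "mv {..<c} (gram r A) x l = mv {..<r} (\<lambda>(l, k). A (k, l)) (mv {..<c} A x) l" .
  qed
  then show ?thesis
    by (simp add: ip_mv_transpose ip_self_L2[symmetric])
qed

lemma nrm_eigensystem:
  assumes "eigensystem {..<c} (gram r A) u e" "c \<ge> 1"
  shows "nrm r c A = Max ((\<lambda>i. sqrt (e i)) ` {..<c})" and "\<And>i. i < c \<Longrightarrow> 0 \<le> e i"
proof -
  have "transpose_mat (Matrix.mat r c A) * Matrix.mat r c A = Matrix.mat c c (gram r A)"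
    by (intro eq_matI) (auto simp: gram_def scalar_prod_def atLeast0LessThan)
  then have "singular_values (Matrix.mat r c A) = (\<lambda>i. sqrt (e i)) ` {..<c}"
    unfolding singular_values_def using eigenvalue_iff_eigensystem[OF assms(1) symm_gram] by auto
  then show "nrm r c A = Max ((\<lambda>i. sqrt (e i)) ` {..<c})"
    by (simp add: nrm_def spectral_norm_def)
  show "0 \<le> e i" if "i < c" for i
  proof -
    have "e i = ip {..<c} (u i) (mv {..<c} (gram r A) (u i))"
      using eigensystem_ip[OF _ assms(1) symm_gram, of i "u i"] assms(1) that
      by (simp add: eigensystem_def orthobasis_def)
    then show ?thesis by (simp add: ip_gram)
  qed
qed

text \<open>
  All three statements are read off an eigensystem of the Gram matrix \<open>A\<^sup>T A\<close>, whose eigenvalues are the squares of the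
  singular values.
\<close>
lemma nrm_bound:
  assumes "c \<ge> 1"
  shows "L2_set (mv {..<c} A x) {..<r} \<le> nrm r c A * L2_set x {..<c}" (is ?bound)
    and "\<exists>x. L2_set x {..<c} = 1 \<and> L2_set (mv {..<c} A x) {..<r} = nrm r c A" (is ?attained)
    and "0 \<le> nrm r c A" (is ?nonneg)
proof -
  obtain u e where ue: "eigensystem {..<c} (gram r A) u e"
    using spectral_theorem[OF _ symm_gram] by blast
  note nrm = nrm_eigensystem[OF ue assms]
  have e: "e i \<le> (nrm r c A)\<^sup>2" if "i < c" for i
  proof -
    have "sqrt (e i) \<le> nrm r c A"
      unfolding nrm(1) using that by (intro Max_ge) auto
    then have "(sqrt (e i))\<^sup>2 \<le> (nrm r c A)\<^sup>2"
      using nrm(2)[OF that] by (intro power_mono) auto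
    then show ?thesis using nrm(2)[OF that] by simp
  qed
  obtain i where i: "i < c" "nrm r c A = sqrt (e i)"
  proof -
    have "Max ((\<lambda>i. sqrt (e i)) ` {..<c}) \<in> (\<lambda>i. sqrt (e i)) ` {..<c}"
      using assms by (intro Max_in) (auto simp: lessThan_empty_iff)
    then show ?thesis using that nrm(1) by auto
  qed
  show ?nonneg using i nrm(2) by simp
  have "(L2_set (mv {..<c} A x) {..<r})\<^sup>2 = (\<Sum>i<c. e i * (ip {..<c} (u i) x)\<^sup>2)"
    unfolding ip_gram[symmetric] by (rule eigensystem_quadratic[OF _ ue symm_gram]) simp
  also have "\<dots> \<le> (\<Sum>i<c. (nrm r c A)\<^sup>2 * (ip {..<c} (u i) x)\<^sup>2)"
    using e by (intro sum_mono mult_right_mono) auto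
  also have "\<dots> = (nrm r c A * L2_set x {..<c})\<^sup>2"
    using parseval_self[of "{..<c}" u x] ue
    by (simp add: eigensystem_def ip_self_L2 power_mult_distrib flip: sum_distrib_left)
  finally show ?bound
    using \<open>?nonneg\<close> by (intro power2_le_imp_le[of "L2_set (mv {..<c} A x) {..<r}"]) (auto simp: L2_set_nonneg)
  have "(L2_set (mv {..<c} A (u i)) {..<r})\<^sup>2 = e i"
    using eigensystem_ip[OF _ ue symm_gram, of i "u i"] ue i
    by (simp add: ip_gram eigensystem_def orthobasis_def)
  moreover have "(L2_set (u i) {..<c})\<^sup>2 = 1"
    using ue i by (simp add: eigensystem_def orthobasis_def flip: ip_self_L2)
  ultimately have "L2_set (u i) {..<c} = 1 \<and> L2_set (mv {..<c} A (u i)) {..<r} = nrm r c A"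
    using i by (metis L2_set_nonneg real_sqrt_abs abs_of_nonneg real_sqrt_one)
  then show ?attained by blast
qed

lemma bilinear_le_nrm:
  assumes "c \<ge> 1"
  shows "\<bar>ip {..<r} y (mv {..<c} A x)\<bar> \<le> nrm r c A * (L2_set y {..<r} * L2_set x {..<c})"
proof -
  have "\<bar>ip {..<r} y (mv {..<c} A x)\<bar> \<le> L2_set y {..<r} * L2_set (mv {..<c} A x) {..<r}"
    by (rule ip_le_L2)
  also have "\<dots> \<le> L2_set y {..<r} * (nrm r c A * L2_set x {..<c})"
    using nrm_bound[OF assms] by (intro mult_left_mono) (auto simp: L2_set_nonneg)
  finally show ?thesis by (simp add: mult_ac)
qed

text \<open>
  With \<open>w = A\<^sup>T y\<close>, one has \<open>\<parallel>w\<parallel>\<^sup>2 = \<langle>y, A w\<rangle> \<le> \<parallel>A\<parallel> \<parallel>y\<parallel> \<parallel>w\<parallel>\<close>.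
\<close>
lemma nrm_bound_transpose:
  assumes "c \<ge> 1"
  shows "L2_set (mv {..<r} (\<lambda>(l, k). A (k, l)) y) {..<c} \<le> nrm r c A * L2_set y {..<r}"
proof -
  define w where "w = mv {..<r} (\<lambda>(l, k). A (k, l)) y"
  have "(L2_set w {..<c})\<^sup>2 = ip {..<r} y (mv {..<c} A w)"
    by (simp add: ip_mv_transpose w_def ip_self_L2)
  also have "\<dots> \<le> nrm r c A * (L2_set y {..<r} * L2_set w {..<c})"
    using bilinear_le_nrm[OF assms, of r y A w] by linarith
  finally have *: "L2_set w {..<c} * L2_set w {..<c} \<le> (nrm r c A * L2_set y {..<r}) * L2_set w {..<c}"
    by (simp add: power2_eq_square mult_ac)
  have "L2_set w {..<c} \<le> nrm r c A * L2_set y {..<r}"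
  proof (cases "L2_set w {..<c} = 0")
    case False
    then have "L2_set w {..<c} > 0" using L2_set_nonneg[of w "{..<c}"] by linarith
    with * show ?thesis by simp
  qed (use nrm_bound(3)[OF assms] L2_set_nonneg in auto)
  then show ?thesis by (simp add: w_def)
qed

lemma nrm_triangle:
  assumes "c \<ge> 1"
  shows "nrm r c (\<lambda>p. A p + B p) \<le> nrm r c A + nrm r c B"
proof -
  obtain x where x: "L2_set x {..<c} = 1" "L2_set (mv {..<c} (\<lambda>p. A p + B p) x) {..<r} = nrm r c (\<lambda>p. A p + B p)"
    using nrm_bound(2)[OF assms] by blast
  have "mv {..<c} (\<lambda>p. A p + B p) x = (\<lambda>k. mv {..<c} A x k + mv {..<c} B x k)"
    by (simp add: mv_def algebra_simps sum.distrib)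
  then have "nrm r c (\<lambda>p. A p + B p) \<le> L2_set (mv {..<c} A x) {..<r} + L2_set (mv {..<c} B x) {..<r}"
    using x(2) L2_set_triangle_ineq[of "mv {..<c} A x" "mv {..<c} B x" "{..<r}"] by simp
  also have "\<dots> \<le> nrm r c A + nrm r c B"
    using nrm_bound(1)[OF assms, of A x r] nrm_bound(1)[OF assms, of B x r] x(1) by simp
  finally show ?thesis .
qed

lemma entry_le_nrm:
  assumes "k < r" "l < c"
  shows "\<bar>A (k, l)\<bar> \<le> nrm r c A"
proof -
  define x :: "nat \<Rightarrow> real" where "x = (\<lambda>l'. if l' = l then 1 else 0)"
  have "mv {..<c} A x k = A (k, l)"
    using assms by (simp add: mv_def x_def if_distrib cong: if_cong)
  moreover have "L2_set x {..<c} = 1"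
    using assms by (simp add: L2_set_def x_def if_distrib[of "\<lambda>t. t\<^sup>2"] cong: if_cong)
  moreover have "\<bar>mv {..<c} A x k\<bar> \<le> L2_set (\<lambda>k. \<bar>mv {..<c} A x k\<bar>) {..<r}"
    using assms by (intro member_le_L2_set) auto
  moreover have "c \<ge> 1" using assms by simp
  ultimately show ?thesis
    using nrm_bound(1)[of c A x r] by (simp add: L2_set_def)
qed

lemma nrm_le_sum_abs:
  assumes "c \<ge> 1"
  shows "nrm r c A \<le> (\<Sum>p\<in>{..<r} \<times> {..<c}. \<bar>A p\<bar>)"
proof -
  obtain x where x: "L2_set x {..<c} = 1" "L2_set (mv {..<c} A x) {..<r} = nrm r c A"
    using nrm_bound(2)[OF assms] by blast
  have x1: "\<bar>x l\<bar> \<le> 1" if "l < c" for l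
    using member_le_L2_set[of "{..<c}" l "\<lambda>l. \<bar>x l\<bar>"] x(1) that by (simp add: L2_set_def)
  have "nrm r c A \<le> (\<Sum>k<r. \<bar>mv {..<c} A x k\<bar>)"
    using x(2) L2_set_le_sum_abs[of "mv {..<c} A x" "{..<r}"] by simp
  also have "\<dots> \<le> (\<Sum>k<r. \<Sum>l<c. \<bar>A (k, l)\<bar>)"
  proof (rule sum_mono)
    fix k
    have "\<bar>mv {..<c} A x k\<bar> \<le> (\<Sum>l<c. \<bar>A (k, l)\<bar> * \<bar>x l\<bar>)"
      unfolding mv_def by (rule order_trans[OF sum_abs]) (simp add: abs_mult)
    also have "\<dots> \<le> (\<Sum>l<c. \<bar>A (k, l)\<bar>)"
      using x1 by (intro sum_mono) (simp add: mult_left_le)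
    finally show "\<bar>mv {..<c} A x k\<bar> \<le> (\<Sum>l<c. \<bar>A (k, l)\<bar>)" .
  qed
  finally show ?thesis by (simp add: sum.cartesian_product)
qed

text \<open>
  A crude dimension-dependent comparison of norms. It serves measurability and uniform continuity only, and does not
  enter the constants of the final bound.
\<close>
lemma nrm_lipschitz:
  assumes "c \<ge> 1"
  shows "\<bar>nrm r c A - nrm r c B\<bar> \<le> (\<Sum>p\<in>{..<r} \<times> {..<c}. \<bar>A p - B p\<bar>)"
proof -
  have le: "nrm r c A - nrm r c B \<le> (\<Sum>p\<in>{..<r} \<times> {..<c}. \<bar>A p - B p\<bar>)" for A B :: "nat \<times> nat \<Rightarrow> real"
    using nrm_triangle[OF assms, of r B "\<lambda>p. A p - B p"] nrm_le_sum_abs[OF assms, of r "\<lambda>p. A p - B p"]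
    by simp
  show ?thesis
    using le[of A B] le[of B A] by (simp add: abs_le_iff abs_minus_commute)
qed

section \<open>The trace exponential of the self-adjoint dilation\<close>

text \<open>
  The self-adjoint dilation \<open>[[0, A], [A\<^sup>T, 0]]\<close>.
\<close>
definition dil :: "(nat \<times> nat \<Rightarrow> real) \<Rightarrow> (nat + nat) \<times> (nat + nat) \<Rightarrow> real" where
  "dil A p = (case p of (Inl k, Inr l) \<Rightarrow> A (k, l) | (Inr l, Inl k) \<Rightarrow> A (k, l) | _ \<Rightarrow> 0)"

abbreviation dil_index :: "nat \<Rightarrow> nat \<Rightarrow> (nat + nat) set" where
  "dil_index r c \<equiv> {..<r} <+> {..<c}"

lemma symm_dil: "symm_on I (\<lambda>p. \<theta> * dil A p)"
  by (auto simp: symm_on_def dil_def split: sum.splits)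

lemma ip_dil_index: "ip (dil_index r c) x y = ip {..<r} (x \<circ> Inl) (y \<circ> Inl) + ip {..<c} (x \<circ> Inr) (y \<circ> Inr)"
  by (simp add: ip_def sum.Plus)

lemma mv_dil:
  "mv (dil_index r c) (\<lambda>p. \<theta> * dil A p) x \<circ> Inl = (\<lambda>k. \<theta> * mv {..<c} A (x \<circ> Inr) k)"
  "mv (dil_index r c) (\<lambda>p. \<theta> * dil A p) x \<circ> Inr = (\<lambda>l. \<theta> * mv {..<r} (\<lambda>(l, k). A (k, l)) (x \<circ> Inl) l)"
  by (auto simp: mv_def sum.Plus dil_def sum_distrib_left mult_ac)

lemma ip_mv_dil_self:
  "ip (dil_index r c) (mv (dil_index r c) (\<lambda>p. \<theta> * dil A p) x) (mv (dil_index r c) (\<lambda>p. \<theta> * dil A p) x)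
   = \<theta>\<^sup>2 * ((L2_set (mv {..<c} A (x \<circ> Inr)) {..<r})\<^sup>2 + (L2_set (mv {..<r} (\<lambda>(l, k). A (k, l)) (x \<circ> Inl)) {..<c})\<^sup>2)"
  unfolding ip_self_L2[symmetric]
  by (simp add: ip_dil_index mv_dil ip_scale_left ip_scale_right power2_eq_square algebra_simps)

lemma ip_mv_dil:
  "ip (dil_index r c) x (mv (dil_index r c) (\<lambda>p. \<theta> * dil A p) x) = 2 * \<theta> * ip {..<r} (x \<circ> Inl) (mv {..<c} A (x \<circ> Inr))"
proof -
  have "ip {..<c} (x \<circ> Inr) (mv {..<r} (\<lambda>(l, k). A (k, l)) (x \<circ> Inl)) = ip {..<r} (x \<circ> Inl) (mv {..<c} A (x \<circ> Inr))"
    by (simp add: ip_mv_transpose[of "{..<r}"] ip_commute)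
  then show ?thesis
    by (simp add: ip_dil_index mv_dil ip_scale_right)
qed

lemma dil_contraction:
  assumes "c \<ge> 1" "0 \<le> \<theta>" "\<theta> * nrm r c A \<le> 1"
  shows "ip (dil_index r c) (mv (dil_index r c) (\<lambda>p. \<theta> * dil A p) x) (mv (dil_index r c) (\<lambda>p. \<theta> * dil A p) x)
     \<le> ip (dil_index r c) x x"
proof -
  have "(L2_set (mv {..<c} A (x \<circ> Inr)) {..<r})\<^sup>2 \<le> (nrm r c A * L2_set (x \<circ> Inr) {..<c})\<^sup>2"
    using nrm_bound[OF assms(1)] by (intro power_mono) (auto simp: L2_set_nonneg)
  moreover have "(L2_set (mv {..<r} (\<lambda>(l, k). A (k, l)) (x \<circ> Inl)) {..<c})\<^sup>2 \<le> (nrm r c A * L2_set (x \<circ> Inl) {..<r})\<^sup>2"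
    using nrm_bound_transpose[OF assms(1)] by (intro power_mono) (auto simp: L2_set_nonneg)
  ultimately have "(L2_set (mv {..<c} A (x \<circ> Inr)) {..<r})\<^sup>2 + (L2_set (mv {..<r} (\<lambda>(l, k). A (k, l)) (x \<circ> Inl)) {..<c})\<^sup>2
     \<le> (nrm r c A)\<^sup>2 * ip (dil_index r c) x x"
    unfolding ip_dil_index by (simp add: ip_self_L2 power_mult_distrib algebra_simps)
  then have "ip (dil_index r c) (mv (dil_index r c) (\<lambda>p. \<theta> * dil A p) x) (mv (dil_index r c) (\<lambda>p. \<theta> * dil A p) x)
      \<le> \<theta>\<^sup>2 * ((nrm r c A)\<^sup>2 * ip (dil_index r c) x x)"
    unfolding ip_mv_dil_self by (intro mult_left_mono) auto
  also have "\<dots> = (\<theta> * nrm r c A)\<^sup>2 * ip (dil_index r c) x x" by (simp add: power_mult_distrib)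
  also have "\<dots> \<le> 1 * ip (dil_index r c) x x"
    using assms nrm_bound(3)[OF assms(1), of r A]
    by (intro mult_right_mono ip_self_nonneg) (simp add: abs_square_le_1)
  finally show ?thesis by simp
qed

text \<open>
  The trace of \<open>exp (\<theta> * dil A)\<close>, computed from some eigensystem. An arbitrary choice does, because
  the perturbation bound holds for every pair of eigensystems.
\<close>
definition trace_exp_dil :: "nat \<Rightarrow> nat \<Rightarrow> real \<Rightarrow> (nat \<times> nat \<Rightarrow> real) \<Rightarrow> real" where
  "trace_exp_dil r c \<theta> A =
     (\<Sum>i\<in>dil_index r c. exp (snd (SOME (u, e). eigensystem (dil_index r c) (\<lambda>p. \<theta> * dil A p) u e) i))"

lemma trace_exp_dil_eigensystem:
  "\<exists>u e. eigensystem (dil_index r c) (\<lambda>p. \<theta> * dil A p) u e \<and> trace_exp_dil r c \<theta> A = (\<Sum>i\<in>dil_index r c. exp (e i))"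
proof -
  define ue where "ue = (SOME (u, e). eigensystem (dil_index r c) (\<lambda>p. \<theta> * dil A p) u e)"
  have "\<exists>u e. eigensystem (dil_index r c) (\<lambda>p. \<theta> * dil A p) u e"
    by (intro spectral_theorem symm_dil) simp
  then obtain u e where "eigensystem (dil_index r c) (\<lambda>p. \<theta> * dil A p) u e"
    by blast
  then have "case (u, e) of (u, e) \<Rightarrow> eigensystem (dil_index r c) (\<lambda>p. \<theta> * dil A p) u e" by simp
  then have "case ue of (u, e) \<Rightarrow> eigensystem (dil_index r c) (\<lambda>p. \<theta> * dil A p) u e"
    unfolding ue_def by (rule someI)
  then have "eigensystem (dil_index r c) (\<lambda>p. \<theta> * dil A p) (fst ue) (snd ue)"
    by (simp add: case_prod_beta)
  moreover have "trace_exp_dil r c \<theta> A = (\<Sum>i\<in>dil_index r c. exp (snd ue i))"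
    by (simp add: trace_exp_dil_def ue_def)
  ultimately show ?thesis by blast
qed

lemma trace_exp_dil_zero: "trace_exp_dil r c \<theta> (\<lambda>_. 0) = real (r + c)"
proof -
  let ?I = "dil_index r c"
  obtain u e where ue: "eigensystem ?I (\<lambda>p. \<theta> * dil (\<lambda>_. 0) p) u e"
    "trace_exp_dil r c \<theta> (\<lambda>_. 0) = (\<Sum>i\<in>?I. exp (e i))"
    using trace_exp_dil_eigensystem by blast
  have "e i = 0" if "i \<in> ?I" for i
  proof -
    have "e i * ip ?I (u i) (u i) = ip ?I (u i) (mv ?I (\<lambda>p. \<theta> * dil (\<lambda>_. 0) p) (u i))"
      using eigensystem_ip[OF _ ue(1) symm_dil that] by simp
    also have "\<dots> = 0" by (simp add: ip_mv_dil) (simp add: ip_def mv_def)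
    finally show ?thesis using ue(1) that by (simp add: eigensystem_def orthobasis_def)
  qed
  then show ?thesis using ue(2) by (simp add: card_Plus)
qed

text \<open>
  Jensen's inequality for the spectral measure of \<open>w\<close>, by means of the tangent of \<open>exp\<close> at \<open>\<langle>w, H w\<rangle>\<close>.
\<close>
lemma exp_quadratic_le_trace:
  assumes "finite I" "eigensystem I H u e" "symm_on I H" and w: "ip I w w = 1"
  shows "exp (ip I w (mv I H w)) \<le> (\<Sum>i\<in>I. exp (e i))"
proof -
  define m where "m = ip I w (mv I H w)"
  define o2 where "o2 i = (ip I (u i) w)\<^sup>2" for i
  have m: "m = (\<Sum>i\<in>I. e i * o2 i)"
    unfolding m_def o2_def using assms by (intro eigensystem_quadratic)
  have one: "(\<Sum>i\<in>I. o2 i) = 1"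
    unfolding o2_def using parseval_self[of I u w] assms by (simp add: eigensystem_def)
  have "exp m = (\<Sum>i\<in>I. o2 i * (exp m * (1 + (e i - m))))"
  proof -
    have "(\<Sum>i\<in>I. o2 i * (exp m * (1 + (e i - m)))) = (\<Sum>i\<in>I. exp m * ((1 - m) * o2 i + e i * o2 i))"
      by (intro sum.cong refl) (simp add: algebra_simps)
    also have "\<dots> = exp m * ((1 - m) * sum o2 I + m)"
      by (subst (2) m) (simp only: sum_distrib_left sum.distrib distrib_left)
    finally show ?thesis by (simp add: one)
  qed
  also have "\<dots> \<le> (\<Sum>i\<in>I. o2 i * exp (e i))"
  proof (intro sum_mono mult_left_mono)
    fix i
    have "exp m * (1 + (e i - m)) \<le> exp m * exp (e i - m)"
      by (intro mult_left_mono exp_ge_add_one_self) auto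
    then show "exp m * (1 + (e i - m)) \<le> exp (e i)" by (simp flip: exp_add)
  qed (simp add: o2_def)
  also have "\<dots> \<le> (\<Sum>i\<in>I. exp (e i))"
  proof (intro sum_mono)
    fix i assume "i \<in> I"
    then have "o2 i \<le> sum o2 I"
      using assms(1) by (intro member_le_sum) (auto simp: o2_def)
    then show "o2 i * exp (e i) \<le> exp (e i)" using one by simp
  qed
  finally show ?thesis by (simp add: m_def)
qed

text \<open>
  If \<open>x\<close> is a unit vector with \<open>\<parallel>A x\<parallel> = \<sigma> = \<parallel>A\<parallel>\<close>, then the unit vector \<open>(A x / \<sigma>, x) / sqrt 2\<close> has the quadratic
  form \<open>\<theta> \<sigma>\<close> under \<open>\<theta>\<close> times the dilation; if \<open>\<sigma> = 0\<close>, the vector \<open>(0, x)\<close> does.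
\<close>
lemma exp_nrm_le_trace_exp_dil:
  assumes "c \<ge> 1"
  shows "exp (\<theta> * nrm r c A) \<le> trace_exp_dil r c \<theta> A"
proof -
  let ?I = "dil_index r c"
  obtain u e where ue: "eigensystem ?I (\<lambda>p. \<theta> * dil A p) u e" "trace_exp_dil r c \<theta> A = (\<Sum>i\<in>?I. exp (e i))"
    using trace_exp_dil_eigensystem by blast
  obtain x where x: "L2_set x {..<c} = 1" "L2_set (mv {..<c} A x) {..<r} = nrm r c A"
    using nrm_bound(2)[OF assms] by blast
  define \<sigma> where "\<sigma> = nrm r c A"
  have "\<exists>w. ip ?I w w = 1 \<and> ip ?I w (mv ?I (\<lambda>p. \<theta> * dil A p) w) = \<theta> * \<sigma>"
  proof (cases "\<sigma> = 0")
    case True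
    define w where "w = case_sum (\<lambda>_ :: nat. 0 :: real) x"
    have "w \<circ> Inl = (\<lambda>_. 0)" "w \<circ> Inr = x" by (auto simp: w_def)
    then have "ip ?I w w = (L2_set x {..<c})\<^sup>2" and "ip ?I w (mv ?I (\<lambda>p. \<theta> * dil A p) w) = 0"
      unfolding ip_mv_dil unfolding ip_dil_index by (simp_all add: ip_self_L2[symmetric]) (simp_all add: ip_def)
    then show ?thesis
      using True x(1) by (intro exI[of _ w]) simp
  next
    case False
    define w where "w = case_sum (\<lambda>k. (1 / (\<sigma> * sqrt 2)) * mv {..<c} A x k) (\<lambda>l. (1 / sqrt 2) * x l)"
    have w: "w \<circ> Inl = (\<lambda>k. (1 / (\<sigma> * sqrt 2)) * mv {..<c} A x k)" "w \<circ> Inr = (\<lambda>l. (1 / sqrt 2) * x l)"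
      by (auto simp: w_def)
    have "ip ?I w w = 1"
      unfolding ip_dil_index w ip_scale_left ip_scale_right unfolding ip_self_L2 x
      using False by (simp add: \<sigma>_def[symmetric] power2_eq_square)
    moreover have "ip ?I w (mv ?I (\<lambda>p. \<theta> * dil A p) w) = \<theta> * \<sigma>"
      unfolding ip_mv_dil w mv_scale ip_scale_left ip_scale_right ip_self_L2 x
      using False by (simp add: \<sigma>_def[symmetric] power2_eq_square)
    ultimately show ?thesis by blast
  qed
  then obtain w where w: "ip ?I w w = 1" "ip ?I w (mv ?I (\<lambda>p. \<theta> * dil A p) w) = \<theta> * \<sigma>"
    by blast
  have "exp (ip ?I w (mv ?I (\<lambda>p. \<theta> * dil A p) w)) \<le> (\<Sum>i\<in>?I. exp (e i))"
    by (rule exp_quadratic_le_trace[OF _ ue(1) symm_dil w(1)]) simp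
  then show ?thesis
    by (simp only: w(2) ue(2) \<sigma>_def)
qed

section \<open>Decoupling by beta-mixing\<close>

lemma sum_measure_partition:
  assumes "prob_space M" "partition_on (space M) P" "finite P" "P \<subseteq> sets M" "E \<in> sets M"
  shows "(\<Sum>A\<in>P. measure M (A \<inter> E)) = measure M E"
proof -
  interpret prob_space M by fact
  have d: "A \<inter> B = {}" if "A \<in> P" "B \<in> P" "A \<noteq> B" for A B
    using assms(2) that by (auto simp: partition_on_def dest: disjointD)
  have "measure M (\<Union>A\<in>P. A \<inter> E) = (\<Sum>A\<in>P. measure M (A \<inter> E))"
    using assms by (intro finite_measure_finite_Union) (auto simp: disjoint_family_on_def, (use d in blast)+)
  moreover have "(\<Union>A\<in>P. A \<inter> E) = E"
    using assms sets.sets_into_space[OF assms(5)] by (auto simp: partition_on_def)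
  ultimately show ?thesis by simp
qed

text \<open>
  This bounds the sets whose suprema define \<open>\<beta>\<close>; without it the real-valued \<open>SUP\<close> would carry no information.
\<close>
lemma partition_dependence_le_2:
  assumes "prob_space M" "\<A> \<subseteq> sets M" "\<B> \<subseteq> sets M"
    and "P \<in> finite_partitions (space M) \<A>" "Q \<in> finite_partitions (space M) \<B>"
  shows "(\<Sum>(A, B)\<in>P \<times> Q. \<bar>measure M (A \<inter> B) - measure M A * measure M B\<bar>) \<le> 2"
proof -
  interpret prob_space M by fact
  have P: "partition_on (space M) P" "finite P" "P \<subseteq> sets M"
    and Q: "partition_on (space M) Q" "finite Q" "Q \<subseteq> sets M"
    using assms by (auto simp: finite_partitions_def)
  have P1: "(\<Sum>A\<in>P. measure M A) = 1"
    using sum_measure_partition[OF assms(1) P sets.top] P(3) sets.sets_into_space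
    by (simp add: prob_space Int_absorb2 subset_iff cong: sum.cong)
  have Q1: "(\<Sum>B\<in>Q. measure M B) = 1"
    using sum_measure_partition[OF assms(1) Q sets.top] Q(3) sets.sets_into_space
    by (simp add: prob_space Int_absorb2 subset_iff cong: sum.cong)
  have "(\<Sum>(A, B)\<in>P \<times> Q. \<bar>measure M (A \<inter> B) - measure M A * measure M B\<bar>)
      \<le> (\<Sum>(A, B)\<in>P \<times> Q. measure M (A \<inter> B) + measure M A * measure M B)"
    by (intro sum_mono) (auto intro!: order_trans[OF abs_triangle_ineq4])
  also have "\<dots> = (\<Sum>B\<in>Q. \<Sum>A\<in>P. measure M (A \<inter> B)) + (\<Sum>A\<in>P. \<Sum>B\<in>Q. measure M A * measure M B)"
    by (subst sum.swap) (simp add: sum.cartesian_product[symmetric] sum.distrib)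
  also have "(\<Sum>B\<in>Q. \<Sum>A\<in>P. measure M (A \<inter> B)) = 1"
    using sum_measure_partition[OF assms(1) P] Q(3) Q1 by (simp add: subset_iff)
  also have "(\<Sum>A\<in>P. \<Sum>B\<in>Q. measure M A * measure M B) = 1"
    by (simp add: P1 Q1 flip: sum_distrib_left)
  finally show ?thesis by simp
qed

lemma bdd_above_partition_dependence:
  assumes "prob_space M" "\<A> \<subseteq> sets M" "\<B> \<subseteq> sets M"
  shows "bdd_above ((\<lambda>(P, Q). \<Sum>(A, B)\<in>P \<times> Q. \<bar>measure M (A \<inter> B) - measure M A * measure M B\<bar>)
    ` (finite_partitions (space M) \<A> \<times> finite_partitions (space M) \<B>))"
  using partition_dependence_le_2[OF assms] by (intro bdd_aboveI[of _ 2]) auto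

lemma partition_dependence_le_beta_dep:
  assumes "prob_space M" "\<A> \<subseteq> sets M" "\<B> \<subseteq> sets M"
    and "P \<in> finite_partitions (space M) \<A>" "Q \<in> finite_partitions (space M) \<B>"
  shows "(\<Sum>(A, B)\<in>P \<times> Q. \<bar>measure M (A \<inter> B) - measure M A * measure M B\<bar>) \<le> 2 * beta_dep M \<A> \<B>"
  using cSUP_upper[OF _ bdd_above_partition_dependence[OF assms(1-3)], of "(P, Q)"] assms(4,5)
  by (simp add: beta_dep_def)

lemma beta_dep_le_1:
  assumes "prob_space M" "\<A> \<subseteq> sets M" "\<B> \<subseteq> sets M" "space M \<in> \<A>" "space M \<in> \<B>"
  shows "beta_dep M \<A> \<B> \<le> 1"
proof -
  interpret prob_space M by fact
  have "{space M} \<in> finite_partitions (space M) \<A>" "{space M} \<in> finite_partitions (space M) \<B>"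
    using assms(4,5) not_empty by (auto simp: finite_partitions_def partition_on_def disjoint_def)
  then have "finite_partitions (space M) \<A> \<times> finite_partitions (space M) \<B> \<noteq> {}" by blast
  then have "(SUP (P, Q) \<in> finite_partitions (space M) \<A> \<times> finite_partitions (space M) \<B>.
        \<Sum>(A, B)\<in>P \<times> Q. \<bar>measure M (A \<inter> B) - measure M A * measure M B\<bar>) \<le> 2"
    using partition_dependence_le_2[OF assms(1-3)] by (intro cSUP_least) auto
  then show ?thesis by (simp add: beta_dep_def)
qed

lemma sigma_generated_subset:
  assumes "\<And>i. i \<in> J \<Longrightarrow> X i \<in> measurable M S"
  shows "sigma_generated M S X J \<subseteq> sets M"
  unfolding sigma_generated_def
  using assms by (intro sets.sigma_sets_subset) (auto intro: measurable_sets)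

lemma beta_dep_le_beta_coeff:
  assumes "prob_space M" "\<And>i. X i \<in> measurable M S"
  shows "beta_dep M (sigma_generated M S X {..i}) (sigma_generated M S X {i + int q..}) \<le> beta_coeff M S X q"
  unfolding beta_coeff_def
proof (rule cSUP_upper)
  show "bdd_above (range (\<lambda>i. beta_dep M (sigma_generated M S X {..i}) (sigma_generated M S X {i + int q..})))"
    using assms
    by (intro bdd_aboveI[of _ 1])
       (auto intro!: beta_dep_le_1 sigma_generated_subset, auto simp: sigma_generated_def intro!: sigma_sets_top)
qed simp

lemma integral_finite_range:
  fixes g :: "'u \<Rightarrow> real"
  assumes "finite_measure M" "finite T" "U ` space M \<subseteq> T" and m: "\<And>u. u \<in> T \<Longrightarrow> U -` {u} \<inter> space M \<in> sets M"
  shows "(\<integral>\<omega>. g (U \<omega>) \<partial>M) = (\<Sum>u\<in>T. g u * measure M (U -` {u} \<inter> space M))"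
proof -
  interpret finite_measure M by fact
  have "(\<integral>\<omega>. g (U \<omega>) \<partial>M) = (\<integral>\<omega>. (\<Sum>u\<in>T. g u * indicator (U -` {u} \<inter> space M) \<omega>) \<partial>M)"
  proof (rule Bochner_Integration.integral_cong[OF refl])
    fix \<omega> assume "\<omega> \<in> space M"
    then have "(\<Sum>u\<in>T. g u * indicator (U -` {u} \<inter> space M) \<omega>) = (\<Sum>u\<in>T. if u = U \<omega> then g u else 0)"
      by (intro sum.cong) (auto simp: indicator_def)
    also have "\<dots> = g (U \<omega>)" using assms \<open>\<omega> \<in> space M\<close> by auto
    finally show "g (U \<omega>) = (\<Sum>u\<in>T. g u * indicator (U -` {u} \<inter> space M) \<omega>)" by simp
  qed
  also have "\<dots> = (\<Sum>u\<in>T. \<integral>\<omega>. g u * indicator (U -` {u} \<inter> space M) \<omega> \<partial>M)"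
    using m by (intro Bochner_Integration.integral_sum) (auto simp: less_top[symmetric])
  also have "\<dots> = (\<Sum>u\<in>T. g u * measure M (U -` {u} \<inter> space M))"
    using m by (intro sum.cong) auto
  finally show ?thesis .
qed

lemma level_sets_finite_partition:
  assumes "finite (U ` space M)" "\<And>u. U -` {u} \<inter> space M \<in> \<A>"
  shows "(\<lambda>u. U -` {u} \<inter> space M) ` (U ` space M) \<in> finite_partitions (space M) \<A>"
  using assms by (auto simp: finite_partitions_def partition_on_def disjoint_def)

text \<open>
  The level sets of \<open>U\<close> and \<open>V\<close> form two finite partitions, and the difference of the two integrals is
  \<open>\<Sum>u v. f u v (P(U = u, V = v) - P(U = u) P(V = v))\<close>.
\<close>
lemma beta_decouple_finite_range:
  fixes U :: "'a \<Rightarrow> 'u" and V :: "'a \<Rightarrow> 'v" and f :: "'u \<Rightarrow> 'v \<Rightarrow> real"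
  assumes M: "prob_space M" and A: "\<A> \<subseteq> sets M" and B: "\<B> \<subseteq> sets M"
    and U: "finite (U ` space M)" "\<And>u. U -` {u} \<inter> space M \<in> \<A>"
    and V: "finite (V ` space M)" "\<And>v. V -` {v} \<inter> space M \<in> \<B>"
    and f: "\<And>u v. 0 \<le> f u v \<and> f u v \<le> 1"
  shows "(\<integral>\<omega>. f (U \<omega>) (V \<omega>) \<partial>M) \<le> (\<integral>\<omega>. (\<integral>\<omega>'. f (U \<omega>) (V \<omega>') \<partial>M) \<partial>M) + 2 * beta_dep M \<A> \<B>"
proof -
  interpret prob_space M by fact
  define a where "a u = U -` {u} \<inter> space M" for u
  define b where "b v = V -` {v} \<inter> space M" for v
  define T where "T = U ` space M"
  define T' where "T' = V ` space M"
  have ab: "a u \<in> sets M" "b v \<in> sets M" for u v using U(2) V(2) A B by (auto simp: a_def b_def)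
  have joint: "(\<integral>\<omega>. f (U \<omega>) (V \<omega>) \<partial>M) = (\<Sum>(u, v)\<in>T \<times> T'. f u v * measure M (a u \<inter> b v))"
  proof -
    have eq: "(\<lambda>\<omega>. (U \<omega>, V \<omega>)) -` {p} \<inter> space M = a (fst p) \<inter> b (snd p)" for p
      by (auto simp: a_def b_def)
    have "(\<integral>\<omega>. case_prod f (U \<omega>, V \<omega>) \<partial>M) =
        (\<Sum>p\<in>T \<times> T'. case_prod f p * measure M ((\<lambda>\<omega>. (U \<omega>, V \<omega>)) -` {p} \<inter> space M))"
      using U V ab unfolding T_def T'_def
      by (intro integral_finite_range) (auto simp: eq, unfold_locales)
    then show ?thesis by (simp add: eq case_prod_beta)
  qed
  have "(\<integral>\<omega>'. f u (V \<omega>') \<partial>M) = (\<Sum>v\<in>T'. f u v * measure M (b v))" for u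
    unfolding b_def T'_def using V ab by (intro integral_finite_range) (auto simp: b_def, unfold_locales)
  then have prod: "(\<integral>\<omega>. (\<integral>\<omega>'. f (U \<omega>) (V \<omega>') \<partial>M) \<partial>M) = (\<Sum>(u, v)\<in>T \<times> T'. f u v * (measure M (a u) * measure M (b v)))"
    using integral_finite_range[OF _ U(1) order_refl, where g = "\<lambda>u. \<Sum>v\<in>T'. f u v * measure M (b v)"] ab finite_measure_axioms
    by (simp add: a_def T_def sum.cartesian_product[symmetric] sum_distrib_right sum_distrib_left mult_ac)
  have "(\<Sum>(u, v)\<in>T \<times> T'. f u v * measure M (a u \<inter> b v)) - (\<Sum>(u, v)\<in>T \<times> T'. f u v * (measure M (a u) * measure M (b v)))
     = (\<Sum>(u, v)\<in>T \<times> T'. f u v * (measure M (a u \<inter> b v) - measure M (a u) * measure M (b v)))"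
    by (simp add: sum_subtractf case_prod_beta algebra_simps)
  also have "\<dots> \<le> (\<Sum>(u, v)\<in>T \<times> T'. \<bar>measure M (a u \<inter> b v) - measure M (a u) * measure M (b v)\<bar>)"
  proof (intro sum_mono, clarify)
    fix u v
    have "f u v * (measure M (a u \<inter> b v) - measure M (a u) * measure M (b v))
       \<le> f u v * \<bar>measure M (a u \<inter> b v) - measure M (a u) * measure M (b v)\<bar>"
      using f by (intro mult_left_mono) auto
    also have "\<dots> \<le> 1 * \<bar>measure M (a u \<inter> b v) - measure M (a u) * measure M (b v)\<bar>"
      using f by (intro mult_right_mono) auto
    finally show "f u v * (measure M (a u \<inter> b v) - measure M (a u) * measure M (b v))
       \<le> \<bar>measure M (a u \<inter> b v) - measure M (a u) * measure M (b v)\<bar>" by simp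
  qed
  also have "\<dots> = (\<Sum>(A, B)\<in>(a ` T) \<times> (b ` T'). \<bar>measure M (A \<inter> B) - measure M A * measure M B\<bar>)"
  proof -
    have "inj_on a T" "inj_on b T'"
      by (auto simp: inj_on_def a_def b_def T_def T'_def)
    then have "inj_on (map_prod a b) (T \<times> T')" by (rule map_prod_inj_on)
    moreover have "(a ` T) \<times> (b ` T') = map_prod a b ` (T \<times> T')"
      by (simp add: map_prod_image)
    ultimately show ?thesis by (simp add: sum.reindex case_prod_beta o_def)
  qed
  also have "\<dots> \<le> 2 * beta_dep M \<A> \<B>"
    using level_sets_finite_partition[OF U] level_sets_finite_partition[OF V] M A B
    unfolding a_def b_def T_def T'_def by (intro partition_dependence_le_beta_dep)
  finally show ?thesis using joint prod by simp
qed

definition lipschitz_01 :: "'k set \<Rightarrow> real \<Rightarrow> (('k \<Rightarrow> real) \<Rightarrow> real) \<Rightarrow> bool" where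
  "lipschitz_01 K L F \<longleftrightarrow>
     (\<forall>x. 0 \<le> F x \<and> F x \<le> 1) \<and> (\<forall>x y. \<bar>F x - F y\<bar> \<le> L * (\<Sum>k\<in>K. \<bar>x k - y k\<bar>))"

lemma lipschitz_measurable:
  fixes F :: "('k::countable \<Rightarrow> real) \<Rightarrow> real"
  assumes lip: "\<And>x y. \<bar>F x - F y\<bar> \<le> L * (\<Sum>k\<in>K. \<bar>x k - y k\<bar>)"
    and U: "\<And>k. k \<in> K \<Longrightarrow> (\<lambda>\<omega>. U \<omega> k) \<in> borel_measurable M"
  shows "(\<lambda>\<omega>. F (U \<omega>)) \<in> borel_measurable M"
proof -
  have "isCont F x" for x
    unfolding isCont_def
  proof (rule tendsto_dist_iff[THEN iffD2], rule tendsto_sandwich)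
    show "\<forall>\<^sub>F y in at x. 0 \<le> dist (F y) (F x)" by simp
    show "\<forall>\<^sub>F y in at x. dist (F y) (F x) \<le> L * (\<Sum>k\<in>K. \<bar>y k - x k\<bar>)"
      using lip by (simp add: dist_real_def)
    have "((\<lambda>y. y k) \<longlongrightarrow> x k) (at x)" for k
    proof -
      have "continuous_on UNIV (\<lambda>y :: 'k \<Rightarrow> real. y k)"
        by (rule continuous_on_product_then_coordinatewise[OF continuous_on_id])
      then show ?thesis by (auto simp: continuous_on_def)
    qed
    then have "((\<lambda>y. L * (\<Sum>k\<in>K. \<bar>y k - x k\<bar>)) \<longlongrightarrow> L * (\<Sum>k\<in>K. \<bar>x k - x k\<bar>)) (at x)"
      by (intro tendsto_intros)
    then show "((\<lambda>y. L * (\<Sum>k\<in>K. \<bar>y k - x k\<bar>)) \<longlongrightarrow> 0) (at x)" by simp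
  qed simp
  then have "continuous_on UNIV F" by (simp add: continuous_at_imp_continuous_on)
  then have F: "F \<in> borel_measurable borel" by (rule borel_measurable_continuous_onI)
  have "(\<lambda>\<omega> k. if k \<in> K then U \<omega> k else 0) \<in> borel_measurable M"
  proof (rule measurable_coordinatewise_then_product)
    fix k show "(\<lambda>\<omega>. if k \<in> K then U \<omega> k else 0) \<in> borel_measurable M"
      using U by (cases "k \<in> K") simp_all
  qed
  from measurable_compose[OF this F] have "(\<lambda>\<omega>. F (\<lambda>k. if k \<in> K then U \<omega> k else 0)) \<in> borel_measurable M" .
  moreover have "F (\<lambda>k. if k \<in> K then U \<omega> k else 0) = F (U \<omega>)" for \<omega>
    using lip[of "\<lambda>k. if k \<in> K then U \<omega> k else 0" "U \<omega>"] by simp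
  ultimately show ?thesis by simp
qed

lemma lipschitz_01_measurable:
  fixes F :: "('k::countable \<Rightarrow> real) \<Rightarrow> real"
  assumes "lipschitz_01 K L F" "\<And>k. k \<in> K \<Longrightarrow> (\<lambda>\<omega>. U \<omega> k) \<in> borel_measurable M"
  shows "(\<lambda>\<omega>. F (U \<omega>)) \<in> borel_measurable M"
  using assms by (intro lipschitz_measurable[of F L K]) (auto simp: lipschitz_01_def)

lemma lipschitz_01_integrable:
  fixes F :: "('k::countable \<Rightarrow> real) \<Rightarrow> real"
  assumes "finite_measure M" "lipschitz_01 K L F" "\<And>k. k \<in> K \<Longrightarrow> (\<lambda>\<omega>. U \<omega> k) \<in> borel_measurable M"
  shows "integrable M (\<lambda>\<omega>. F (U \<omega>))"
  using assms by (intro finite_measure.integrable_const_bound[where B = 1] lipschitz_01_measurable[of K L F])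
    (auto simp: lipschitz_01_def)

text \<open>
  Averaging over \<open>V\<close> preserves the class, including the Lipschitz constant. This is what makes the decoupling
  step repeatable.
\<close>
lemma lipschitz_01_average:
  fixes F :: "('k::countable \<Rightarrow> real) \<Rightarrow> real"
  assumes "prob_space M" and F: "lipschitz_01 K L F" and V: "\<And>k. k \<in> K \<Longrightarrow> (\<lambda>\<omega>. V \<omega> k) \<in> borel_measurable M"
  shows "lipschitz_01 K L (\<lambda>x. \<integral>\<omega>. F (\<lambda>k. x k + V \<omega> k) \<partial>M)"
proof -
  interpret prob_space M by fact
  have int: "integrable M (\<lambda>\<omega>. F (\<lambda>k. x k + V \<omega> k))" for x
    using F V by (intro lipschitz_01_integrable) (auto, unfold_locales)
  have le: "(\<integral>\<omega>. F (\<lambda>k. x k + V \<omega> k) \<partial>M) \<le> (\<integral>\<omega>. F (\<lambda>k. y k + V \<omega> k) \<partial>M) + L * (\<Sum>k\<in>K. \<bar>x k - y k\<bar>)" for x y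
  proof -
    have "(\<integral>\<omega>. F (\<lambda>k. x k + V \<omega> k) \<partial>M) \<le> (\<integral>\<omega>. F (\<lambda>k. y k + V \<omega> k) + L * (\<Sum>k\<in>K. \<bar>x k - y k\<bar>) \<partial>M)"
    proof (intro integral_mono int Bochner_Integration.integrable_add integrable_const)
      fix \<omega>
      have "\<bar>F (\<lambda>k. x k + V \<omega> k) - F (\<lambda>k. y k + V \<omega> k)\<bar> \<le> L * (\<Sum>k\<in>K. \<bar>(x k + V \<omega> k) - (y k + V \<omega> k)\<bar>)"
        using F unfolding lipschitz_01_def by blast
      then show "F (\<lambda>k. x k + V \<omega> k) \<le> F (\<lambda>k. y k + V \<omega> k) + L * (\<Sum>k\<in>K. \<bar>x k - y k\<bar>)"
        by simp
    qed
    also have "\<dots> = (\<integral>\<omega>. F (\<lambda>k. y k + V \<omega> k) \<partial>M) + L * (\<Sum>k\<in>K. \<bar>x k - y k\<bar>)"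
      by (subst Bochner_Integration.integral_add) (auto simp: int prob_space)
    finally show ?thesis .
  qed
  have "\<bar>(\<integral>\<omega>. F (\<lambda>k. x k + V \<omega> k) \<partial>M) - (\<integral>\<omega>. F (\<lambda>k. y k + V \<omega> k) \<partial>M)\<bar> \<le> L * (\<Sum>k\<in>K. \<bar>x k - y k\<bar>)" for x y
    using le[of x y] le[of y x] by (simp add: abs_le_iff abs_minus_commute)
  moreover have "0 \<le> (\<integral>\<omega>. F (\<lambda>k. x k + V \<omega> k) \<partial>M)" for x
    using F by (intro Bochner_Integration.integral_nonneg) (simp add: lipschitz_01_def)
  moreover have "(\<integral>\<omega>. F (\<lambda>k. x k + V \<omega> k) \<partial>M) \<le> 1" for x
    using F by (intro integral_le_const int) (simp add: lipschitz_01_def)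
  ultimately show ?thesis by (simp add: lipschitz_01_def)
qed

text \<open>
  Rounding down to a multiple of \<open>\<delta>\<close> after truncation to \<open>[-B, B]\<close>. The truncation makes the range finite even where
  an almost sure bound fails.
\<close>
definition grid :: "real \<Rightarrow> real \<Rightarrow> real \<Rightarrow> real" where
  "grid \<delta> B x = \<delta> * of_int \<lfloor>max (- B) (min B x) / \<delta>\<rfloor>"

lemma grid_measurable: "grid \<delta> B \<in> borel_measurable borel"
  unfolding grid_def by measurable

lemma finite_range_grid: "\<delta> > 0 \<Longrightarrow> finite (range (grid \<delta> B))"
proof -
  assume d: "\<delta> > 0"
  have "- \<bar>B\<bar> \<le> max (- B) (min B x)" "max (- B) (min B x) \<le> \<bar>B\<bar>" for x
    by linarith+
  then have "\<lfloor>- \<bar>B\<bar> / \<delta>\<rfloor> \<le> \<lfloor>max (- B) (min B x) / \<delta>\<rfloor>" "\<lfloor>max (- B) (min B x) / \<delta>\<rfloor> \<le> \<lfloor>\<bar>B\<bar> / \<delta>\<rfloor>" for x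
    using d by (intro floor_mono divide_right_mono; simp)+
  then have "range (grid \<delta> B) \<subseteq> (\<lambda>j. \<delta> * of_int j) ` {\<lfloor>- \<bar>B\<bar> / \<delta>\<rfloor>..\<lfloor>\<bar>B\<bar> / \<delta>\<rfloor>}"
    unfolding grid_def by (intro image_subsetI imageI) simp
  then show ?thesis by (rule finite_subset) simp
qed

lemma grid_close: "\<delta> > 0 \<Longrightarrow> \<bar>x\<bar> \<le> B \<Longrightarrow> \<bar>grid \<delta> B x - x\<bar> \<le> \<delta>"
proof -
  assume d: "\<delta> > 0" and x: "\<bar>x\<bar> \<le> B"
  have "max (- B) (min B x) = x" using x by (auto simp: abs_le_iff)
  then have g: "grid \<delta> B x = \<delta> * of_int \<lfloor>x / \<delta>\<rfloor>" by (simp add: grid_def)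
  have "\<delta> * of_int \<lfloor>x / \<delta>\<rfloor> \<le> \<delta> * (x / \<delta>)" "\<delta> * (x / \<delta>) \<le> \<delta> * (of_int \<lfloor>x / \<delta>\<rfloor> + 1)"
    using d by (intro mult_left_mono; linarith)+
  then have "\<delta> * of_int \<lfloor>x / \<delta>\<rfloor> \<le> x" "x \<le> \<delta> * of_int \<lfloor>x / \<delta>\<rfloor> + \<delta>"
    using d by (simp_all add: distrib_left)
  then show ?thesis by (simp add: g)
qed

definition grid_vec :: "'k set \<Rightarrow> real \<Rightarrow> real \<Rightarrow> ('k \<Rightarrow> real) \<Rightarrow> 'k \<Rightarrow> real" where
  "grid_vec K \<delta> B x = (\<lambda>k. if k \<in> K then grid \<delta> B (x k) else 0)"

lemma finite_range_grid_vec: "finite K \<Longrightarrow> \<delta> > 0 \<Longrightarrow> finite (range (grid_vec K \<delta> B))"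
  by (rule finite_subset[OF _ finite_set_of_finite_funs[of K "range (grid \<delta> B)" 0]])
     (auto simp: grid_vec_def finite_range_grid)

lemma level_sets_grid_vec:
  assumes "finite K" "\<And>k. k \<in> K \<Longrightarrow> (\<lambda>\<omega>. U \<omega> k) \<in> borel_measurable N"
  shows "(\<lambda>\<omega>. grid_vec K \<delta> B (U \<omega>)) -` {u} \<inter> space N \<in> sets N"
proof (cases "\<forall>k. k \<notin> K \<longrightarrow> u k = 0")
  case True
  have "(\<lambda>\<omega>. grid_vec K \<delta> B (U \<omega>)) -` {u} \<inter> space N = {\<omega> \<in> space N. \<forall>k\<in>K. grid \<delta> B (U \<omega> k) = u k}"
    using True by (auto simp: grid_vec_def fun_eq_iff)
  moreover have "(\<lambda>\<omega>. grid \<delta> B (U \<omega> k)) \<in> borel_measurable N" if "k \<in> K" for k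
    using measurable_compose[OF assms(2)[OF that] grid_measurable] .
  then have "{\<omega> \<in> space N. \<forall>k\<in>K. grid \<delta> B (U \<omega> k) = u k} \<in> sets N"
    using assms(1) by (intro sets.sets_Collect_finite_All borel_measurable_eq) auto
  ultimately show ?thesis by simp
next
  case False
  then have "(\<lambda>\<omega>. grid_vec K \<delta> B (U \<omega>)) -` {u} \<inter> space N = {}"
    by (auto simp: grid_vec_def)
  then show ?thesis by (simp only: sets.empty_sets)
qed

text \<open>
  Rounding both vectors to a grid of width \<open>\<delta>\<close> changes \<open>F\<close> by \<open>O(\<delta>)\<close> and leaves finitely many values.
\<close>
lemma beta_decouple_lipschitz:
  fixes F :: "('k::countable \<Rightarrow> real) \<Rightarrow> real"
  assumes M: "prob_space M" and N: "subalgebra M N" "subalgebra M N'" and fin: "finite K" and L: "0 \<le> L"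
    and U: "\<And>k. k \<in> K \<Longrightarrow> (\<lambda>\<omega>. U \<omega> k) \<in> borel_measurable N"
    and V: "\<And>k. k \<in> K \<Longrightarrow> (\<lambda>\<omega>. V \<omega> k) \<in> borel_measurable N'"
    and bU: "AE \<omega> in M. \<forall>k\<in>K. \<bar>U \<omega> k\<bar> \<le> B" and bV: "AE \<omega> in M. \<forall>k\<in>K. \<bar>V \<omega> k\<bar> \<le> B"
    and F: "lipschitz_01 K L F"
  shows "(\<integral>\<omega>. F (\<lambda>k. U \<omega> k + V \<omega> k) \<partial>M)
     \<le> (\<integral>\<omega>. (\<integral>\<omega>'. F (\<lambda>k. U \<omega> k + V \<omega>' k) \<partial>M) \<partial>M) + 2 * beta_dep M (sets N) (sets N')"
proof (rule field_le_epsilon)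
  interpret prob_space M by fact
  fix \<epsilon> :: real assume "\<epsilon> > 0"
  \<comment> \<open>Two roundings, each of two vectors, cost \<open>4 L card(K) \<delta>\<close>; the summand \<open>1\<close> avoids a division by zero.\<close>
  define \<delta> where "\<delta> = \<epsilon> / (4 * L * real (card K) + 1)"
  have \<delta>: "\<delta> > 0" using \<open>\<epsilon> > 0\<close> L by (simp add: \<delta>_def add_nonneg_pos)
  define \<eta> where "\<eta> = L * (real (card K) * (2 * \<delta>))"
  have \<eta>: "2 * \<eta> \<le> \<epsilon>"
  proof -
    have "2 * \<eta> \<le> \<delta> * (4 * L * real (card K) + 1)"
      using \<delta> by (simp add: \<eta>_def algebra_simps)
    also have "\<dots> = \<epsilon>"
    proof -
      have "4 * L * real (card K) + 1 > 0" using L by (simp add: add_nonneg_pos)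
      then show ?thesis by (simp add: \<delta>_def)
    qed
    finally show ?thesis .
  qed
  define Ud where "Ud \<omega> = grid_vec K \<delta> B (U \<omega>)" for \<omega>
  define Vd where "Vd \<omega> = grid_vec K \<delta> B (V \<omega>)" for \<omega>
  have UM: "(\<lambda>\<omega>. U \<omega> k) \<in> borel_measurable M" and VM: "(\<lambda>\<omega>. V \<omega> k) \<in> borel_measurable M" if "k \<in> K" for k
    using that U V N by (auto intro: measurable_from_subalg)
  have UdM: "(\<lambda>\<omega>. Ud \<omega> k) \<in> borel_measurable M" and VdM: "(\<lambda>\<omega>. Vd \<omega> k) \<in> borel_measurable M" for k
    using measurable_compose[OF UM grid_measurable] measurable_compose[OF VM grid_measurable]
    by (cases "k \<in> K"; simp add: Ud_def Vd_def grid_vec_def)+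
  have fm: "finite_measure M" by unfold_locales
  note int = lipschitz_01_integrable[OF fm F]
  have close: "\<bar>F (\<lambda>k. U \<omega> k + V \<omega>' k) - F (\<lambda>k. Ud \<omega> k + Vd \<omega>' k)\<bar> \<le> \<eta>"
    if b: "\<forall>k\<in>K. \<bar>U \<omega> k\<bar> \<le> B" "\<forall>k\<in>K. \<bar>V \<omega>' k\<bar> \<le> B" for \<omega> \<omega>'
  proof -
    have "\<bar>F (\<lambda>k. U \<omega> k + V \<omega>' k) - F (\<lambda>k. Ud \<omega> k + Vd \<omega>' k)\<bar>
        \<le> L * (\<Sum>k\<in>K. \<bar>(U \<omega> k + V \<omega>' k) - (Ud \<omega> k + Vd \<omega>' k)\<bar>)"
      using F unfolding lipschitz_01_def by blast
    also have "\<dots> \<le> L * (\<Sum>k\<in>K. 2 * \<delta>)"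
    proof (intro mult_left_mono sum_mono L)
      fix k assume k: "k \<in> K"
      show "\<bar>(U \<omega> k + V \<omega>' k) - (Ud \<omega> k + Vd \<omega>' k)\<bar> \<le> 2 * \<delta>"
        using grid_close[OF \<delta>, of "U \<omega> k" B] grid_close[OF \<delta>, of "V \<omega>' k" B] b k
        by (simp add: Ud_def Vd_def grid_vec_def abs_le_iff)
    qed
    finally show ?thesis by (simp add: \<eta>_def)
  qed
  have "(\<integral>\<omega>. F (\<lambda>k. U \<omega> k + V \<omega> k) \<partial>M) \<le> (\<integral>\<omega>. F (\<lambda>k. Ud \<omega> k + Vd \<omega> k) + \<eta> \<partial>M)"
  proof (intro integral_mono_AE)
    show "AE \<omega> in M. F (\<lambda>k. U \<omega> k + V \<omega> k) \<le> F (\<lambda>k. Ud \<omega> k + Vd \<omega> k) + \<eta>"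
      using bU bV by eventually_elim (use close in \<open>force simp: abs_le_iff\<close>)
  qed (use UM VM UdM VdM in \<open>auto intro!: int\<close>)
  also have "\<dots> = (\<integral>\<omega>. F (\<lambda>k. Ud \<omega> k + Vd \<omega> k) \<partial>M) + \<eta>"
    using UdM VdM by (subst Bochner_Integration.integral_add) (auto intro!: int simp: prob_space)
  also have "(\<integral>\<omega>. F (\<lambda>k. Ud \<omega> k + Vd \<omega> k) \<partial>M)
     \<le> (\<integral>\<omega>. (\<integral>\<omega>'. F (\<lambda>k. Ud \<omega> k + Vd \<omega>' k) \<partial>M) \<partial>M) + 2 * beta_dep M (sets N) (sets N')"
  proof (rule beta_decouple_finite_range[OF M, where f = "\<lambda>u v. F (\<lambda>k. u k + v k)"])
    show "sets N \<subseteq> sets M" "sets N' \<subseteq> sets M" using N by (auto simp: subalgebra_def)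
    show "finite (Ud ` space M)" "finite (Vd ` space M)"
      by (rule finite_subset[OF _ finite_range_grid_vec[OF fin \<delta>, of B]]; auto simp: Ud_def Vd_def)+
    show "Ud -` {u} \<inter> space M \<in> sets N" for u
      using level_sets_grid_vec[OF fin, of U N \<delta> B u] U N by (simp add: Ud_def[abs_def] subalgebra_def)
    show "Vd -` {u} \<inter> space M \<in> sets N'" for u
      using level_sets_grid_vec[OF fin, of V N' \<delta> B u] V N by (simp add: Vd_def[abs_def] subalgebra_def)
    show "0 \<le> F (\<lambda>k. u k + v k) \<and> F (\<lambda>k. u k + v k) \<le> 1" for u v
      using F by (simp add: lipschitz_01_def)
  qed
  also have "(\<integral>\<omega>. (\<integral>\<omega>'. F (\<lambda>k. Ud \<omega> k + Vd \<omega>' k) \<partial>M) \<partial>M) \<le> (\<integral>\<omega>. (\<integral>\<omega>'. F (\<lambda>k. U \<omega> k + V \<omega>' k) \<partial>M) + \<eta> \<partial>M)"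
  proof (intro integral_mono_AE)
    show "AE \<omega> in M. (\<integral>\<omega>'. F (\<lambda>k. Ud \<omega> k + Vd \<omega>' k) \<partial>M) \<le> (\<integral>\<omega>'. F (\<lambda>k. U \<omega> k + V \<omega>' k) \<partial>M) + \<eta>"
      using bU
    proof eventually_elim
      fix \<omega> assume b: "\<forall>k\<in>K. \<bar>U \<omega> k\<bar> \<le> B"
      have "(\<integral>\<omega>'. F (\<lambda>k. Ud \<omega> k + Vd \<omega>' k) \<partial>M) \<le> (\<integral>\<omega>'. F (\<lambda>k. U \<omega> k + V \<omega>' k) + \<eta> \<partial>M)"
      proof (intro integral_mono_AE)
        show "AE \<omega>' in M. F (\<lambda>k. Ud \<omega> k + Vd \<omega>' k) \<le> F (\<lambda>k. U \<omega> k + V \<omega>' k) + \<eta>"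
          using bV by eventually_elim (use close[OF b] in \<open>force simp: abs_le_iff\<close>)
      qed (use VM VdM in \<open>auto intro!: int\<close>)
      also have "\<dots> = (\<integral>\<omega>'. F (\<lambda>k. U \<omega> k + V \<omega>' k) \<partial>M) + \<eta>"
        using VM by (subst Bochner_Integration.integral_add) (auto intro!: int simp: prob_space)
      finally show "(\<integral>\<omega>'. F (\<lambda>k. Ud \<omega> k + Vd \<omega>' k) \<partial>M) \<le> (\<integral>\<omega>'. F (\<lambda>k. U \<omega> k + V \<omega>' k) \<partial>M) + \<eta>" .
    qed
    show "integrable M (\<lambda>\<omega>. \<integral>\<omega>'. F (\<lambda>k. Ud \<omega> k + Vd \<omega>' k) \<partial>M)"
      using lipschitz_01_integrable[OF fm lipschitz_01_average[OF M F VdM] UdM] .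
    show "integrable M (\<lambda>\<omega>. (\<integral>\<omega>'. F (\<lambda>k. U \<omega> k + V \<omega>' k) \<partial>M) + \<eta>)"
      using lipschitz_01_integrable[OF fm lipschitz_01_average[OF M F VM] UM] by simp
  qed
  also have "\<dots> = (\<integral>\<omega>. (\<integral>\<omega>'. F (\<lambda>k. U \<omega> k + V \<omega>' k) \<partial>M) \<partial>M) + \<eta>"
    using lipschitz_01_integrable[OF fm lipschitz_01_average[OF M F VM] UM]
    by (subst Bochner_Integration.integral_add) (auto simp: prob_space)
  finally show "(\<integral>\<omega>. F (\<lambda>k. U \<omega> k + V \<omega> k) \<partial>M)
     \<le> (\<integral>\<omega>. (\<integral>\<omega>'. F (\<lambda>k. U \<omega> k + V \<omega>' k) \<partial>M) \<partial>M) + 2 * beta_dep M (sets N) (sets N') + \<epsilon>"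
    using \<eta> by simp
qed

text \<open>
  The last summand is averaged out first: \<open>F\<close> is replaced by \<open>G(x) = E F(x + Y\<^sub>m)\<close> at the price \<open>2 b\<close>. The
  induction therefore runs over all Lipschitz \<open>F\<close>. The bound \<open>F \<le> c \<Phi>\<close> turns into \<open>G \<le> (c a) \<Phi>\<close>. The potential
  \<open>\<Phi>\<close> may be unbounded, and no \<open>\<beta>\<close>-term is ever multiplied by it. The dominating function \<open>g\<close> in the
  assumption avoids a measurability requirement on \<open>\<Phi>\<close>.
\<close>
lemma decoupled_iteration:
  fixes Y :: "nat \<Rightarrow> 'a \<Rightarrow> 'k::countable \<Rightarrow> real" and F :: "('k \<Rightarrow> real) \<Rightarrow> real"
  assumes M: "prob_space M" and fin: "finite K" and L: "0 \<le> L" and a: "0 \<le> a" and c: "0 \<le> c"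
    and dep: "\<And>j. j < m \<Longrightarrow> \<exists>N N'. subalgebra M N \<and> subalgebra M N' \<and>
       (\<forall>k\<in>K. (\<lambda>\<omega>. \<Sum>i<j. Y i \<omega> k) \<in> borel_measurable N) \<and>
       (\<forall>k\<in>K. (\<lambda>\<omega>. Y j \<omega> k) \<in> borel_measurable N') \<and> beta_dep M (sets N) (sets N') \<le> b"
    and bnd: "\<And>j. j < m \<Longrightarrow> AE \<omega> in M. \<forall>k\<in>K. \<bar>Y j \<omega> k\<bar> \<le> B"
    and step: "\<And>j x. j < m \<Longrightarrow>
       \<exists>g. integrable M g \<and> (AE \<omega> in M. \<Phi> (\<lambda>k. x k + Y j \<omega> k) \<le> g \<omega>) \<and> (\<integral>\<omega>. g \<omega> \<partial>M) \<le> a * \<Phi> x"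
    and F: "lipschitz_01 K L F" and le: "\<And>x. F x \<le> c * \<Phi> x"
  shows "(\<integral>\<omega>. F (\<lambda>k. \<Sum>j<m. Y j \<omega> k) \<partial>M) \<le> c * a ^ m * \<Phi> (\<lambda>_. 0) + 2 * real m * b"
  using dep bnd step F le c
proof (induction m arbitrary: F c)
  case 0
  interpret prob_space M by fact
  show ?case using 0(5) by (simp add: prob_space)
next
  case (Suc m)
  interpret prob_space M by fact
  define G where "G x = (\<integral>\<omega>. F (\<lambda>k. x k + Y m \<omega> k) \<partial>M)" for x
  obtain N N' where N: "subalgebra M N" "subalgebra M N'"
    "\<And>k. k \<in> K \<Longrightarrow> (\<lambda>\<omega>. \<Sum>i<m. Y i \<omega> k) \<in> borel_measurable N"
    "\<And>k. k \<in> K \<Longrightarrow> (\<lambda>\<omega>. Y m \<omega> k) \<in> borel_measurable N'" "beta_dep M (sets N) (sets N') \<le> b"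
    using Suc.prems(1)[of m] by auto
  have YM: "(\<lambda>\<omega>. Y m \<omega> k) \<in> borel_measurable M" if "k \<in> K" for k
    using N that by (auto intro: measurable_from_subalg)
  have Ball: "AE \<omega> in M. \<forall>j\<in>{..<Suc m}. \<forall>k\<in>K. \<bar>Y j \<omega> k\<bar> \<le> B"
    by (rule AE_finite_allI) (use Suc.prems(2) in simp_all)
  have B1: "AE \<omega> in M. \<forall>k\<in>K. \<bar>\<Sum>i<m. Y i \<omega> k\<bar> \<le> real (Suc m) * B"
    using Ball
  proof eventually_elim
    fix \<omega> assume b: "\<forall>j\<in>{..<Suc m}. \<forall>k\<in>K. \<bar>Y j \<omega> k\<bar> \<le> B"
    show "\<forall>k\<in>K. \<bar>\<Sum>i<m. Y i \<omega> k\<bar> \<le> real (Suc m) * B"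
    proof
      fix k assume k: "k \<in> K"
      have "\<bar>\<Sum>i<m. Y i \<omega> k\<bar> \<le> (\<Sum>i<m. \<bar>Y i \<omega> k\<bar>)" by (rule sum_abs)
      also have "\<dots> \<le> (\<Sum>i<Suc m. \<bar>Y i \<omega> k\<bar>)" by simp
      also have "\<dots> \<le> (\<Sum>i<Suc m. B)" using b k by (intro sum_mono) auto
      finally show "\<bar>\<Sum>i<m. Y i \<omega> k\<bar> \<le> real (Suc m) * B" by simp
    qed
  qed
  have B2: "AE \<omega> in M. \<forall>k\<in>K. \<bar>Y m \<omega> k\<bar> \<le> real (Suc m) * B"
    using Ball
  proof eventually_elim
    fix \<omega> assume b: "\<forall>j\<in>{..<Suc m}. \<forall>k\<in>K. \<bar>Y j \<omega> k\<bar> \<le> B"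
    show "\<forall>k\<in>K. \<bar>Y m \<omega> k\<bar> \<le> real (Suc m) * B"
    proof
      fix k assume k: "k \<in> K"
      have "\<bar>Y m \<omega> k\<bar> \<le> (\<Sum>i<Suc m. \<bar>Y i \<omega> k\<bar>)" by (simp add: sum_nonneg)
      also have "\<dots> \<le> (\<Sum>i<Suc m. B)" using b k by (intro sum_mono) auto
      finally show "\<bar>Y m \<omega> k\<bar> \<le> real (Suc m) * B" by simp
    qed
  qed
  have "(\<integral>\<omega>. F (\<lambda>k. \<Sum>j<Suc m. Y j \<omega> k) \<partial>M) = (\<integral>\<omega>. F (\<lambda>k. (\<Sum>j<m. Y j \<omega> k) + Y m \<omega> k) \<partial>M)"
    by simp
  also have "\<dots> \<le> (\<integral>\<omega>. G (\<lambda>k. \<Sum>j<m. Y j \<omega> k) \<partial>M) + 2 * beta_dep M (sets N) (sets N')"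
    unfolding G_def
    by (rule beta_decouple_lipschitz[OF M N(1,2) fin L N(3,4) B1 B2 Suc.prems(4)])
  also have "(\<integral>\<omega>. G (\<lambda>k. \<Sum>j<m. Y j \<omega> k) \<partial>M) \<le> (c * a) * a ^ m * \<Phi> (\<lambda>_. 0) + 2 * real m * b"
  proof (rule Suc.IH)
    show "lipschitz_01 K L G"
      unfolding G_def by (rule lipschitz_01_average[OF M Suc.prems(4) YM])
    show "G x \<le> c * a * \<Phi> x" for x
    proof -
      obtain g where g: "integrable M g" "AE \<omega> in M. \<Phi> (\<lambda>k. x k + Y m \<omega> k) \<le> g \<omega>" "(\<integral>\<omega>. g \<omega> \<partial>M) \<le> a * \<Phi> x"
        using Suc.prems(3)[of m x] by auto
      have "G x \<le> (\<integral>\<omega>. c * g \<omega> \<partial>M)"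
        unfolding G_def
      proof (rule integral_mono_AE)
        show "integrable M (\<lambda>\<omega>. F (\<lambda>k. x k + Y m \<omega> k))"
          using Suc.prems(4) YM by (intro lipschitz_01_integrable) (auto, unfold_locales)
        show "AE \<omega> in M. F (\<lambda>k. x k + Y m \<omega> k) \<le> c * g \<omega>"
          using g(2)
        proof eventually_elim
          fix \<omega> assume "\<Phi> (\<lambda>k. x k + Y m \<omega> k) \<le> g \<omega>"
          then have "c * \<Phi> (\<lambda>k. x k + Y m \<omega> k) \<le> c * g \<omega>" using Suc.prems(6) by (rule mult_left_mono)
          then show "F (\<lambda>k. x k + Y m \<omega> k) \<le> c * g \<omega>" using Suc.prems(5) order_trans by blast
        qed
      qed (use g in simp)
      also have "\<dots> = c * (\<integral>\<omega>. g \<omega> \<partial>M)" by simp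
      also have "\<dots> \<le> c * (a * \<Phi> x)" using g(3) Suc.prems(6) by (rule mult_left_mono)
      finally show ?thesis by (simp add: mult_ac)
    qed
    show "0 \<le> c * a" using Suc.prems(6) a by simp
  qed (use Suc.prems in auto)
  finally show ?case using N(5) by (simp add: algebra_simps)
qed

section \<open>Sums of weakly dependent random matrices\<close>

lemma dil_add: "dil (\<lambda>p. A p + B p) p = dil A p + dil B p"
  by (cases p; cases "fst p"; cases "snd p") (auto simp: dil_def)

lemma L2_square_mv: "(L2_set (mv J A v) I)\<^sup>2 = (\<Sum>k\<in>I. (\<Sum>l\<in>J. A (k, l) * v l)\<^sup>2)"
  by (simp add: L2_set_def mv_def sum_nonneg)

text \<open>
  The expectation of the second order bound: the linear term vanishes because \<open>Y\<close> is centred, and in the quadratic term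
  the eigenvectors \<open>u\<^sub>i\<close> of the dilation split into two parts whose squared norms add up to \<open>1\<close>.
\<close>
lemma trace_exp_dil_average:
  fixes Y :: "'a \<Rightarrow> nat \<times> nat \<Rightarrow> real"
  assumes M: "prob_space M" and c: "c \<ge> 1" and \<theta>: "0 \<le> \<theta>" and \<theta>R: "\<theta> * R \<le> 1"
    and meas: "\<And>p. p \<in> {..<r} \<times> {..<c} \<Longrightarrow> (\<lambda>\<omega>. Y \<omega> p) \<in> borel_measurable M"
    and bnd: "AE \<omega> in M. nrm r c (Y \<omega>) \<le> R"
    and mean: "\<And>p. p \<in> {..<r} \<times> {..<c} \<Longrightarrow> (\<integral>\<omega>. Y \<omega> p \<partial>M) = 0"
    and var1: "\<And>v. (\<integral>\<omega>. (L2_set (mv {..<c} (Y \<omega>) v) {..<r})\<^sup>2 \<partial>M) \<le> V * (L2_set v {..<c})\<^sup>2"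
    and var2: "\<And>v. (\<integral>\<omega>. (L2_set (mv {..<r} (\<lambda>(l, k). Y \<omega> (k, l)) v) {..<c})\<^sup>2 \<partial>M) \<le> V * (L2_set v {..<r})\<^sup>2"
  shows "\<exists>g. integrable M g \<and> (AE \<omega> in M. trace_exp_dil r c \<theta> (\<lambda>p. x p + Y \<omega> p) \<le> g \<omega>) \<and>
     (\<integral>\<omega>. g \<omega> \<partial>M) \<le> (1 + 2 * \<theta>\<^sup>2 * V) * trace_exp_dil r c \<theta> x"
proof -
  interpret prob_space M by fact
  let ?I = "dil_index r c"
  obtain u e where ue: "eigensystem ?I (\<lambda>p. \<theta> * dil x p) u e"
    and T: "trace_exp_dil r c \<theta> x = (\<Sum>i\<in>?I. exp (e i))"
    using trace_exp_dil_eigensystem by blast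
  define lin where "lin i \<omega> = ip {..<r} (u i \<circ> Inl) (mv {..<c} (Y \<omega>) (u i \<circ> Inr))" for i \<omega>
  define q1 where "q1 i \<omega> = (L2_set (mv {..<c} (Y \<omega>) (u i \<circ> Inr)) {..<r})\<^sup>2" for i \<omega>
  define q2 where "q2 i \<omega> = (L2_set (mv {..<r} (\<lambda>(l, k). Y \<omega> (k, l)) (u i \<circ> Inl)) {..<c})\<^sup>2" for i \<omega>
  define g where "g \<omega> = (\<Sum>i\<in>?I. exp (e i)) + (\<Sum>i\<in>?I. exp (e i) * (2 * \<theta> * lin i \<omega>))
      + 2 * (\<Sum>i\<in>?I. exp (e i) * (\<theta>\<^sup>2 * (q1 i \<omega> + q2 i \<omega>)))" for \<omega>
  have int_entry: "integrable M (\<lambda>\<omega>. Y \<omega> (k, l))" if "k < r" "l < c" for k l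
  proof (rule integrable_const_bound[where B = R])
    show "AE \<omega> in M. norm (Y \<omega> (k, l)) \<le> R"
      using bnd by eventually_elim (use order_trans[OF entry_le_nrm[OF that]] in simp)
  qed (use meas that in auto)
  have lin_eq: "lin i = (\<lambda>\<omega>. \<Sum>p\<in>{..<r} \<times> {..<c}. u i (Inl (fst p)) * u i (Inr (snd p)) * Y \<omega> p)" for i
    by (rule ext) (simp add: lin_def ip_def mv_def sum_distrib_left sum.cartesian_product mult_ac case_prod_beta)
  have int_lin: "integrable M (lin i)" for i
    unfolding lin_eq using int_entry by (intro Bochner_Integration.integrable_sum integrable_mult_right) auto
  have lin0: "(\<integral>\<omega>. lin i \<omega> \<partial>M) = 0" for i
  proof -
    have "(\<integral>\<omega>. lin i \<omega> \<partial>M) = (\<Sum>p\<in>{..<r} \<times> {..<c}. \<integral>\<omega>. u i (Inl (fst p)) * u i (Inr (snd p)) * Y \<omega> p \<partial>M)"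
      unfolding lin_eq
      by (rule Bochner_Integration.integral_sum) (use int_entry in \<open>auto intro!: integrable_mult_right\<close>)
    also have "\<dots> = 0"
      using mean by (intro sum.neutral ballI) (simp only: integral_mult_right_zero mult_zero_right)
    finally show ?thesis .
  qed
  have int_q1: "integrable M (q1 i)" for i
  proof (rule integrable_const_bound[where B = "(R * L2_set (u i \<circ> Inr) {..<c})\<^sup>2"])
    show "AE \<omega> in M. norm (q1 i \<omega>) \<le> (R * L2_set (u i \<circ> Inr) {..<c})\<^sup>2"
      using bnd
    proof eventually_elim
      fix \<omega> assume R: "nrm r c (Y \<omega>) \<le> R"
      have "L2_set (mv {..<c} (Y \<omega>) (u i \<circ> Inr)) {..<r} \<le> R * L2_set (u i \<circ> Inr) {..<c}"
        using R by (intro order_trans[OF nrm_bound(1)[OF c]] mult_right_mono) (auto simp: L2_set_nonneg)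
      then show "norm (q1 i \<omega>) \<le> (R * L2_set (u i \<circ> Inr) {..<c})\<^sup>2"
        unfolding q1_def by (simp add: power_mono L2_set_nonneg)
    qed
    show "q1 i \<in> borel_measurable M"
      unfolding q1_def L2_square_mv using meas by (intro borel_measurable_sum borel_measurable_power borel_measurable_times) auto
  qed
  have int_q2: "integrable M (q2 i)" for i
  proof (rule integrable_const_bound[where B = "(R * L2_set (u i \<circ> Inl) {..<r})\<^sup>2"])
    show "AE \<omega> in M. norm (q2 i \<omega>) \<le> (R * L2_set (u i \<circ> Inl) {..<r})\<^sup>2"
      using bnd
    proof eventually_elim
      fix \<omega> assume R: "nrm r c (Y \<omega>) \<le> R"
      have "L2_set (mv {..<r} (\<lambda>(l, k). Y \<omega> (k, l)) (u i \<circ> Inl)) {..<c} \<le> R * L2_set (u i \<circ> Inl) {..<r}"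
        using R by (intro order_trans[OF nrm_bound_transpose[OF c]] mult_right_mono) (auto simp: L2_set_nonneg)
      then show "norm (q2 i \<omega>) \<le> (R * L2_set (u i \<circ> Inl) {..<r})\<^sup>2"
        unfolding q2_def by (simp add: power_mono L2_set_nonneg)
    qed
    show "q2 i \<in> borel_measurable M"
      unfolding q2_def L2_square_mv using meas by (intro borel_measurable_sum borel_measurable_power borel_measurable_times) auto
  qed
  have "integrable M g"
    unfolding g_def using int_lin int_q1 int_q2 by simp
  moreover have "AE \<omega> in M. trace_exp_dil r c \<theta> (\<lambda>p. x p + Y \<omega> p) \<le> g \<omega>"
    using bnd
  proof eventually_elim
    fix \<omega> assume R: "nrm r c (Y \<omega>) \<le> R"
    obtain v b where vb: "eigensystem ?I (\<lambda>p. \<theta> * dil (\<lambda>p. x p + Y \<omega> p) p) v b"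
      and T': "trace_exp_dil r c \<theta> (\<lambda>p. x p + Y \<omega> p) = (\<Sum>i\<in>?I. exp (b i))"
      using trace_exp_dil_eigensystem by blast
    have "\<theta> * nrm r c (Y \<omega>) \<le> 1"
      using mult_left_mono[OF R \<theta>] \<theta>R by linarith
    then have "(\<Sum>j\<in>?I. exp (b j)) \<le> (\<Sum>i\<in>?I. exp (e i))
         + (\<Sum>i\<in>?I. exp (e i) * ip ?I (u i) (mv ?I (\<lambda>p. \<theta> * dil (Y \<omega>) p) (u i)))
         + 2 * (\<Sum>i\<in>?I. exp (e i) * ip ?I (mv ?I (\<lambda>p. \<theta> * dil (Y \<omega>) p) (u i)) (mv ?I (\<lambda>p. \<theta> * dil (Y \<omega>) p) (u i)))"
      by (intro trace_exp_perturbation[OF _ ue vb symm_dil symm_dil] dil_contraction c \<theta>)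
         (auto simp: dil_add algebra_simps)
    then show "trace_exp_dil r c \<theta> (\<lambda>p. x p + Y \<omega> p) \<le> g \<omega>"
      unfolding T' g_def ip_mv_dil ip_mv_dil_self lin_def q1_def q2_def .
  qed
  moreover have "(\<integral>\<omega>. g \<omega> \<partial>M) \<le> (1 + 2 * \<theta>\<^sup>2 * V) * trace_exp_dil r c \<theta> x"
  proof -
    have "(\<integral>\<omega>. g \<omega> \<partial>M) = (\<Sum>i\<in>?I. exp (e i))
        + 2 * (\<Sum>i\<in>?I. exp (e i) * (\<theta>\<^sup>2 * ((\<integral>\<omega>. q1 i \<omega> \<partial>M) + (\<integral>\<omega>. q2 i \<omega> \<partial>M))))"
      unfolding g_def using int_lin int_q1 int_q2 lin0 by (simp add: prob_space)
    also have "\<dots> \<le> (\<Sum>i\<in>?I. exp (e i)) + 2 * (\<Sum>i\<in>?I. exp (e i) * (\<theta>\<^sup>2 * V))"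
    proof (intro add_left_mono mult_left_mono sum_mono)
      fix i assume i: "i \<in> ?I"
      have "(\<integral>\<omega>. q1 i \<omega> \<partial>M) + (\<integral>\<omega>. q2 i \<omega> \<partial>M)
          \<le> V * ((L2_set (u i \<circ> Inl) {..<r})\<^sup>2 + (L2_set (u i \<circ> Inr) {..<c})\<^sup>2)"
        using var1[of "u i \<circ> Inr"] var2[of "u i \<circ> Inl"] by (simp add: q1_def q2_def algebra_simps)
      also have "(L2_set (u i \<circ> Inl) {..<r})\<^sup>2 + (L2_set (u i \<circ> Inr) {..<c})\<^sup>2 = ip ?I (u i) (u i)"
        by (simp only: ip_dil_index) (simp only: ip_self_L2)
      also have "\<dots> = 1" using ue i by (simp add: eigensystem_def orthobasis_def)
      finally show "(\<integral>\<omega>. q1 i \<omega> \<partial>M) + (\<integral>\<omega>. q2 i \<omega> \<partial>M) \<le> V" by simp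
    qed auto
    also have "\<dots> = (1 + 2 * \<theta>\<^sup>2 * V) * (\<Sum>i\<in>?I. exp (e i))"
      by (simp add: algebra_simps flip: sum_distrib_left sum_distrib_right)
    finally show ?thesis by (simp add: T)
  qed
  ultimately show ?thesis by blast
qed

text \<open>
  The truncated function \<open>F A = max 0 (min 1 (\<parallel>A\<parallel> / t - 1))\<close> lies between the indicators of \<open>\<parallel>A\<parallel> > 2 t\<close> and
  \<open>\<parallel>A\<parallel> > t\<close>. The first makes its expectation dominate the tail probability, the second gives
  \<open>F A \<le> exp (- \<theta> t) tr exp (\<theta> dil A)\<close>.
\<close>
lemma spectral_tail_bound:
  fixes Y :: "nat \<Rightarrow> 'a \<Rightarrow> nat \<times> nat \<Rightarrow> real"
  assumes M: "prob_space M" and c: "c \<ge> 1" and t: "t > 0" and \<theta>: "0 \<le> \<theta>" and \<theta>R: "\<theta> * R \<le> 1" and V: "0 \<le> V"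
    and dep: "\<And>j. j < m \<Longrightarrow> \<exists>N N'. subalgebra M N \<and> subalgebra M N' \<and>
       (\<forall>p\<in>{..<r} \<times> {..<c}. (\<lambda>\<omega>. \<Sum>i<j. Y i \<omega> p) \<in> borel_measurable N) \<and>
       (\<forall>p\<in>{..<r} \<times> {..<c}. (\<lambda>\<omega>. Y j \<omega> p) \<in> borel_measurable N') \<and> beta_dep M (sets N) (sets N') \<le> b"
    and bnd: "\<And>j. j < m \<Longrightarrow> AE \<omega> in M. nrm r c (Y j \<omega>) \<le> R"
    and mean: "\<And>j p. j < m \<Longrightarrow> p \<in> {..<r} \<times> {..<c} \<Longrightarrow> (\<integral>\<omega>. Y j \<omega> p \<partial>M) = 0"
    and var1: "\<And>j v. j < m \<Longrightarrow> (\<integral>\<omega>. (L2_set (mv {..<c} (Y j \<omega>) v) {..<r})\<^sup>2 \<partial>M) \<le> V * (L2_set v {..<c})\<^sup>2"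
    and var2: "\<And>j v. j < m \<Longrightarrow> (\<integral>\<omega>. (L2_set (mv {..<r} (\<lambda>(l, k). Y j \<omega> (k, l)) v) {..<c})\<^sup>2 \<partial>M) \<le> V * (L2_set v {..<r})\<^sup>2"
  shows "measure M {\<omega> \<in> space M. nrm r c (\<lambda>p. \<Sum>j<m. Y j \<omega> p) > 2 * t}
     \<le> exp (- \<theta> * t) * (1 + 2 * \<theta>\<^sup>2 * V) ^ m * real (r + c) + 2 * real m * b"
proof -
  interpret prob_space M by fact
  let ?K = "{..<r} \<times> {..<c}"
  define F where "F A = max 0 (min 1 (nrm r c A / t - 1))" for A
  have F: "lipschitz_01 ?K (1 / t) F"
    unfolding lipschitz_01_def
  proof (intro conjI allI)
    fix A B :: "nat \<times> nat \<Rightarrow> real"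
    have "\<bar>F A - F B\<bar> \<le> \<bar>(nrm r c A / t - 1) - (nrm r c B / t - 1)\<bar>"
      unfolding F_def by linarith
    also have "\<dots> = \<bar>nrm r c A - nrm r c B\<bar> / t"
      using t by (simp add: diff_divide_distrib[symmetric])
    also have "\<dots> \<le> (\<Sum>p\<in>?K. \<bar>A p - B p\<bar>) / t"
      using t nrm_lipschitz[OF c] by (intro divide_right_mono) auto
    finally show "\<bar>F A - F B\<bar> \<le> 1 / t * (\<Sum>p\<in>?K. \<bar>A p - B p\<bar>)" by simp
  qed (auto simp: F_def)
  have YM: "(\<lambda>\<omega>. Y j \<omega> p) \<in> borel_measurable M" if "j < m" "p \<in> ?K" for j p
    using dep[OF that(1)] that(2) by (blast intro: measurable_from_subalg)
  have F_le: "F A \<le> exp (- \<theta> * t) * trace_exp_dil r c \<theta> A" for A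
  proof (cases "nrm r c A \<le> t")
    case True
    then have "nrm r c A / t \<le> 1" using t by (simp add: divide_le_eq)
    then have "F A = 0" by (simp add: F_def)
    moreover have "0 \<le> trace_exp_dil r c \<theta> A" by (simp add: trace_exp_dil_def sum_nonneg)
    ultimately show ?thesis by simp
  next
    case False
    have "F A \<le> 1" by (simp add: F_def)
    also have "1 \<le> exp (\<theta> * (nrm r c A - t))"
      using False \<theta> by simp
    also have "\<dots> = exp (- \<theta> * t) * exp (\<theta> * nrm r c A)"
      by (simp add: algebra_simps flip: exp_add)
    also have "\<dots> \<le> exp (- \<theta> * t) * trace_exp_dil r c \<theta> A"
      using exp_nrm_le_trace_exp_dil[OF c] by (intro mult_left_mono) auto
    finally show ?thesis .
  qed
  have sumM: "(\<lambda>\<omega>. \<Sum>j<m. Y j \<omega> p) \<in> borel_measurable M" if "p \<in> ?K" for p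
    using YM that by (intro borel_measurable_sum) auto
  have nrmM: "(\<lambda>\<omega>. nrm r c (\<lambda>p. \<Sum>j<m. Y j \<omega> p)) \<in> borel_measurable M"
    using lipschitz_measurable[of "nrm r c" 1 ?K "\<lambda>\<omega> p. \<Sum>j<m. Y j \<omega> p" M] nrm_lipschitz[OF c] sumM by simp
  define E where "E = {\<omega> \<in> space M. nrm r c (\<lambda>p. \<Sum>j<m. Y j \<omega> p) > 2 * t}"
  have E: "E \<in> sets M" unfolding E_def using nrmM by measurable
  have "measure M E = (\<integral>\<omega>. indicator E \<omega> \<partial>M)" using E by simp
  also have "\<dots> \<le> (\<integral>\<omega>. F (\<lambda>p. \<Sum>j<m. Y j \<omega> p) \<partial>M)"
  proof (rule integral_mono)
    show "integrable M (\<lambda>\<omega>. F (\<lambda>p. \<Sum>j<m. Y j \<omega> p))"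
      using sumM by (intro lipschitz_01_integrable[OF _ F]) (auto, unfold_locales)
    show "indicator E \<omega> \<le> F (\<lambda>p. \<Sum>j<m. Y j \<omega> p)" for \<omega>
      using t by (auto simp: E_def F_def indicator_def field_simps)
  qed (use E in \<open>auto simp: less_top[symmetric]\<close>)
  also have "\<dots> \<le> exp (- \<theta> * t) * (1 + 2 * \<theta>\<^sup>2 * V) ^ m * trace_exp_dil r c \<theta> (\<lambda>_. 0) + 2 * real m * b"
  proof (rule decoupled_iteration[OF M _ _ _ _ dep _ _ F F_le, where B = R])
    show "AE \<omega> in M. \<forall>k\<in>?K. \<bar>Y j \<omega> k\<bar> \<le> R" if "j < m" for j
      using bnd[OF that]
    proof eventually_elim
      fix \<omega> assume R: "nrm r c (Y j \<omega>) \<le> R"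
      show "\<forall>k\<in>?K. \<bar>Y j \<omega> k\<bar> \<le> R"
      proof
        fix p assume "p \<in> ?K"
        then show "\<bar>Y j \<omega> p\<bar> \<le> R"
          using R entry_le_nrm[of "fst p" r "snd p" c "Y j \<omega>"] by auto
      qed
    qed
    show "\<exists>g. integrable M g \<and> (AE \<omega> in M. trace_exp_dil r c \<theta> (\<lambda>k. x k + Y j \<omega> k) \<le> g \<omega>) \<and>
        expectation g \<le> (1 + 2 * \<theta>\<^sup>2 * V) * trace_exp_dil r c \<theta> x" if "j < m" for j x
      using that by (intro trace_exp_dil_average[OF M c \<theta> \<theta>R] YM bnd mean var1 var2)
  qed (use t V in auto)
  finally show ?thesis by (simp add: E_def trace_exp_dil_zero)
qed

text \<open>
  The second moment of a block is a sum of \<open>(card J)\<^sup>2\<close> cross moments \<open>\<langle>v, E[W\<^sub>i\<^sup>T W\<^sub>j] v\<rangle>\<close>.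
\<close>
lemma block_second_moment:
  fixes W :: "'i \<Rightarrow> 'a \<Rightarrow> nat \<times> nat \<Rightarrow> real"
  assumes M: "prob_space M" and c: "c \<ge> 1"
    and meas: "\<And>i p. i \<in> J \<Longrightarrow> p \<in> {..<r} \<times> {..<c} \<Longrightarrow> (\<lambda>\<omega>. W i \<omega> p) \<in> borel_measurable M"
    and bnd: "\<And>i p. i \<in> J \<Longrightarrow> p \<in> {..<r} \<times> {..<c} \<Longrightarrow> AE \<omega> in M. \<bar>W i \<omega> p\<bar> \<le> B"
    and S: "\<And>i j. i \<in> J \<Longrightarrow> j \<in> J \<Longrightarrow>
       nrm c c (\<lambda>(l, l'). \<integral>\<omega>. (\<Sum>k<r. W i \<omega> (k, l) * W j \<omega> (k, l')) \<partial>M) \<le> S"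
  shows "(\<integral>\<omega>. (L2_set (mv {..<c} (\<lambda>p. \<Sum>i\<in>J. W i \<omega> p) v) {..<r})\<^sup>2 \<partial>M)
     \<le> ((real (card J))\<^sup>2 * S) * (L2_set v {..<c})\<^sup>2"
proof -
  interpret prob_space M by fact
  define E where "E i j = (\<lambda>(l, l'). \<integral>\<omega>. (\<Sum>k<r. W i \<omega> (k, l) * W j \<omega> (k, l')) \<partial>M)" for i j
  define f where "f i j \<omega> = (\<Sum>l<c. \<Sum>l'<c. v l * ((\<Sum>k<r. W i \<omega> (k, l) * W j \<omega> (k, l')) * v l'))" for i j \<omega>
  have int: "integrable M (\<lambda>\<omega>. \<Sum>k<r. W i \<omega> (k, l) * W j \<omega> (k, l'))"
    if "i \<in> J" "j \<in> J" "l < c" "l' < c" for i j l l'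
  proof (rule Bochner_Integration.integrable_sum)
    fix k assume "k \<in> {..<r}"
    then have k: "(k, l) \<in> {..<r} \<times> {..<c}" "(k, l') \<in> {..<r} \<times> {..<c}" using that by auto
    show "integrable M (\<lambda>\<omega>. W i \<omega> (k, l) * W j \<omega> (k, l'))"
    proof (rule integrable_const_bound[where B = "B * B"])
      show "AE \<omega> in M. norm (W i \<omega> (k, l) * W j \<omega> (k, l')) \<le> B * B"
        using bnd[OF that(1) k(1)] bnd[OF that(2) k(2)]
        by eventually_elim (auto simp: abs_mult intro!: mult_mono)
    qed (use meas k that in auto)
  qed
  have int': "integrable M (\<lambda>\<omega>. v l * ((\<Sum>k<r. W i \<omega> (k, l) * W j \<omega> (k, l')) * v l'))"
    if "i \<in> J" "j \<in> J" "l < c" "l' < c" for i j l l'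
    by (rule integrable_mult_right, rule integrable_mult_left) (rule int[OF that])
  have intf: "integrable M (f i j)" if "i \<in> J" "j \<in> J" for i j
    unfolding f_def by (intro Bochner_Integration.integrable_sum int'[OF that]) auto
  have Ef: "(\<integral>\<omega>. f i j \<omega> \<partial>M) \<le> S * (L2_set v {..<c})\<^sup>2" if ij: "i \<in> J" "j \<in> J" for i j
  proof -
    have "(\<integral>\<omega>. f i j \<omega> \<partial>M) = (\<Sum>l<c. \<Sum>l'<c. \<integral>\<omega>. v l * ((\<Sum>k<r. W i \<omega> (k, l) * W j \<omega> (k, l')) * v l') \<partial>M)"
      unfolding f_def
    proof (subst Bochner_Integration.integral_sum)
      show "(\<Sum>l<c. \<integral>\<omega>. (\<Sum>l'<c. v l * ((\<Sum>k<r. W i \<omega> (k, l) * W j \<omega> (k, l')) * v l')) \<partial>M) =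
         (\<Sum>l<c. \<Sum>l'<c. \<integral>\<omega>. v l * ((\<Sum>k<r. W i \<omega> (k, l) * W j \<omega> (k, l')) * v l') \<partial>M)"
        by (intro sum.cong refl Bochner_Integration.integral_sum int'[OF ij]) auto
    qed (intro Bochner_Integration.integrable_sum int'[OF ij]; simp)
    also have "\<dots> = ip {..<c} v (mv {..<c} (E i j) v)"
      by (simp add: ip_def mv_def E_def sum_distrib_left)
    also have "\<dots> \<le> nrm c c (E i j) * (L2_set v {..<c} * L2_set v {..<c})"
      using bilinear_le_nrm[OF c, of c v "E i j" v] by linarith
    also have "\<dots> \<le> S * (L2_set v {..<c} * L2_set v {..<c})"
      using S[OF ij] by (intro mult_right_mono) (auto simp: E_def L2_set_nonneg)
    finally show ?thesis by (simp add: power2_eq_square)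
  qed
  have eq: "(L2_set (mv {..<c} (\<lambda>p. \<Sum>i\<in>J. W i \<omega> p) v) {..<r})\<^sup>2 = (\<Sum>i\<in>J. \<Sum>j\<in>J. f i j \<omega>)" for \<omega>
  proof -
    have mv: "mv {..<c} (\<lambda>p. \<Sum>i\<in>J. W i \<omega> p) v = (\<lambda>k. \<Sum>i\<in>J. mv {..<c} (W i \<omega>) v k)"
      by (simp add: mv_def sum_distrib_right sum.swap[of _ J])
    have f: "ip {..<r} (mv {..<c} (W i \<omega>) v) (mv {..<c} (W j \<omega>) v) = f i j \<omega>" for i j
    proof -
      have "ip {..<r} (mv {..<c} (W i \<omega>) v) (mv {..<c} (W j \<omega>) v)
         = (\<Sum>k<r. \<Sum>l<c. \<Sum>l'<c. (W i \<omega> (k, l) * v l) * (W j \<omega> (k, l') * v l'))"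
        by (simp add: ip_def mv_def sum_product)
      also have "\<dots> = (\<Sum>l<c. \<Sum>k<r. \<Sum>l'<c. (W i \<omega> (k, l) * v l) * (W j \<omega> (k, l') * v l'))"
        by (rule sum.swap)
      also have "\<dots> = (\<Sum>l<c. \<Sum>l'<c. \<Sum>k<r. (W i \<omega> (k, l) * v l) * (W j \<omega> (k, l') * v l'))"
        by (rule sum.cong[OF refl], rule sum.swap)
      also have "\<dots> = f i j \<omega>"
        unfolding f_def sum_distrib_left sum_distrib_right by (intro sum.cong refl) (simp add: mult_ac)
      finally show ?thesis .
    qed
    have "(L2_set (mv {..<c} (\<lambda>p. \<Sum>i\<in>J. W i \<omega> p) v) {..<r})\<^sup>2
       = ip {..<r} (\<lambda>k. \<Sum>i\<in>J. mv {..<c} (W i \<omega>) v k) (\<lambda>k. \<Sum>i\<in>J. mv {..<c} (W i \<omega>) v k)"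
      by (simp add: mv ip_self_L2)
    also have "\<dots> = (\<Sum>i\<in>J. \<Sum>j\<in>J. ip {..<r} (mv {..<c} (W j \<omega>) v) (mv {..<c} (W i \<omega>) v))"
      by (simp add: ip_sum_right ip_commute[of "{..<r}" "\<lambda>k. \<Sum>i\<in>J. mv {..<c} (W i \<omega>) v k"])
         (simp add: ip_commute)
    finally show ?thesis
      by (simp add: f) (rule sum.swap)
  qed
  have "(\<integral>\<omega>. (L2_set (mv {..<c} (\<lambda>p. \<Sum>i\<in>J. W i \<omega> p) v) {..<r})\<^sup>2 \<partial>M) = (\<Sum>i\<in>J. \<Sum>j\<in>J. \<integral>\<omega>. f i j \<omega> \<partial>M)"
    unfolding eq
  proof (subst Bochner_Integration.integral_sum)
    show "(\<Sum>i\<in>J. \<integral>\<omega>. (\<Sum>j\<in>J. f i j \<omega>) \<partial>M) = (\<Sum>i\<in>J. \<Sum>j\<in>J. \<integral>\<omega>. f i j \<omega> \<partial>M)"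
      using intf by (intro sum.cong refl Bochner_Integration.integral_sum) auto
  qed (use intf in \<open>intro Bochner_Integration.integrable_sum; auto\<close>)
  also have "\<dots> \<le> (\<Sum>i\<in>J. \<Sum>j\<in>J. S * (L2_set v {..<c})\<^sup>2)"
    using Ef by (intro sum_mono)
  finally show ?thesis by (simp add: power2_eq_square mult_ac)
qed

lemma nrm_zero: "c \<ge> 1 \<Longrightarrow> nrm r c (\<lambda>_. 0) = 0"
  using nrm_le_sum_abs[of c r "\<lambda>_. 0"] nrm_bound(3)[of c r "\<lambda>_. 0"] by simp

lemma nrm_sum_le:
  assumes "c \<ge> 1"
  shows "nrm r c (\<lambda>p. \<Sum>i\<in>J. W i p) \<le> (\<Sum>i\<in>J. nrm r c (W i))"
proof (induction J rule: infinite_finite_induct)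
  case (insert i J)
  then show ?case
    using nrm_triangle[OF assms, of r "W i" "\<lambda>p. \<Sum>i\<in>J. W i p"] by simp
qed (use assms in \<open>simp_all add: nrm_zero\<close>)

text \<open>
  \<open>sigma_generated\<close> as a measure space, as required for measurability of functions.
\<close>
definition generated_algebra :: "'a measure \<Rightarrow> 'x measure \<Rightarrow> ('i \<Rightarrow> 'a \<Rightarrow> 'x) \<Rightarrow> 'i set \<Rightarrow> 'a measure" where
  "generated_algebra M S X J = sigma (space M) (\<Union>j\<in>J. {X j -` B \<inter> space M |B. B \<in> sets S})"

lemma generated_algebra:
  assumes X: "\<And>i. X i \<in> measurable M S"
  shows "sets (generated_algebra M S X J) = sigma_generated M S X J"
    and "subalgebra M (generated_algebra M S X J)"
    and "j \<in> J \<Longrightarrow> X j \<in> measurable (generated_algebra M S X J) S"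
proof -
  have sub: "(\<Union>j\<in>J. {X j -` B \<inter> space M |B. B \<in> sets S}) \<subseteq> Pow (space M)" by auto
  show s: "sets (generated_algebra M S X J) = sigma_generated M S X J"
    using sub by (simp add: generated_algebra_def sigma_generated_def)
  have sp: "space (generated_algebra M S X J) = space M"
    using sub by (simp add: generated_algebra_def space_measure_of)
  show "subalgebra M (generated_algebra M S X J)"
    using sigma_generated_subset[of J X M S] X by (simp add: subalgebra_def s sp)
  show "X j \<in> measurable (generated_algebra M S X J) S" if "j \<in> J"
  proof (rule measurableI)
    show "X j \<omega> \<in> space S" if "\<omega> \<in> space (generated_algebra M S X J)" for \<omega>
      using that measurable_space[OF X] by (simp add: sp)
    show "X j -` B \<inter> space (generated_algebra M S X J) \<in> sets (generated_algebra M S X J)" if "B \<in> sets S" for B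
      unfolding s sp sigma_generated_def using that \<open>j \<in> J\<close> by (intro sigma_sets.Basic) auto
  qed
qed

text \<open>
  The last nonempty block may be shorter than \<open>q\<close>, and all later ones are empty.
\<close>
definition block :: "nat \<Rightarrow> nat \<Rightarrow> nat \<Rightarrow> int set" where
  "block n q h = {i \<in> {1..int n}. int (h * q) < i \<and> i \<le> int (Suc h * q)}"

lemma finite_block: "finite (block n q h)"
  by (simp add: block_def)

lemma card_block: "card (block n q h) \<le> q"
proof -
  have "block n q h \<subseteq> {int (h * q)<..int (Suc h * q)}" by (auto simp: block_def)
  then have "card (block n q h) \<le> card {int (h * q)<..int (Suc h * q)}" by (intro card_mono) auto
  then show ?thesis by simp
qed

lemma sum_blocks:
  "(\<Sum>h<H. \<Sum>i\<in>block n q h. f i) = (\<Sum>i\<in>{i \<in> {1..int n}. i \<le> int (H * q)}. f i :: real)"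
proof (induction H)
  case (Suc H)
  have "{i \<in> {1..int n}. i \<le> int (Suc H * q)} = {i \<in> {1..int n}. i \<le> int (H * q)} \<union> block n q H"
    by (auto simp: block_def)
  moreover have "{i \<in> {1..int n}. i \<le> int (H * q)} \<inter> block n q H = {}" by (auto simp: block_def)
  moreover have "finite {i \<in> {1..int n}. i \<le> int (H * q)}"
    by (rule finite_subset[of _ "{1..int n}"]) auto
  ultimately have "(\<Sum>i\<in>{i \<in> {1..int n}. i \<le> int (Suc H * q)}. f i) =
      (\<Sum>i\<in>{i \<in> {1..int n}. i \<le> int (H * q)}. f i) + (\<Sum>i\<in>block n q H. f i)"
    using finite_block[of n q H] by (simp only:) (rule sum.union_disjoint)
  then show ?case
    using Suc by simp
qed (auto intro!: sum.neutral)

lemma sum_even_odd: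
  fixes g :: "nat \<Rightarrow> real"
  shows "(\<Sum>h<2 * m. g h) = (\<Sum>j<m. g (2 * j)) + (\<Sum>j<m. g (2 * j + 1))"
  by (induction m) (auto simp: algebra_simps)

lemma sum_even_odd_blocks:
  assumes "n \<le> 2 * m * q"
  shows "(\<Sum>i\<in>{1..int n}. f i :: real)
     = (\<Sum>j<m. \<Sum>i\<in>block n q (2 * j). f i) + (\<Sum>j<m. \<Sum>i\<in>block n q (2 * j + 1). f i)"
proof -
  have "int n \<le> int (2 * m * q)" using assms by (simp only: of_nat_le_iff)
  then have "{i \<in> {1..int n}. i \<le> int (2 * m * q)} = {1..int n}" by auto
  then show ?thesis
    using sum_blocks[where n = n and q = q and f = f and H = "2 * m"] sum_even_odd[of "\<lambda>h. \<Sum>i\<in>block n q h. f i" m] by simp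
qed

text \<open>
  Even and odd blocks are treated alike; \<open>a\<close> is the parity below. If the whole sum
  exceeds \<open>4 t\<close>, one of the two parity sums exceeds \<open>2 t\<close>.
\<close>
lemma mixing_matrix_tail_bound:
  fixes X :: "int \<Rightarrow> 'a \<Rightarrow> 'x" and w :: "'x \<Rightarrow> nat \<times> nat \<Rightarrow> real"
  assumes M: "prob_space M" and X: "\<And>i. X i \<in> measurable M S"
    and r: "r \<ge> 1" and c: "c \<ge> 1" and t: "t > 0" and \<theta>: "0 \<le> \<theta>" and \<theta>R: "\<theta> * (real q * R) \<le> 1"
    and m: "n \<le> 2 * m * q"
    and w: "\<And>p. p \<in> {..<r} \<times> {..<c} \<Longrightarrow> (\<lambda>x. w x p) \<in> borel_measurable S"
    and bnd: "\<And>i. AE \<omega> in M. nrm r c (w (X i \<omega>)) \<le> R"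
    and mean: "\<And>i p. p \<in> {..<r} \<times> {..<c} \<Longrightarrow> (\<integral>\<omega>. w (X i \<omega>) p \<partial>M) = 0"
    and V1: "\<And>i j. i \<in> {1..int n} \<Longrightarrow> j \<in> {1..int n} \<Longrightarrow>
       nrm c c (\<lambda>(l, l'). \<integral>\<omega>. (\<Sum>k<r. w (X i \<omega>) (k, l) * w (X j \<omega>) (k, l')) \<partial>M) \<le> V"
    and V2: "\<And>i j. i \<in> {1..int n} \<Longrightarrow> j \<in> {1..int n} \<Longrightarrow>
       nrm r r (\<lambda>(k, k'). \<integral>\<omega>. (\<Sum>l<c. w (X i \<omega>) (k, l) * w (X j \<omega>) (k', l)) \<partial>M) \<le> V"
    and V: "0 \<le> V"
  shows "measure M {\<omega> \<in> space M. nrm r c (\<lambda>p. \<Sum>i\<in>{1..int n}. w (X i \<omega>) p) > 4 * t}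
     \<le> 2 * (exp (- \<theta> * t) * (1 + 2 * \<theta>\<^sup>2 * ((real q)\<^sup>2 * V)) ^ m * real (r + c) + 2 * real m * beta_coeff M S X q)"
proof -
  interpret prob_space M by fact
  let ?K = "{..<r} \<times> {..<c}"
  define Y where "Y a j \<omega> p = (\<Sum>i\<in>block n q (2 * j + a). w (X i \<omega>) p)" for a j \<omega> p
  have wX: "(\<lambda>\<omega>. w (X i \<omega>) p) \<in> borel_measurable M" if "p \<in> ?K" for i p
    using measurable_compose[OF X w[OF that]] .
  have R0: "0 \<le> R"
  proof -
    have "AE \<omega> in M. 0 \<le> R"
      using bnd[of 0] by eventually_elim (use nrm_bound(3)[OF c] in \<open>blast intro: order_trans\<close>)
    then show ?thesis by simp
  qed
  have bndall: "AE \<omega> in M. \<forall>i\<in>block n q h. nrm r c (w (X i \<omega>)) \<le> R" for h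
    by (rule AE_finite_allI) (use finite_block bnd in auto)
  have bentry: "AE \<omega> in M. \<bar>w (X i \<omega>) p\<bar> \<le> R" if "p \<in> ?K" for i p
    using bnd[of i]
  proof eventually_elim
    fix \<omega> assume "nrm r c (w (X i \<omega>)) \<le> R"
    then show "\<bar>w (X i \<omega>) p\<bar> \<le> R"
      using entry_le_nrm[of "fst p" r "snd p" c "w (X i \<omega>)"] that by auto
  qed
  have inte: "integrable M (\<lambda>\<omega>. w (X i \<omega>) p)" if "p \<in> ?K" for i p
    using bentry[OF that] wX[OF that] by (intro integrable_const_bound[where B = R]) auto
  have tail: "measure M {\<omega> \<in> space M. nrm r c (\<lambda>p. \<Sum>j<m. Y a j \<omega> p) > 2 * t}
     \<le> exp (- \<theta> * t) * (1 + 2 * \<theta>\<^sup>2 * ((real q)\<^sup>2 * V)) ^ m * real (r + c) + 2 * real m * beta_coeff M S X q" for a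
  proof (rule spectral_tail_bound[OF M c t \<theta> \<theta>R])
    show "0 \<le> (real q)\<^sup>2 * V" using V by simp
  next
    fix j assume "j < m"
    \<comment> \<open>The end of the block before block \<open>2 j + a\<close>: all earlier blocks of the same parity lie before the skipped
      block, hence a gap of \<open>q\<close> indices remains.\<close>
    define i0 where "i0 = (2 * int j + int a - 1) * int q"
    let ?N = "generated_algebra M S X {..i0}"
    let ?N' = "generated_algebra M S X {i0 + int q..}"
    have past: "block n q (2 * i + a) \<subseteq> {..i0}" if "i < j" for i
    proof -
      have "int (Suc (2 * i + a) * q) \<le> i0"
      proof -
        have "int (Suc (2 * i + a)) \<le> 2 * int j + int a - 1" using that by simp
        then have "int (Suc (2 * i + a)) * int q \<le> i0"
          unfolding i0_def by (rule mult_right_mono) simp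
        then show ?thesis by (simp only: of_nat_mult)
      qed
      then show ?thesis by (auto simp: block_def)
    qed
    have future: "block n q (2 * j + a) \<subseteq> {i0 + int q..}"
      by (auto simp: block_def i0_def algebra_simps)
    have pm: "(\<lambda>\<omega>. \<Sum>i<j. Y a i \<omega> p) \<in> borel_measurable ?N" if "p \<in> ?K" for p
      unfolding Y_def
    proof (intro borel_measurable_sum)
      fix i l assume "i \<in> {..<j}" "l \<in> block n q (2 * i + a)"
      then have "l \<in> {..i0}" using past by blast
      then show "(\<lambda>\<omega>. w (X l \<omega>) p) \<in> borel_measurable ?N"
        by (rule measurable_compose[OF generated_algebra(3)[where X = X, OF X] w[OF that]])
    qed
    have fm: "(\<lambda>\<omega>. Y a j \<omega> p) \<in> borel_measurable ?N'" if "p \<in> ?K" for p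
      unfolding Y_def
    proof (intro borel_measurable_sum)
      fix l assume "l \<in> block n q (2 * j + a)"
      then have "l \<in> {i0 + int q..}" using future by blast
      then show "(\<lambda>\<omega>. w (X l \<omega>) p) \<in> borel_measurable ?N'"
        by (rule measurable_compose[OF generated_algebra(3)[where X = X, OF X] w[OF that]])
    qed
    have bd: "beta_dep M (sets ?N) (sets ?N') \<le> beta_coeff M S X q"
      unfolding generated_algebra(1)[OF X] by (rule beta_dep_le_beta_coeff[OF M X])
    show "\<exists>N N'. subalgebra M N \<and> subalgebra M N' \<and>
       (\<forall>p\<in>?K. (\<lambda>\<omega>. \<Sum>i<j. Y a i \<omega> p) \<in> borel_measurable N) \<and>
       (\<forall>p\<in>?K. (\<lambda>\<omega>. Y a j \<omega> p) \<in> borel_measurable N') \<and> beta_dep M (sets N) (sets N') \<le> beta_coeff M S X q"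
      by (intro exI[of _ ?N] exI[of _ ?N'] conjI ballI generated_algebra(2)[OF X] pm fm bd)
  next
    fix j
    show "AE \<omega> in M. nrm r c (Y a j \<omega>) \<le> real q * R"
      using bndall[of "2 * j + a"]
    proof eventually_elim
      fix \<omega> assume b: "\<forall>i\<in>block n q (2 * j + a). nrm r c (w (X i \<omega>)) \<le> R"
      have "nrm r c (Y a j \<omega>) \<le> (\<Sum>i\<in>block n q (2 * j + a). nrm r c (w (X i \<omega>)))"
        unfolding Y_def by (rule nrm_sum_le[OF c])
      also have "\<dots> \<le> (\<Sum>i\<in>block n q (2 * j + a). R)" using b by (intro sum_mono) auto
      also have "\<dots> \<le> real q * R"
        using R0 card_block[of n q "2 * j + a"] by (simp add: mult_right_mono)
      finally show "nrm r c (Y a j \<omega>) \<le> real q * R" .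
    qed
  next
    fix j p assume "p \<in> ?K"
    then show "(\<integral>\<omega>. Y a j \<omega> p \<partial>M) = 0"
      unfolding Y_def using inte mean by (subst Bochner_Integration.integral_sum) auto
  next
    fix j v
    have cardq: "(real (card (block n q (2 * j + a))))\<^sup>2 * V * x\<^sup>2 \<le> (real q)\<^sup>2 * V * x\<^sup>2" for x
      using card_block[of n q "2 * j + a"] V by (intro mult_right_mono power_mono) auto
    have "(\<integral>\<omega>. (L2_set (mv {..<c} (\<lambda>p. \<Sum>i\<in>block n q (2 * j + a). w (X i \<omega>) p) v) {..<r})\<^sup>2 \<partial>M)
       \<le> ((real (card (block n q (2 * j + a))))\<^sup>2 * V) * (L2_set v {..<c})\<^sup>2"
      using V1 by (intro block_second_moment[OF M c, where W = "\<lambda>i \<omega> p. w (X i \<omega>) p" and B = R] wX bentry) (auto simp: block_def)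
    then show "(\<integral>\<omega>. (L2_set (mv {..<c} (Y a j \<omega>) v) {..<r})\<^sup>2 \<partial>M) \<le> (real q)\<^sup>2 * V * (L2_set v {..<c})\<^sup>2"
      unfolding Y_def using cardq by (rule order_trans)
    have tr: "(\<lambda>(l, k). Y a j \<omega> (k, l)) = (\<lambda>p. \<Sum>i\<in>block n q (2 * j + a). w (X i \<omega>) (snd p, fst p))" for \<omega>
      by (auto simp: Y_def)
    have "(\<integral>\<omega>. (L2_set (mv {..<r} (\<lambda>p. \<Sum>i\<in>block n q (2 * j + a). w (X i \<omega>) (snd p, fst p)) v) {..<c})\<^sup>2 \<partial>M)
       \<le> ((real (card (block n q (2 * j + a))))\<^sup>2 * V) * (L2_set v {..<r})\<^sup>2"
      using V2 by (intro block_second_moment[OF M r, where W = "\<lambda>i \<omega> p. w (X i \<omega>) (snd p, fst p)" and B = R] wX bentry) (auto simp: block_def)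
    then show "(\<integral>\<omega>. (L2_set (mv {..<r} (\<lambda>(l, k). Y a j \<omega> (k, l)) v) {..<c})\<^sup>2 \<partial>M) \<le> (real q)\<^sup>2 * V * (L2_set v {..<r})\<^sup>2"
      unfolding tr using cardq by (rule order_trans)
  qed
  define E where "E a = {\<omega> \<in> space M. nrm r c (\<lambda>p. \<Sum>j<m. Y a j \<omega> p) > 2 * t}" for a
  have E: "E a \<in> sets M" for a
  proof -
    have "(\<lambda>\<omega>. nrm r c (\<lambda>p. \<Sum>j<m. Y a j \<omega> p)) \<in> borel_measurable M"
      using lipschitz_measurable[of "nrm r c" 1 ?K "\<lambda>\<omega> p. \<Sum>j<m. Y a j \<omega> p" M] nrm_lipschitz[OF c] wX
      by (simp add: Y_def)
    then show ?thesis unfolding E_def by measurable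
  qed
  have "{\<omega> \<in> space M. nrm r c (\<lambda>p. \<Sum>i\<in>{1..int n}. w (X i \<omega>) p) > 4 * t} \<subseteq> E 0 \<union> E 1"
  proof
    fix \<omega> assume \<omega>: "\<omega> \<in> {\<omega> \<in> space M. nrm r c (\<lambda>p. \<Sum>i\<in>{1..int n}. w (X i \<omega>) p) > 4 * t}"
    have "(\<lambda>p. \<Sum>i\<in>{1..int n}. w (X i \<omega>) p) = (\<lambda>p. (\<Sum>j<m. Y 0 j \<omega> p) + (\<Sum>j<m. Y 1 j \<omega> p))"
      by (simp add: sum_even_odd_blocks[OF m] Y_def)
    then show "\<omega> \<in> E 0 \<union> E 1"
      using \<omega> nrm_triangle[OF c, of r "\<lambda>p. \<Sum>j<m. Y 0 j \<omega> p" "\<lambda>p. \<Sum>j<m. Y 1 j \<omega> p"] by (auto simp: E_def)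
  qed
  then have "measure M {\<omega> \<in> space M. nrm r c (\<lambda>p. \<Sum>i\<in>{1..int n}. w (X i \<omega>) p) > 4 * t} \<le> measure M (E 0 \<union> E 1)"
    using E by (intro finite_measure_mono) auto
  also have "\<dots> \<le> measure M (E 0) + measure M (E 1)" using E by (intro measure_Un_le)
  finally show ?thesis using tail[of 0] tail[of 1] by (simp add: E_def)
qed

text \<open>
  With \<open>L = ln (r + c)\<close> the choice \<open>\<theta> = sqrt L / (s sqrt (n q))\<close> and \<open>t = C s sqrt (n q L)\<close> gives the exponent
  \<open>- \<theta> t = - C L\<close>. The dimension \<open>r + c\<close> contributes \<open>L\<close>, and the at most \<open>n / q\<close> factors
  \<open>1 + 2 \<theta>\<^sup>2 q\<^sup>2 s\<^sup>2 = 1 + 2 L q / n\<close> contribute \<open>2 L\<close>. The condition \<open>\<theta> q R \<le> 1\<close> is the assumption on \<open>R\<close>.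
\<close>
lemma mixing_matrix_tail_bound_log_scale:
  fixes X :: "int \<Rightarrow> 'a \<Rightarrow> 'x" and w :: "'x \<Rightarrow> nat \<times> nat \<Rightarrow> real"
  assumes M: "prob_space M" and X: "\<And>i. X i \<in> measurable M S"
    and r: "r \<ge> 1" and c: "c \<ge> 1" and q: "1 \<le> q" "real q \<le> real n / 2" and s: "s > 0" and C: "C > 0"
    and Rs: "R * sqrt (real q * ln (real (r + c))) \<le> s * sqrt (real n)"
    and w: "\<And>p. p \<in> {..<r} \<times> {..<c} \<Longrightarrow> (\<lambda>x. w x p) \<in> borel_measurable S"
    and bnd: "\<And>i. AE \<omega> in M. nrm r c (w (X i \<omega>)) \<le> R"
    and mean: "\<And>i p. p \<in> {..<r} \<times> {..<c} \<Longrightarrow> (\<integral>\<omega>. w (X i \<omega>) p \<partial>M) = 0"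
    and V1: "\<And>i j. i \<in> {1..int n} \<Longrightarrow> j \<in> {1..int n} \<Longrightarrow>
       nrm c c (\<lambda>(l, l'). \<integral>\<omega>. (\<Sum>k<r. w (X i \<omega>) (k, l) * w (X j \<omega>) (k, l')) \<partial>M) \<le> s\<^sup>2"
    and V2: "\<And>i j. i \<in> {1..int n} \<Longrightarrow> j \<in> {1..int n} \<Longrightarrow>
       nrm r r (\<lambda>(k, k'). \<integral>\<omega>. (\<Sum>l<c. w (X i \<omega>) (k, l) * w (X j \<omega>) (k', l)) \<partial>M) \<le> s\<^sup>2"
  shows "measure M {\<omega> \<in> space M. nrm r c (\<lambda>p. \<Sum>i\<in>{1..int n}. w (X i \<omega>) p)
            > 4 * C * (s * sqrt (real n * real q * ln (real (r + c))))}
     \<le> 2 * exp ((3 - C) * ln (real (r + c))) + 4 * \<bar>real n / real q * beta_coeff M S X q\<bar>"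
proof -
  define L where "L = ln (real (r + c))"
  have L: "L > 0" using r c by (simp add: L_def)
  have n: "real n > 0" using q by simp
  define m where "m = n div (2 * q) + 1"
  have nm: "n \<le> 2 * m * q"
  proof -
    have "n < 2 * q * (n div (2 * q)) + 2 * q"
      using dividend_less_times_div[of "2 * q" n] q(1) by simp
    then show ?thesis by (simp add: m_def algebra_simps)
  qed
  have mnq: "real m \<le> real n / real q"
  proof -
    have "real (n div (2 * q)) * real (2 * q) \<le> real n"
      unfolding of_nat_mult[symmetric] of_nat_le_iff by (rule div_times_less_eq_dividend)
    then have "real (n div (2 * q)) \<le> real n / real (2 * q)"
      using q(1) by (simp add: pos_le_divide_eq)
    moreover have "1 \<le> real n / real (2 * q)" using q by (simp add: field_simps)
    ultimately have "real m \<le> real n / real (2 * q) + real n / real (2 * q)" by (simp add: m_def)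
    then show ?thesis by simp
  qed
  define \<theta> where "\<theta> = sqrt L / (s * sqrt (real n * real q))"
  define t where "t = C * (s * sqrt (real n * real q * L))"
  have nq: "sqrt (real n * real q) > 0" using n q by simp
  have \<theta>: "\<theta> \<ge> 0" using L s by (simp add: \<theta>_def)
  have t: "t > 0" using C s n q L by (simp add: t_def)
  have \<theta>t: "\<theta> * t = C * L"
  proof -
    have "\<theta> * t = C * (sqrt L * sqrt L) * (s * sqrt (real n * real q)) / (s * sqrt (real n * real q))"
      by (simp add: \<theta>_def t_def real_sqrt_mult)
    also have "\<dots> = C * L" using s n q L by simp
    finally show ?thesis .
  qed
  have "\<theta> * (real q * R) \<le> 1"
  proof -
    have "sqrt (real q) * (R * sqrt (real q * L)) \<le> sqrt (real q) * (s * sqrt (real n))"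
      using Rs by (intro mult_left_mono) (auto simp: L_def)
    moreover have "sqrt (real q) * (R * sqrt (real q * L)) = real q * R * sqrt L"
      by (simp add: real_sqrt_mult)
    moreover have "sqrt (real q) * (s * sqrt (real n)) = s * sqrt (real n * real q)"
      by (simp add: real_sqrt_mult)
    ultimately have "real q * R * sqrt L \<le> s * sqrt (real n * real q)" by simp
    then show ?thesis using s nq by (simp add: \<theta>_def divide_le_eq mult_ac)
  qed
  from mixing_matrix_tail_bound[OF M X r c t \<theta> this nm w bnd mean V1 V2]
  have "measure M {\<omega> \<in> space M. nrm r c (\<lambda>p. \<Sum>i\<in>{1..int n}. w (X i \<omega>) p) > 4 * t}
     \<le> 2 * (exp (- \<theta> * t) * (1 + 2 * \<theta>\<^sup>2 * ((real q)\<^sup>2 * s\<^sup>2)) ^ m * real (r + c) + 2 * real m * beta_coeff M S X q)"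
    by simp
  also have "\<dots> \<le> 2 * (exp ((3 - C) * L) + 2 * \<bar>real n / real q * beta_coeff M S X q\<bar>)"
  proof (intro mult_left_mono add_mono)
    define x where "x = 2 * \<theta>\<^sup>2 * ((real q)\<^sup>2 * s\<^sup>2)"
    have x: "x = 2 * L * (real q / real n)"
      using s n q L by (simp add: x_def \<theta>_def power_divide power_mult_distrib field_simps power2_eq_square)
    have x0: "x \<ge> 0" by (simp add: x_def)
    have "(1 + x) ^ m \<le> exp x ^ m" using x0 by (intro power_mono exp_ge_add_one_self) auto
    also have "\<dots> = exp (real m * x)" by (simp add: exp_of_nat_mult)
    also have "\<dots> \<le> exp (2 * L)"
    proof -
      have "real m * x \<le> real n / real q * x" using mnq x0 by (intro mult_right_mono)
      also have "\<dots> = 2 * L" using n q by (simp add: x)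
      finally show ?thesis by simp
    qed
    finally have "exp (- \<theta> * t) * (1 + x) ^ m * real (r + c) \<le> exp (- \<theta> * t) * exp (2 * L) * exp L"
      using r c by (intro mult_mono mult_left_mono) (auto simp: L_def x0)
    also have "\<dots> = exp ((3 - C) * L)"
      by (simp add: \<theta>t algebra_simps flip: exp_add)
    finally show "exp (- \<theta> * t) * (1 + 2 * \<theta>\<^sup>2 * ((real q)\<^sup>2 * s\<^sup>2)) ^ m * real (r + c) \<le> exp ((3 - C) * L)"
      by (simp add: x_def)
    have "real m * beta_coeff M S X q \<le> real m * \<bar>beta_coeff M S X q\<bar>" by (intro mult_left_mono) auto
    also have "\<dots> \<le> real n / real q * \<bar>beta_coeff M S X q\<bar>" using mnq by (intro mult_right_mono) auto
    also have "\<dots> = \<bar>real n / real q * beta_coeff M S X q\<bar>" by (simp add: abs_mult)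
    finally show "2 * real m * beta_coeff M S X q \<le> 2 * \<bar>real n / real q * beta_coeff M S X q\<bar>" by simp
  qed auto
  finally show ?thesis by (simp add: t_def L_def mult_ac)
qed

section \<open>Expectations of matrices and the final bound\<close>

lemma mat_expectation_product:
  assumes "\<And>\<omega>. \<omega> \<in> space M \<Longrightarrow> A \<omega> \<in> carrier_mat r c \<and> B \<omega> \<in> carrier_mat r c"
  shows "spectral_norm (mat_expectation M c c (\<lambda>\<omega>. transpose_mat (A \<omega>) * B \<omega>))
       = nrm c c (\<lambda>(l, l'). \<integral>\<omega>. (\<Sum>k<r. A \<omega> $$ (k, l) * B \<omega> $$ (k, l')) \<partial>M)"
    and "spectral_norm (mat_expectation M r r (\<lambda>\<omega>. A \<omega> * transpose_mat (B \<omega>)))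
       = nrm r r (\<lambda>(k, k'). \<integral>\<omega>. (\<Sum>l<c. A \<omega> $$ (k, l) * B \<omega> $$ (k', l)) \<partial>M)"
proof -
  have "(\<integral>\<omega>. (transpose_mat (A \<omega>) * B \<omega>) $$ (l, l') \<partial>M) = (\<integral>\<omega>. (\<Sum>k<r. A \<omega> $$ (k, l) * B \<omega> $$ (k, l')) \<partial>M)"
    if "l < c" "l' < c" for l l'
  proof (rule Bochner_Integration.integral_cong[OF refl])
    fix \<omega> assume "\<omega> \<in> space M"
    with assms have "A \<omega> \<in> carrier_mat r c" "B \<omega> \<in> carrier_mat r c" by auto
    then show "(transpose_mat (A \<omega>) * B \<omega>) $$ (l, l') = (\<Sum>k<r. A \<omega> $$ (k, l) * B \<omega> $$ (k, l'))"
      using that by (auto simp: scalar_prod_def atLeast0LessThan)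
  qed
  then show "spectral_norm (mat_expectation M c c (\<lambda>\<omega>. transpose_mat (A \<omega>) * B \<omega>))
       = nrm c c (\<lambda>(l, l'). \<integral>\<omega>. (\<Sum>k<r. A \<omega> $$ (k, l) * B \<omega> $$ (k, l')) \<partial>M)"
    unfolding mat_expectation_def nrm_def[symmetric] by (intro nrm_cong) simp
  have "(\<integral>\<omega>. (A \<omega> * transpose_mat (B \<omega>)) $$ (k, k') \<partial>M) = (\<integral>\<omega>. (\<Sum>l<c. A \<omega> $$ (k, l) * B \<omega> $$ (k', l)) \<partial>M)"
    if "k < r" "k' < r" for k k'
  proof (rule Bochner_Integration.integral_cong[OF refl])
    fix \<omega> assume "\<omega> \<in> space M"
    with assms have "A \<omega> \<in> carrier_mat r c" "B \<omega> \<in> carrier_mat r c" by auto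
    then show "(A \<omega> * transpose_mat (B \<omega>)) $$ (k, k') = (\<Sum>l<c. A \<omega> $$ (k, l) * B \<omega> $$ (k', l))"
      using that by (auto simp: scalar_prod_def atLeast0LessThan)
  qed
  then show "spectral_norm (mat_expectation M r r (\<lambda>\<omega>. A \<omega> * transpose_mat (B \<omega>)))
       = nrm r r (\<lambda>(k, k'). \<integral>\<omega>. (\<Sum>l<c. A \<omega> $$ (k, l) * B \<omega> $$ (k', l)) \<partial>M)"
    unfolding mat_expectation_def nrm_def[symmetric] by (intro nrm_cong) simp
qed

lemma s_coeff_bounds:
  assumes "n \<ge> 1" "r \<ge> 1" "c \<ge> 1"
  shows "0 \<le> s_coeff M r c A n"
    and "i \<in> {1..int n} \<Longrightarrow> j \<in> {1..int n} \<Longrightarrow>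
      spectral_norm (mat_expectation M r r (\<lambda>\<omega>. A i \<omega> * transpose_mat (A j \<omega>))) \<le> (s_coeff M r c A n)\<^sup>2"
    and "i \<in> {1..int n} \<Longrightarrow> j \<in> {1..int n} \<Longrightarrow>
      spectral_norm (mat_expectation M c c (\<lambda>\<omega>. transpose_mat (A i \<omega>) * A j \<omega>)) \<le> (s_coeff M r c A n)\<^sup>2"
proof -
  define f where "f = (\<lambda>(i, j). max (spectral_norm (mat_expectation M r r (\<lambda>\<omega>. A i \<omega> * transpose_mat (A j \<omega>))))
         (spectral_norm (mat_expectation M c c (\<lambda>\<omega>. transpose_mat (A i \<omega>) * A j \<omega>))))"
  have s: "s_coeff M r c A n = sqrt (Max (f ` ({1..int n} \<times> {1..int n})))"
    by (simp add: s_coeff_def f_def)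
  have le: "f (i, j) \<le> Max (f ` ({1..int n} \<times> {1..int n}))" if "i \<in> {1..int n}" "j \<in> {1..int n}" for i j
    using that by (intro Max_ge) auto
  have "0 \<le> f (1, 1)"
    using nrm_bound(3)[OF assms(2), of r] unfolding f_def mat_expectation_def nrm_def by (simp add: le_max_iff_disj)
  also have "\<dots> \<le> Max (f ` ({1..int n} \<times> {1..int n}))" using assms(1) by (intro le) auto
  finally have nonneg: "0 \<le> Max (f ` ({1..int n} \<times> {1..int n}))" .
  then show "0 \<le> s_coeff M r c A n" by (simp add: s)
  show "spectral_norm (mat_expectation M r r (\<lambda>\<omega>. A i \<omega> * transpose_mat (A j \<omega>))) \<le> (s_coeff M r c A n)\<^sup>2"
    and "spectral_norm (mat_expectation M c c (\<lambda>\<omega>. transpose_mat (A i \<omega>) * A j \<omega>)) \<le> (s_coeff M r c A n)\<^sup>2"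
    if "i \<in> {1..int n}" "j \<in> {1..int n}"
    using le[OF that] nonneg by (simp_all add: s f_def)
qed

theorem corollary4p2:
  fixes M :: "'a measure" and S :: "'x measure"
    and X :: "int \<Rightarrow> 'a \<Rightarrow> 'x"
    and \<Xi> :: "nat \<Rightarrow> 'x \<Rightarrow> real mat"
    and d1 d2 q :: "nat \<Rightarrow> nat" and R s :: "nat \<Rightarrow> real"
  assumes "prob_space M"
    and "\<And>i. X i \<in> measurable M S"
    and "beta_mixing M S X"
    and "\<And>n. n \<ge> 1 \<Longrightarrow> d1 n \<ge> 1 \<and> d2 n \<ge> 1"
    and "\<And>n x. n \<ge> 1 \<Longrightarrow> x \<in> space S \<Longrightarrow> \<Xi> n x \<in> carrier_mat (d1 n) (d2 n)"
    and "\<And>n k l. n \<ge> 1 \<Longrightarrow> k < d1 n \<Longrightarrow> l < d2 n \<Longrightarrow>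
           (\<lambda>x. \<Xi> n x $$ (k, l)) \<in> borel_measurable S"
    and "\<And>n i. n \<ge> 1 \<Longrightarrow>
           mat_expectation M (d1 n) (d2 n) (\<lambda>\<omega>. \<Xi> n (X i \<omega>)) = 0\<^sub>m (d1 n) (d2 n)"
    and "\<And>n i. n \<ge> 1 \<Longrightarrow> AE \<omega> in M. spectral_norm (\<Xi> n (X i \<omega>)) \<le> R n"
    and "\<And>n. n \<ge> 1 \<Longrightarrow> s n = s_coeff M (d1 n) (d2 n) (\<lambda>i \<omega>. \<Xi> n (X i \<omega>)) n"
    and "\<And>n. n \<ge> 2 \<Longrightarrow> 1 \<le> q n \<and> real (q n) \<le> real n / 2"
    and "(\<lambda>n. real n / real (q n) * beta_coeff M S X (q n)) \<in> o(\<lambda>_. 1)"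
    and "(\<lambda>n. R n * sqrt (real (q n) * ln (real (d1 n + d2 n)))) \<in> o(\<lambda>n. s n * sqrt (real n))"
  shows "big_o_p M
           (\<lambda>n \<omega>. spectral_norm (mat_sum (d1 n) (d2 n) (\<lambda>i. \<Xi> n (X i \<omega>)) {1..int n}))
           (\<lambda>n. s n * sqrt (real n * real (q n) * ln (real (d1 n + d2 n))))"
proof -
  note X = assms(2) and beta_small = assms(11) and R_small = assms(12)
  interpret prob_space M by fact
  define w where "w n x p = \<Xi> n x $$ p" for n x and p :: "nat \<times> nat"
  define T where "T n \<omega> = nrm (d1 n) (d2 n) (\<lambda>p. \<Sum>i\<in>{1..int n}. w n (X i \<omega>) p)" for n \<omega>
  define a where "a n = s n * sqrt (real n * real (q n) * ln (real (d1 n + d2 n)))" for n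
  have T: "spectral_norm (mat_sum (d1 n) (d2 n) (\<lambda>i. \<Xi> n (X i \<omega>)) {1..int n}) = T n \<omega>" for n \<omega>
    unfolding T_def nrm_def mat_sum_def w_def by (simp add: case_prod_beta')
  have meas: "(\<lambda>x. w n x p) \<in> borel_measurable S" if "n \<ge> 1" "p \<in> {..<d1 n} \<times> {..<d2 n}" for n p
    using assms(6)[OF that(1), of "fst p" "snd p"] that(2) by (auto simp: w_def)
  have bnd: "AE \<omega> in M. nrm (d1 n) (d2 n) (w n (X i \<omega>)) \<le> R n" if "n \<ge> 1" for n i
    using assms(8)[OF that, of i] AE_space
  proof eventually_elim
    fix \<omega> assume "spectral_norm (\<Xi> n (X i \<omega>)) \<le> R n" "\<omega> \<in> space M"
    then show "nrm (d1 n) (d2 n) (w n (X i \<omega>)) \<le> R n"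
      using spectral_norm_eq_nrm[OF assms(5)[OF that measurable_space[OF X]], of \<omega> i] by (simp add: w_def[abs_def])
  qed
  have mean: "(\<integral>\<omega>. w n (X i \<omega>) p \<partial>M) = 0" if "n \<ge> 1" "p \<in> {..<d1 n} \<times> {..<d2 n}" for n i p
    using arg_cong[OF assms(7)[OF that(1), of i], of "\<lambda>A. A $$ p"] that(2)
    by (auto simp: mat_expectation_def w_def)
  have carr: "\<omega> \<in> space M \<Longrightarrow> \<Xi> n (X i \<omega>) \<in> carrier_mat (d1 n) (d2 n) \<and> \<Xi> n (X j \<omega>) \<in> carrier_mat (d1 n) (d2 n)"
    if "n \<ge> 1" for n i j \<omega>
    using assms(5)[OF that] measurable_space[OF X] by blast
  have s0: "0 \<le> s n" if "n \<ge> 1" for n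
    unfolding assms(9)[OF that] using assms(4)[OF that] by (intro s_coeff_bounds(1) that) auto
  have V1: "nrm (d2 n) (d2 n) (\<lambda>(l, l'). \<integral>\<omega>. (\<Sum>k<d1 n. w n (X i \<omega>) (k, l) * w n (X j \<omega>) (k, l')) \<partial>M) \<le> (s n)\<^sup>2"
    if "n \<ge> 1" "i \<in> {1..int n}" "j \<in> {1..int n}" for n i j
  proof -
    have "nrm (d2 n) (d2 n) (\<lambda>(l, l'). \<integral>\<omega>. (\<Sum>k<d1 n. w n (X i \<omega>) (k, l) * w n (X j \<omega>) (k, l')) \<partial>M)
      = spectral_norm (mat_expectation M (d2 n) (d2 n) (\<lambda>\<omega>. transpose_mat (\<Xi> n (X i \<omega>)) * \<Xi> n (X j \<omega>)))"
      unfolding w_def by (rule mat_expectation_product(1)[symmetric]) (rule carr[OF that(1)])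
    also have "\<dots> \<le> (s n)\<^sup>2"
      unfolding assms(9)[OF that(1)] using assms(4)[OF that(1)] that
      by (intro s_coeff_bounds(3)[where A = "\<lambda>i \<omega>. \<Xi> n (X i \<omega>)"]) auto
    finally show ?thesis .
  qed
  have V2: "nrm (d1 n) (d1 n) (\<lambda>(k, k'). \<integral>\<omega>. (\<Sum>l<d2 n. w n (X i \<omega>) (k, l) * w n (X j \<omega>) (k', l)) \<partial>M) \<le> (s n)\<^sup>2"
    if "n \<ge> 1" "i \<in> {1..int n}" "j \<in> {1..int n}" for n i j
  proof -
    have "nrm (d1 n) (d1 n) (\<lambda>(k, k'). \<integral>\<omega>. (\<Sum>l<d2 n. w n (X i \<omega>) (k, l) * w n (X j \<omega>) (k', l)) \<partial>M)
      = spectral_norm (mat_expectation M (d1 n) (d1 n) (\<lambda>\<omega>. \<Xi> n (X i \<omega>) * transpose_mat (\<Xi> n (X j \<omega>))))"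
      unfolding w_def by (rule mat_expectation_product(2)[symmetric]) (rule carr[OF that(1)])
    also have "\<dots> \<le> (s n)\<^sup>2"
      unfolding assms(9)[OF that(1)] using assms(4)[OF that(1)] that
      by (intro s_coeff_bounds(2)[where A = "\<lambda>i \<omega>. \<Xi> n (X i \<omega>)"]) auto
    finally show ?thesis .
  qed
  have wX: "(\<lambda>\<omega>. w n (X i \<omega>) p) \<in> borel_measurable M" if "n \<ge> 1" "p \<in> {..<d1 n} \<times> {..<d2 n}" for n i p
    using measurable_compose[OF X meas[OF that]] .
  have TM: "T n \<in> borel_measurable M" if "n \<ge> 1" for n
    unfolding T_def
    using lipschitz_measurable[of "nrm (d1 n) (d2 n)" 1 "{..<d1 n} \<times> {..<d2 n}"
        "\<lambda>\<omega> p. \<Sum>i\<in>{1..int n}. w n (X i \<omega>) p" M] nrm_lipschitz[of "d2 n" "d1 n"] assms(4)[OF that] wX[OF that]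
    by simp
  have T0: "0 \<le> T n \<omega>" if "n \<ge> 1" for n \<omega>
    unfolding T_def using assms(4)[OF that] by (intro nrm_bound(3)) simp
  show ?thesis
    unfolding big_o_p_def T a_def[symmetric]
  proof (intro allI impI)
    fix \<epsilon> :: real assume "\<epsilon> > 0"
    obtain k :: nat where k: "(1 / 2) ^ k < \<epsilon> / 4"
      using real_arch_pow_inv[of "\<epsilon> / 4" "1 / 2"] \<open>\<epsilon> > 0\<close> by auto
    \<comment> \<open>As \<open>d1 n + d2 n\<close> is at least \<open>2\<close>, the tail \<open>exp ((3 - C) ln (d1 n + d2 n))\<close> is at most \<open>2\<^sup>-\<^sup>k\<close>.\<close>
    define C where "C = 3 + real k"
    have tail: "measure M {\<omega> \<in> space M. \<bar>T n \<omega>\<bar> > 4 * C * a n} < \<epsilon>"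
      if n: "n \<ge> 2" and b: "norm (real n / real (q n) * beta_coeff M S X (q n)) \<le> \<epsilon> / 16 * norm (1 :: real)"
        and Rn: "norm (R n * sqrt (real (q n) * ln (real (d1 n + d2 n)))) \<le> 1 * norm (s n * sqrt (real n))" for n
    proof -
      have n1: "n \<ge> 1" using n by simp
      have d: "d1 n \<ge> 1" "d2 n \<ge> 1" using assms(4)[OF n1] by auto
      have q: "1 \<le> q n" "real (q n) \<le> real n / 2" using assms(10)[OF n] by auto
      define L where "L = ln (real (d1 n + d2 n))"
      have L: "L \<ge> ln 2" using d by (simp add: L_def)
      have absT: "\<bar>T n \<omega>\<bar> = T n \<omega>" for \<omega> using T0[OF n1] by simp
      show ?thesis
      \<comment> \<open>If \<open>s n = 0\<close>, the assumption on \<open>R n\<close> forces \<open>R n = 0\<close>, and the sum vanishes almost surely.\<close>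
      proof (cases "s n = 0")
        case False
        then have s: "s n > 0" using s0[OF n1] by simp
        have "measure M {\<omega> \<in> space M. T n \<omega> > 4 * C * a n}
            \<le> 2 * exp ((3 - C) * L) + 4 * \<bar>real n / real (q n) * beta_coeff M S X (q n)\<bar>"
          unfolding T_def a_def L_def
        proof (rule mixing_matrix_tail_bound_log_scale[OF assms(1) X d q s])
          show "R n * sqrt (real (q n) * ln (real (d1 n + d2 n))) \<le> s n * sqrt (real n)"
            using Rn abs_ge_self[of "R n * sqrt (real (q n) * ln (real (d1 n + d2 n)))"]
              abs_of_nonneg[of "s n * sqrt (real n)"] s
            unfolding real_norm_def by simp
        qed (use meas bnd mean V1 V2 n1 in \<open>simp_all add: C_def\<close>)
        also have "\<dots> \<le> 2 * (1 / 2) ^ k + 4 * (\<epsilon> / 16)"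
        proof (intro add_mono mult_left_mono)
          have "exp ((3 - C) * L) \<le> exp (real k * (- ln 2))"
            using L by (simp add: C_def mult_left_mono)
          also have "\<dots> = exp (- ln 2) ^ k" by (rule exp_of_nat_mult)
          also have "\<dots> = (1 / 2) ^ k" by (simp add: exp_minus inverse_eq_divide)
          finally show "exp ((3 - C) * L) \<le> (1 / 2) ^ k" .
        qed (use b in auto)
        also have "\<dots> < \<epsilon>" using k \<open>\<epsilon> > 0\<close> by simp
        finally show ?thesis by (simp add: absT)
      next
        case True
        have "R n = 0"
        proof -
          have "R n * sqrt (real (q n) * L) = 0" using Rn True by (simp add: L_def)
          moreover have "L > 0" using L ln_2_less_1 less_le_trans[of 0 "ln 2" L] by simp
          then have "sqrt (real (q n) * L) \<noteq> 0" using q by simp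
          ultimately show ?thesis by (simp only: mult_eq_0_iff) blast
        qed
        have "AE \<omega> in M. \<forall>i\<in>{1..int n}. nrm (d1 n) (d2 n) (w n (X i \<omega>)) \<le> 0"
          by (rule AE_finite_allI) (use bnd[OF n1] \<open>R n = 0\<close> in auto)
        then have AE: "AE \<omega> in M. \<omega> \<notin> {\<omega> \<in> space M. T n \<omega> > 0}"
        proof eventually_elim
          fix \<omega> assume "\<forall>i\<in>{1..int n}. nrm (d1 n) (d2 n) (w n (X i \<omega>)) \<le> 0"
          then have "(\<Sum>i\<in>{1..int n}. nrm (d1 n) (d2 n) (w n (X i \<omega>))) \<le> 0"
            by (intro sum_nonpos) auto
          then have "T n \<omega> \<le> 0"
            unfolding T_def using nrm_sum_le[OF d(2), where r = "d1 n" and J = "{1..int n}" and W = "\<lambda>i. w n (X i \<omega>)"] by linarith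
          then show "\<omega> \<notin> {\<omega> \<in> space M. T n \<omega> > 0}" by simp
        qed
        moreover have "{\<omega> \<in> space M. T n \<omega> > 0} \<in> sets M"
          using TM[OF n1] by measurable
        ultimately have "measure M {\<omega> \<in> space M. T n \<omega> > 0} = 0"
          by (simp add: prob_eq_0)
        then show ?thesis using \<open>\<epsilon> > 0\<close> True by (simp add: absT a_def)
      qed
    qed
    have one: "0 < (1 :: real)" by simp
    have \<epsilon>16: "0 < \<epsilon> / 16" using \<open>\<epsilon> > 0\<close> by simp
    have "\<forall>\<^sub>F n in sequentially. T n \<in> borel_measurable M \<and> measure M {\<omega> \<in> space M. \<bar>T n \<omega>\<bar> > 4 * C * a n} < \<epsilon>"
      using landau_o.smallD[OF beta_small \<epsilon>16] landau_o.smallD[OF R_small one] eventually_ge_at_top[of 2]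
    proof eventually_elim
      case (elim n)
      then show ?case using tail[of n] TM[of n] by simp
    qed
    then show "\<exists>C>0. \<forall>\<^sub>F n in sequentially. T n \<in> borel_measurable M \<and> measure M {\<omega> \<in> space M. C * a n < \<bar>T n \<omega>\<bar>} < \<epsilon>"
      by (intro exI[of _ "4 * C"]) (simp add: C_def)
  qed
qed

end
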